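(* Let $\phi\in L^\infty(B)$ be real-valued and suppose that either $$\operatorname{ess\,sup}\{\phi(z):z\in B_q\}=m<0<M=\operatorname{ess\,inf}\{\phi(z):z\in B_1\}$$ or $$\operatorname{ess\,sup}\{\phi(z):z\in B_1\}=m<0<M=\operatorname{ess\,inf}\{\phi(z):z\in B_q\}.$$ If either $$\int_B\log|\phi-M|\,d\mu=-\infty\qquad\text{or}\qquad\int_B\log|\phi-m|\,d\mu=-\infty,$$ then for each $\alpha\in[0,1)$ the Toeplitz operator $T^\alpha_\phi$ has infinitely many eigenvalues in the interval $(m,M)$.
   Context: Fix $0<q<1$ and let $\mathbb A=\{z\in\mathbb C: q<|z|<1\}$, with boundary $B=B_1\cup B_q$, where $B_1=\{|z|=1\}$ and $B_q=\{|z|=q\}$. For $j\in\{1,q\}$, $\mu_j$ is the multiple of arclength measure on $B_j$ with $\mu_j(B_j)=2\pi$, and $\mu=\mu_1+\mu_q$. The spaces $L^p=L^p(B)$ are taken with respect to $\mu$. Write $\chi(z)=z$. Hardy spaces: $H^2_0$ is the closure in $L^2(B)$ of the Laurent polynomials. For $\alpha\in[0,1)$, $H^2_\alpha=\{\chi^\alpha f: f\in H^2_0\}$, regarded as a closed subspace of $L^2(B)$ by fixing the branch $\chi^\alpha(re^{it})=r^\alpha e^{i\alpha t}$, $0\le t<2\pi$. Toeplitz operators: for real-valued $\phi\in L^\infty(B)$, $T^\alpha_\phi:H^2_\alpha\to H^2_\alpha$ is $T^\alpha_\phi f=P_\alpha(\phi f)$, where $P_\alpha$ is the orthogonal projection of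 $L^2(B)$ onto $H^2_\alpha$. *)

theory Defs
  imports "HOL-Probability.Probability"
begin

section \<open>The boundary of the annulus\<close>

text \<open>
  Arclength on \<open>|z| = r\<close> is the image of \<open>r dt\<close> under \<open>t \<mapsto> r exp(it)\<close>, so its multiple of total
  mass \<open>2 pi\<close> is the image of \<open>dt\<close>. Measures on the boundary are taken as Borel measures on the
  plane concentrated on the boundary circles.
\<close>

definition circle_measure :: "real \<Rightarrow> complex measure" where
  "circle_measure r =
     distr (restrict_space lborel {0..<2 * pi}) borel (\<lambda>t. of_real r * cis t)"

definition boundary_measure :: "real \<Rightarrow> complex measure" where
  "boundary_measure q =
     measure_of UNIV (sets borel)
       (\<lambda>A. emeasure (circle_measure 1) A + emeasure (circle_measure q) A)"

lemma circle_map_measurable: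
  "(\<lambda>t. of_real r * cis t) \<in> measurable (restrict_space lborel {0..<2 * pi}) borel"
proof -
  have "(\<lambda>t. of_real r * cis t) \<in> borel_measurable borel"
    unfolding cis_conv_exp by measurable
  then show ?thesis
    by (intro measurable_restrict_space1) simp
qed

lemma space_circle_measure [simp]: "space (circle_measure r) = UNIV"
  and sets_circle_measure [simp, measurable_cong]: "sets (circle_measure r) = sets borel"
  by (simp_all add: circle_measure_def)

lemma emeasure_circle_measure_UNIV: "emeasure (circle_measure r) UNIV = ennreal (2 * pi)"
  by (simp add: circle_measure_def emeasure_distr[OF circle_map_measurable]
      space_restrict_space emeasure_restrict_space)

lemma AE_circle_measure: "r \<ge> 0 \<Longrightarrow> AE z in circle_measure r. z \<in> sphere 0 r"
  unfolding circle_measure_def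
  by (subst AE_distr_iff[OF circle_map_measurable]) (simp_all add: norm_mult)

lemma space_boundary_measure [simp]: "space (boundary_measure q) = UNIV"
  and sets_boundary_measure [simp, measurable_cong]: "sets (boundary_measure q) = sets borel"
  using sets.sigma_sets_eq[of "borel :: complex measure"]
  by (auto simp: boundary_measure_def)

lemma emeasure_boundary_measure:
  assumes "A \<in> sets borel"
  shows "emeasure (boundary_measure q) A =
           emeasure (circle_measure 1) A + emeasure (circle_measure q) A"
proof (rule emeasure_measure_of[OF boundary_measure_def])
  show "countably_additive (sets (boundary_measure q))
          (\<lambda>A. emeasure (circle_measure 1) A + emeasure (circle_measure q) A)"
  proof (rule countably_additiveI)
    fix A :: "nat \<Rightarrow> complex set"
    assume "range A \<subseteq> sets (boundary_measure q)" "disjoint_family A"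
    then show "(\<Sum>i. emeasure (circle_measure 1) (A i) + emeasure (circle_measure q) (A i)) =
        emeasure (circle_measure 1) (\<Union>i. A i) + emeasure (circle_measure q) (\<Union>i. A i)"
      by (simp add: suminf_add[symmetric] suminf_emeasure)
  qed
qed (use assms in \<open>auto simp: positive_def\<close>)


section \<open>Square-integrable functions\<close>

text \<open>
  Elements of the \<open>L\<^sup>2\<close> space are represented by functions, and equality of elements by equality
  almost everywhere.
\<close>

definition L2 :: "real \<Rightarrow> (complex \<Rightarrow> complex) set" where
  "L2 q = {f \<in> borel_measurable (boundary_measure q).
             integrable (boundary_measure q) (\<lambda>z. (cmod (f z))\<^sup>2)}"

definition L2_inner :: "real \<Rightarrow> (complex \<Rightarrow> complex) \<Rightarrow> (complex \<Rightarrow> complex) \<Rightarrow> complex" where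
  "L2_inner q f g = (\<integral>z. f z * cnj (g z) \<partial>boundary_measure q)"

definition L2_norm :: "real \<Rightarrow> (complex \<Rightarrow> complex) \<Rightarrow> real" where
  "L2_norm q f = sqrt (\<integral>z. (cmod (f z))\<^sup>2 \<partial>boundary_measure q)"

definition real_Linfty :: "real \<Rightarrow> (complex \<Rightarrow> real) set" where
  "real_Linfty q = {\<phi> \<in> borel_measurable (boundary_measure q).
                      esssup (boundary_measure q) (\<lambda>z. ereal \<bar>\<phi> z\<bar>) < \<infinity>}"


section \<open>Hardy spaces\<close>

definition laurent_polynomials :: "(complex \<Rightarrow> complex) set" where
  "laurent_polynomials =
     {(\<lambda>z. \<Sum>k\<in>{- int n..int n}. c k * z powi k) | (c :: int \<Rightarrow> complex) (n :: nat). True}"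

definition H2_0 :: "real \<Rightarrow> (complex \<Rightarrow> complex) set" where
  "H2_0 q = {f \<in> L2 q. \<forall>\<epsilon>>0. \<exists>p\<in>laurent_polynomials. L2_norm q (\<lambda>z. f z - p z) < \<epsilon>}"

text \<open>\<^const>\<open>Arg2pi\<close> takes its values in \<open>[0, 2 pi)\<close>, the branch used for \<open>\<chi>\<^sup>\<alpha>\<close>.\<close>

definition chi_pow :: "real \<Rightarrow> complex \<Rightarrow> complex" where
  "chi_pow \<alpha> z = of_real (cmod z powr \<alpha>) * cis (\<alpha> * Arg2pi z)"

definition H2 :: "real \<Rightarrow> real \<Rightarrow> (complex \<Rightarrow> complex) set" where
  "H2 q \<alpha> = {g \<in> L2 q. \<exists>f\<in>H2_0 q. AE z in boundary_measure q. g z = chi_pow \<alpha> z * f z}"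


section \<open>Toeplitz operators\<close>

text \<open>
  The orthogonal projection of \<open>g\<close> is the element \<open>h\<close> of the closed subspace with \<open>g - h\<close>
  orthogonal to the subspace; it is determined up to equality almost everywhere, and a
  representative is chosen.
\<close>

definition H2_proj :: "real \<Rightarrow> real \<Rightarrow> (complex \<Rightarrow> complex) \<Rightarrow> (complex \<Rightarrow> complex)" where
  "H2_proj q \<alpha> g =
     (SOME h. h \<in> H2 q \<alpha> \<and> (\<forall>u\<in>H2 q \<alpha>. L2_inner q (\<lambda>z. g z - h z) u = 0))"

definition toeplitz ::
    "real \<Rightarrow> real \<Rightarrow> (complex \<Rightarrow> real) \<Rightarrow> (complex \<Rightarrow> complex) \<Rightarrow> (complex \<Rightarrow> complex)" where
  "toeplitz q \<alpha> \<phi> f = H2_proj q \<alpha> (\<lambda>z. of_real (\<phi> z) * f z)"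

definition toeplitz_eigenvalue :: "real \<Rightarrow> real \<Rightarrow> (complex \<Rightarrow> real) \<Rightarrow> complex \<Rightarrow> bool" where
  "toeplitz_eigenvalue q \<alpha> \<phi> w \<longleftrightarrow>
     (\<exists>f\<in>H2 q \<alpha>. \<not> (AE z in boundary_measure q. f z = 0) \<and>
        (AE z in boundary_measure q. toeplitz q \<alpha> \<phi> f z = w * f z))"


section \<open>Essential infimum and extended-valued integrals\<close>

definition essinf :: "'a measure \<Rightarrow> ('a \<Rightarrow> ereal) \<Rightarrow> ereal" where
  "essinf M f = - esssup M (\<lambda>x. - f x)"

text \<open>The library function \<^term>\<open>ln\<close> has value \<open>0\<close> at \<open>0\<close>; here \<open>log 0\<close> must be \<open>-\<infinity>\<close>.\<close>

definition log_abs :: "real \<Rightarrow> ereal" where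
  "log_abs x = (if x = 0 then - \<infinity> else ereal (ln \<bar>x\<bar>))"

text \<open>
  The integral of the positive part minus that of the negative part. As \<open>\<infinity> - \<infinity> = \<infinity>\<close> in
  \<^typ>\<open>ereal\<close>, the value is \<open>-\<infinity>\<close> exactly when the positive part has finite integral and the
  negative part has infinite integral.
\<close>

definition ext_integral :: "'a measure \<Rightarrow> ('a \<Rightarrow> ereal) \<Rightarrow> ereal" where
  "ext_integral M f =
     enn2ereal (\<integral>\<^sup>+ x. e2ennreal (f x) \<partial>M) - enn2ereal (\<integral>\<^sup>+ x. e2ennreal (- f x) \<partial>M)"

lemma ext_integral_eq_MInf_iff:
  "ext_integral M f = - \<infinity> \<longleftrightarrow>
     (\<integral>\<^sup>+ x. e2ennreal (f x) \<partial>M) < \<infinity> \<and> (\<integral>\<^sup>+ x. e2ennreal (- f x) \<partial>M) = \<infinity>"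
proof -
  have "enn2ereal a - enn2ereal b = - \<infinity> \<longleftrightarrow> a < \<infinity> \<and> b = \<infinity>" for a b :: ennreal
    by (cases a; cases b) (simp_all add: enn2ereal_ennreal)
  then show ?thesis
    by (simp add: ext_integral_def)
qed

end

theory Submission
  imports Defs
begin

text \<open>
  Let \<open>x\<close> lie in the gap and put \<open>L = ln \<bar>\<phi> - x\<bar>\<close>, a bounded function on \<open>B\<close> with means \<open>a\<close> on \<open>B\<^sub>1\<close>
  and \<open>b\<close> on \<open>B\<^sub>q\<close>. The Dirichlet problem with boundary values \<open>(a - L) / 2\<close> on \<open>B\<^sub>1\<close> and
  \<open>(b - L) / 2\<close> on \<open>B\<^sub>q\<close> is solved by the real part of a single-valued analytic function \<open>h\<close>, since
  the boundary values have mean zero on each circle. Then \<open>f = \<chi>\<^sup>\<alpha> z\<^sup>k exp h\<close> is in the Hardy space, and on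
  each circle \<open>(\<phi> - x) exp h\<close> is a constant times the conjugate of \<open>exp (- h)\<close>; the constants have
  opposite signs on the two circles. By Cauchy's theorem \<open>(\<phi> - x) f\<close> is orthogonal to the Hardy space
  as soon as the constants match, that is if \<open>a - b = 2 (\<alpha> + k) ln q\<close> for some integer \<open>k\<close>.
  As a function of \<open>x\<close>, \<open>a - b\<close> is continuous on \<open>(m, M)\<close>, and the divergence of the logarithmic
  integral makes it unbounded, so it takes infinitely many of the values \<open>2 (\<alpha> + k) ln q\<close>.
  Boundary values of analytic functions are avoided: \<open>h\<close> is obtained as an almost everywhere
  limit of Laurent polynomials on \<open>B\<close> whose real parts are uniformly bounded there.
\<close>

section \<open>Integration over the boundary\<close>

text \<open>The first obstacle is the period of the harmonic conjugate: a harmonic function on the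
  annulus is the real part of a single-valued analytic function only if its means on the two circles
  agree. Removing the means \<open>a\<close> and \<open>b\<close> disposes of the period but leaves
  the factors \<open>exp a\<close> and \<open>exp b\<close>. Their ratio can be absorbed only by
  |z|^(2(\<alpha>+k)), which is 1 on the outer circle and q^(2(\<alpha>+k)) on the inner one; hence
  a discrete set of admissible differences. The second obstacle is that the conjugate of a bounded
  function may be unbounded, so that \<open>h\<close> itself is controlled only in L2. But only
  \<open>exp h\<close> and \<open>exp (- h)\<close> enter, and their moduli depend on Re h alone:
  uniform bounds on real parts, together with convergence almost everywhere, provide constant
  majorants for every passage to the limit. With integrals in place of means, each circle having
  mass 2 pi, the step 2 ln q of the progression becomes 4 pi ln q.\<close>

lemma nn_integral_boundary_measure:
  assumes "f \<in> borel_measurable borel"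
  shows "(\<integral>\<^sup>+z. f z \<partial>boundary_measure q) =
     (\<integral>\<^sup>+z. f z \<partial>circle_measure 1) + (\<integral>\<^sup>+z. f z \<partial>circle_measure q)"
  using assms
proof (induction rule: borel_measurable_induct)
  case (cong f g)
  then show ?case by (simp cong: nn_integral_cong)
next
  case (set A)
  then show ?case by (simp add: emeasure_boundary_measure)
next
  case (mult u c)
  then show ?case by (simp add: nn_integral_cmult distrib_left)
next
  case (add u v)
  then show ?case by (simp add: nn_integral_add ac_simps)
next
  case (seq U)
  have "(\<integral>\<^sup>+z. (SUP i. U i z) \<partial>M) = (SUP i. \<integral>\<^sup>+z. U i z \<partial>M)" if "sets M = sets borel" for M
    using seq that measurable_cong_sets[OF that refl]
    by (intro nn_integral_monotone_convergence_SUP) (auto simp: measurable_def)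
  moreover have "incseq (\<lambda>i. \<integral>\<^sup>+z. U i z \<partial>M)" for M
    using seq(3) by (intro incseq_SucI nn_integral_mono) (auto simp: incseq_Suc_iff le_fun_def)
  ultimately show ?case
    using seq by (simp add: image_comp SUP_apply[abs_def] ennreal_SUP_add[symmetric])
qed

lemma AE_boundary_measure_iff:
  "(AE z in boundary_measure q. P z) \<longleftrightarrow>
     (AE z in circle_measure 1. P z) \<and> (AE z in circle_measure q. P z)"
proof safe
  assume "AE z in boundary_measure q. P z"
  then obtain N where N: "{z. \<not> P z} \<subseteq> N" "N \<in> sets borel" "emeasure (boundary_measure q) N = 0"
    by (auto elim!: AE_E)
  then have "emeasure (circle_measure 1) N = 0" "emeasure (circle_measure q) N = 0"
    by (auto simp: emeasure_boundary_measure)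
  then show "AE z in circle_measure 1. P z" "AE z in circle_measure q. P z"
    using N by (auto intro!: AE_I[where N=N])
next
  assume "AE z in circle_measure 1. P z" "AE z in circle_measure q. P z"
  then obtain N N' where N: "{z. \<not> P z} \<subseteq> N" "N \<in> sets borel" "emeasure (circle_measure 1) N = 0"
     "{z. \<not> P z} \<subseteq> N'" "N' \<in> sets borel" "emeasure (circle_measure q) N' = 0"
    by (auto elim!: AE_E)
  \<comment> \<open>The exceptional set of \<open>P\<close> lies in both \<open>N\<close> and
    \<open>N'\<close>, hence in their intersection, which is null for both circles; the union need
    not be.\<close>
  have "emeasure (circle_measure 1) (N \<inter> N') = 0" "emeasure (circle_measure q) (N \<inter> N') = 0"
    using N emeasure_mono[of "N \<inter> N'" N "circle_measure 1"]
      emeasure_mono[of "N \<inter> N'" N' "circle_measure q"] by auto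
  then show "AE z in boundary_measure q. P z"
    using N by (intro AE_I[where N="N \<inter> N'"]) (auto simp: emeasure_boundary_measure)
qed

lemma finite_circle_measure [simp]: "finite_measure (circle_measure r)"
  by (rule finite_measureI) (simp add: emeasure_circle_measure_UNIV)

lemma finite_boundary_measure [simp]: "finite_measure (boundary_measure q)"
  by (rule finite_measureI) (simp add: emeasure_boundary_measure emeasure_circle_measure_UNIV)

lemma measure_circle_measure [simp]: "measure (circle_measure r) UNIV = 2 * pi"
  by (simp add: measure_def emeasure_circle_measure_UNIV)

lemma measure_boundary_measure [simp]: "measure (boundary_measure q) UNIV = 4 * pi"
  by (simp add: measure_def emeasure_boundary_measure emeasure_circle_measure_UNIV
      flip: ennreal_plus)

lemma integrable_boundary_measure_iff:
  fixes f :: "complex \<Rightarrow> 'b::{banach, second_countable_topology}"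
  assumes "f \<in> borel_measurable borel"
  shows "integrable (boundary_measure q) f \<longleftrightarrow>
     integrable (circle_measure 1) f \<and> integrable (circle_measure q) f"
  using assms by (auto simp: integrable_iff_bounded nn_integral_boundary_measure)

lemma integral_boundary_measure:
  fixes f :: "complex \<Rightarrow> 'b::{banach, second_countable_topology}"
  assumes "integrable (boundary_measure q) f"
  shows "(\<integral>z. f z \<partial>boundary_measure q) =
     (\<integral>z. f z \<partial>circle_measure 1) + (\<integral>z. f z \<partial>circle_measure q)"
  using assms
proof (induction rule: integrable_induct)
  case (base A c)
  then have "emeasure (circle_measure 1) A < \<infinity>" "emeasure (circle_measure q) A < \<infinity>"
    by (simp_all add: emeasure_boundary_measure)
  then show ?case using base
    by (simp add: measure_def emeasure_boundary_measure enn2real_plus scaleR_add_left)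
next
  case (add f g)
  then show ?case
    using integrable_boundary_measure_iff[of f q] integrable_boundary_measure_iff[of g q]
      borel_measurable_integrable[of "boundary_measure q" f]
      borel_measurable_integrable[of "boundary_measure q" g] by simp
next
  case (lim f s)
  have f: "integrable (circle_measure 1) f" "integrable (circle_measure q) f"
      "f \<in> borel_measurable borel"
    using lim integrable_boundary_measure_iff[of f q]
      borel_measurable_integrable[of "boundary_measure q" f] by auto
  have s: "s i \<in> borel_measurable borel" for i
    using lim borel_measurable_integrable[of "boundary_measure q" "s i"] by simp
  have *: "(\<lambda>i. \<integral>z. s i z \<partial>M) \<longlonglongrightarrow> (\<integral>z. f z \<partial>M)"
    if M: "sets M = sets borel" "space M = UNIV" "integrable M f" for M
  proof (rule integral_dominated_convergence[where w="\<lambda>z. 2 * norm (f z)"])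
    show "f \<in> borel_measurable M" "s i \<in> borel_measurable M" for i
      using f s M(1) by (simp_all add: measurable_cong_sets[OF M(1) refl])
  qed (use lim M in auto)
  have "(\<lambda>i. \<integral>z. s i z \<partial>boundary_measure q) \<longlonglongrightarrow> (\<integral>z. f z \<partial>boundary_measure q)"
    by (rule *) (use lim in auto)
  moreover have "(\<lambda>i. \<integral>z. s i z \<partial>boundary_measure q)
      \<longlonglongrightarrow> (\<integral>z. f z \<partial>circle_measure 1) + (\<integral>z. f z \<partial>circle_measure q)"
    unfolding lim.IH by (intro tendsto_add *) (use f in auto)
  ultimately show ?case by (rule LIMSEQ_unique)
qed

section \<open>Angular coordinates and orthogonality of the exponentials\<close>

abbreviation angle_measure :: "real measure" where
  "angle_measure \<equiv> restrict_space lborel {0..<2 * pi}"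

lemma finite_angle_measure [simp]: "finite_measure angle_measure"
  by (rule finite_measureI) (simp add: emeasure_restrict_space space_restrict_space)

lemma measure_angle_measure [simp]: "measure angle_measure {0..<2 * pi} = 2 * pi"
  by (simp add: measure_restrict_space)

lemma space_angle_measure [simp]: "space angle_measure = {0..<2 * pi}"
  by (simp add: space_restrict_space)

lemma measurable_angle [measurable (raw)]:
  "f \<in> borel_measurable borel \<Longrightarrow> f \<in> borel_measurable angle_measure"
  by (intro measurable_restrict_space1) simp

lemma integral_circle_measure:
  fixes f :: "complex \<Rightarrow> 'b::{banach, second_countable_topology}"
  assumes "f \<in> borel_measurable borel"
  shows "(\<integral>z. f z \<partial>circle_measure r) = (\<integral>t. f (of_real r * cis t) \<partial>angle_measure)"
  unfolding circle_measure_def by (rule integral_distr[OF circle_map_measurable assms])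

lemma AE_circle_measure_iff:
  assumes "Measurable.pred borel P"
  shows "(AE z in circle_measure r. P z) \<longleftrightarrow> (AE t in angle_measure. P (of_real r * cis t))"
  unfolding circle_measure_def
  using assms by (subst AE_distr_iff[OF circle_map_measurable]) (auto simp: pred_def)

lemma AE_angle_measure_iff:
  "(AE t in angle_measure. P t) \<longleftrightarrow> (AE t in lborel. 0 \<le> t \<and> t < 2 * pi \<longrightarrow> P t)"
  by (subst AE_restrict_space_iff) auto

lemma integral_cis:
  fixes k :: int
  shows "(\<integral>t. cis (of_int k * t) \<partial>angle_measure) = (if k = 0 then 2 * pi else 0)"
proof (cases "k = 0")
  case False
  have "(\<integral>t. cis (of_int k * t) \<partial>angle_measure) = (\<integral>t. indicator {0..<2*pi} t *\<^sub>R cis (of_int k * t) \<partial>lborel)"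
    by (subst integral_restrict_space) auto
  \<comment> \<open>The fundamental theorem of calculus is applied on the closed interval; the added
    endpoint is a null set.\<close>
  also have "\<dots> = (\<integral>t. indicator {0..2*pi} t *\<^sub>R cis (of_int k * t) \<partial>lborel)"
  proof (intro integral_cong_AE)
    have "AE t in lborel. t \<noteq> 2 * pi"
      by (rule AE_lborel_singleton)
    then show "AE t in lborel. indicat_real {0..<2*pi} t *\<^sub>R cis (of_int k * t) = indicat_real {0..2*pi} t *\<^sub>R cis (of_int k * t)"
      by eventually_elim (auto simp: indicator_def)
  qed (simp_all add: cis_conv_exp)
  also have "\<dots> = cis (of_int k * (2 * pi)) / (\<i> * of_int k) - cis (of_int k * 0) / (\<i> * of_int k)"
  proof (rule integral_FTC_atLeastAtMost)
    show "((\<lambda>t. cis (of_int k * t) / (\<i> * of_int k)) has_vector_derivative cis (of_int k * t)) (at t within {0..2*pi})" for t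
      unfolding cis_conv_exp using False
      by (auto intro!: derivative_eq_intros has_vector_derivative_real_field simp: scaleR_conv_of_real mult.commute[of _ \<i>])
  qed (auto intro!: continuous_intros)
  also have "cis (of_int k * (2 * pi)) = 1"
    by (metis cis_multiple_2pi Ints_of_int mult.commute)
  finally show ?thesis using False by simp
qed (simp add: scaleR_conv_of_real)

section \<open>Laurent polynomials\<close>

definition laurent :: "(int \<Rightarrow> complex) \<Rightarrow> nat \<Rightarrow> complex \<Rightarrow> complex" where
  "laurent c n z = (\<Sum>k\<in>{- int n..int n}. c k * z powi k)"

lemma laurent_in_laurent_polynomials: "laurent c n \<in> laurent_polynomials"
  unfolding laurent_polynomials_def laurent_def by auto

lemma laurent_polynomialsE:
  assumes "p \<in> laurent_polynomials"
  obtains c n where "p = laurent c n"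
  using assms unfolding laurent_polynomials_def laurent_def by auto

lemma laurent_extend:
  assumes "n \<le> m" "\<And>k. int n < \<bar>k\<bar> \<Longrightarrow> c k = 0"
  shows "laurent c m z = laurent c n z"
  unfolding laurent_def using assms by (intro sum.mono_neutral_right) auto

text \<open>Coefficients beyond \<open>n\<close> do not enter the value. Setting them to
  \<open>0\<close> makes \<open>laurent_extend\<close> applicable, which brings two polynomials to a
  common length.\<close>

lemma laurent_truncate: "laurent (\<lambda>k. if \<bar>k\<bar> \<le> int n then c k else 0) n z = laurent c n z"
  unfolding laurent_def by (intro sum.cong) auto

lemma laurent_diff: "laurent (\<lambda>k. c k - d k) n z = laurent c n z - laurent d n z"
  unfolding laurent_def by (simp add: algebra_simps sum_subtractf)

lemma borel_measurable_powi [measurable]: "(\<lambda>z::complex. z powi k) \<in> borel_measurable borel"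
  unfolding power_int_def by measurable

lemma borel_measurable_laurent [measurable]: "laurent c n \<in> borel_measurable borel"
  unfolding laurent_def[abs_def] by measurable

lemma borel_measurable_cis [measurable]: "(\<lambda>t. cis (c * t)) \<in> borel_measurable borel"
  unfolding cis_conv_exp by measurable

lemma powi_cis:
  assumes "r \<noteq> 0" shows "(of_real r * cis t) powi k = of_real (r powi k) * cis (of_int k * t)"
  by (simp add: power_int_mult_distrib cis_power_int)

text \<open>Equality is required only off \<open>0\<close>, since \<open>0 powi k\<close> is \<open>0\<close> for negative \<open>k\<close>, so
  that products of Laurent polynomials need not be Laurent polynomials at \<open>0\<close>.\<close>

definition is_laurent :: "(complex \<Rightarrow> complex) \<Rightarrow> bool" where
  "is_laurent f \<longleftrightarrow> (\<exists>c n. \<forall>z. z \<noteq> 0 \<longrightarrow> f z = laurent c n z)"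

lemma is_laurent_laurent: "is_laurent (laurent c n)"
  unfolding is_laurent_def by auto

lemma is_laurent_add:
  assumes "is_laurent f" "is_laurent g" shows "is_laurent (\<lambda>z. f z + g z)"
proof -
  obtain c n d m where f: "\<forall>z. z \<noteq> 0 \<longrightarrow> f z = laurent c n z"
    and g: "\<forall>z. z \<noteq> 0 \<longrightarrow> g z = laurent d m z"
    using assms unfolding is_laurent_def by auto
  let ?c = "\<lambda>k. if \<bar>k\<bar> \<le> int n then c k else 0" and ?d = "\<lambda>k. if \<bar>k\<bar> \<le> int m then d k else 0"
  have "f z + g z = laurent (\<lambda>k. ?c k + ?d k) (max n m) z" if "z \<noteq> 0" for z
  proof -
    have "f z = laurent ?c (max n m) z" "g z = laurent ?d (max n m) z"
      using that f g laurent_extend[of n "max n m" ?c] laurent_extend[of m "max n m" ?d]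
      by (auto simp: laurent_truncate)
    then show ?thesis
      by (simp add: laurent_def sum.distrib distrib_right)
  qed
  then show ?thesis
    unfolding is_laurent_def by blast
qed

lemma is_laurent_monomial: "is_laurent (\<lambda>z. a * z powi k)"
proof -
  have "a * z powi k = laurent (\<lambda>j. if j = k then a else 0) (nat \<bar>k\<bar>) z" for z
  proof -
    have "k \<in> {- int (nat \<bar>k\<bar>)..int (nat \<bar>k\<bar>)}"
      by auto
    then show ?thesis
      unfolding laurent_def by (simp only: if_distrib[of "\<lambda>x. x * _"] mult_zero_left sum.delta' sum.delta finite_atLeastAtMost_int if_True)
  qed
  then show ?thesis
    unfolding is_laurent_def by metis
qed

lemma is_laurent_const: "is_laurent (\<lambda>z. a)"
  using is_laurent_monomial[of a 0] by simp

lemma is_laurent_sum: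
  "(\<And>i. i \<in> I \<Longrightarrow> is_laurent (f i)) \<Longrightarrow> is_laurent (\<lambda>z. \<Sum>i\<in>I. f i z)"
  by (induction I rule: infinite_finite_induct) (auto intro: is_laurent_add is_laurent_const)

lemma is_laurent_cong:
  "is_laurent f \<Longrightarrow> (\<And>z. z \<noteq> 0 \<Longrightarrow> f z = g z) \<Longrightarrow> is_laurent g"
  unfolding is_laurent_def by metis

lemma is_laurent_mult:
  assumes "is_laurent f" "is_laurent g" shows "is_laurent (\<lambda>z. f z * g z)"
proof -
  obtain c n d m where f: "\<forall>z. z \<noteq> 0 \<longrightarrow> f z = laurent c n z"
    and g: "\<forall>z. z \<noteq> 0 \<longrightarrow> g z = laurent d m z"
    using assms unfolding is_laurent_def by auto
  have "is_laurent (\<lambda>z. \<Sum>i\<in>{-int n..int n}. \<Sum>j\<in>{-int m..int m}. (c i * d j) * z powi (i + j))"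
    by (intro is_laurent_sum is_laurent_monomial)
  then show ?thesis
    by (rule is_laurent_cong)
      (simp add: f g laurent_def sum_product power_int_add algebra_simps)
qed

lemma is_laurent_power: "is_laurent f \<Longrightarrow> is_laurent (\<lambda>z. f z ^ n)"
  by (induction n) (auto intro: is_laurent_mult is_laurent_const)

section \<open>Uniform approximation on both circles at once, and Cauchy's theorem\<close>

definition uniform_laurent :: "real \<Rightarrow> (complex \<Rightarrow> complex) \<Rightarrow> bool" where
  "uniform_laurent q f \<longleftrightarrow>
     (\<forall>e>0. \<exists>p. is_laurent p \<and> (\<forall>z\<in>sphere 0 1 \<union> sphere 0 q. norm (f z - p z) < e))"

text \<open>The values of the Laurent polynomial on the compact boundary lie in a disc, on which the
  exponential series converges uniformly; its partial sums, evaluated at a Laurent polynomial, are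
  Laurent polynomials.\<close>

lemma uniform_laurent_exp:
  assumes "0 < q" shows "uniform_laurent q (\<lambda>z. exp (laurent c n z))"
  unfolding uniform_laurent_def
proof (intro allI impI)
  fix e :: real assume "e > 0"
  have "continuous_on (sphere 0 1 \<union> sphere 0 q) (laurent c n)"
    unfolding laurent_def[abs_def] using assms by (intro continuous_intros) auto
  then have "bounded (laurent c n ` (sphere 0 1 \<union> sphere 0 q))"
    by (intro compact_imp_bounded compact_continuous_image compact_Un compact_sphere)
  then obtain R where R: "\<And>z. z \<in> sphere 0 1 \<union> sphere 0 q \<Longrightarrow> norm (laurent c n z) \<le> R"
    unfolding bounded_iff by (metis image_eqI)
  have "uniform_limit (cball 0 R) (\<lambda>n w. \<Sum>i<n. w ^ i /\<^sub>R fact i) (\<lambda>w. \<Sum>i. w ^ i /\<^sub>R fact i :: complex) sequentially"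
  proof (rule Weierstrass_m_test)
    show "norm (w ^ i /\<^sub>R fact i) \<le> R ^ i /\<^sub>R fact i" if "w \<in> cball 0 R" for w :: complex and i
      using that by (auto simp: norm_power divide_simps intro!: power_mono)
    show "summable (\<lambda>i. R ^ i /\<^sub>R fact i)"
      using summable_exp_generic .
  qed
  then obtain N where N: "\<And>w. w \<in> cball 0 R \<Longrightarrow> dist (\<Sum>i<N. w ^ i /\<^sub>R fact i) (exp w :: complex) < e"
    using \<open>e > 0\<close> unfolding uniform_limit_iff eventually_sequentially exp_def by blast
  have "is_laurent (\<lambda>z. \<Sum>i<N. (laurent c n z) ^ i /\<^sub>R fact i)"
    unfolding scaleR_conv_of_real
    by (intro is_laurent_sum is_laurent_mult is_laurent_const is_laurent_power is_laurent_laurent)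
  moreover have "norm (exp (laurent c n z) - (\<Sum>i<N. (laurent c n z) ^ i /\<^sub>R fact i)) < e"
    if "z \<in> sphere 0 1 \<union> sphere 0 q" for z
    using N[of "laurent c n z"] R[OF that] by (simp add: dist_norm norm_minus_commute)
  ultimately show "\<exists>p. is_laurent p \<and> (\<forall>z\<in>sphere 0 1 \<union> sphere 0 q. norm (exp (laurent c n z) - p z) < e)"
    by blast
qed

lemma uniform_laurent_powi_mult:
  assumes "0 < q" "uniform_laurent q f" shows "uniform_laurent q (\<lambda>z. z powi k * f z)"
  unfolding uniform_laurent_def
proof (intro allI impI)
  fix e :: real assume "e > 0"
  \<comment> \<open>The modulus of \<open>z powi k\<close> is 1 on one circle and
    \<open>q powi k\<close> on the other, where it may exceed 1.\<close>
  define K where "K = max 1 (q powi k)"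
  have K: "K \<ge> 1" "norm (z powi k) \<le> K" if "z \<in> sphere 0 1 \<union> sphere 0 q" for z :: complex
    using that by (auto simp: K_def norm_power_int intro: max.coboundedI1 max.coboundedI2)
  have "e / K > 0" using \<open>e > 0\<close> by (simp add: K_def)
  then obtain p where p: "is_laurent p" "\<And>z. z \<in> sphere 0 1 \<union> sphere 0 q \<Longrightarrow> norm (f z - p z) < e / K"
    using assms unfolding uniform_laurent_def by blast
  show "\<exists>p. is_laurent p \<and> (\<forall>z\<in>sphere 0 1 \<union> sphere 0 q. norm (z powi k * f z - p z) < e)"
  proof (intro exI conjI ballI)
    show "is_laurent (\<lambda>z. (1 * z powi k) * p z)"
      by (intro is_laurent_mult p is_laurent_monomial)
  next
    fix z :: complex assume z: "z \<in> sphere 0 1 \<union> sphere 0 q"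
    have "norm (z powi k * f z - 1 * z powi k * p z) = norm (z powi k) * norm (f z - p z)"
      by (simp add: right_diff_distrib flip: norm_mult)
    also have "\<dots> \<le> K * norm (f z - p z)"
      using K z by (intro mult_right_mono) auto
    also have "\<dots> < e"
      using p(2)[OF z] K[OF z] by (simp add: field_simps)
    finally show "norm (z powi k * f z - 1 * z powi k * p z) < e" .
  qed
qed

lemma integrable_circle_bounded:
  fixes f :: "complex \<Rightarrow> 'b::{banach, second_countable_topology}"
  assumes "f \<in> borel_measurable borel" "0 \<le> r" "\<And>z. z \<in> sphere 0 r \<Longrightarrow> norm (f z) \<le> K"
  shows "integrable (circle_measure r) f"
proof (rule finite_measure.integrable_const_bound[OF finite_circle_measure])
  show "AE z in circle_measure r. norm (f z) \<le> K"
    using AE_circle_measure[OF assms(2)] by eventually_elim (use assms in auto)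
qed (use assms in auto)

lemma laurent_bounded:
  assumes "0 < r" shows "\<exists>K. \<forall>z\<in>sphere 0 r. norm (laurent c n z) \<le> K"
proof -
  have "continuous_on (sphere 0 r) (laurent c n)"
    unfolding laurent_def[abs_def] using assms by (intro continuous_intros) auto
  then have "bounded (laurent c n ` (sphere 0 r))"
    by (intro compact_imp_bounded compact_continuous_image compact_sphere)
  then show ?thesis
    unfolding bounded_iff by auto
qed

lemma laurent_polar:
  assumes "0 < r"
  shows "laurent c n (of_real r * cis t)
    = (\<Sum>k\<in>{- int n..int n}. (c k * of_real (r powi k)) * cis (of_int k * t))"
  using assms unfolding laurent_def by (simp add: powi_cis mult.assoc)

lemma integrable_angle_cis: "integrable angle_measure (\<lambda>t. a * cis (of_int k * t))"
  by (rule finite_measure.integrable_const_bound[where B="norm a"]) (auto simp: norm_mult)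

lemma integral_laurent:
  assumes "0 < r" shows "(\<integral>z. laurent c n z \<partial>circle_measure r) = of_real (2 * pi) * c 0"
proof -
  have "(\<integral>z. laurent c n z \<partial>circle_measure r) =
     (\<Sum>k\<in>{- int n..int n}. \<integral>t. (c k * of_real (r powi k)) * cis (of_int k * t) \<partial>angle_measure)"
    using assms
    by (simp add: integral_circle_measure laurent_polar integrable_angle_cis Bochner_Integration.integral_sum)
  also have "\<dots> = (\<Sum>k\<in>{- int n..int n}. if k = 0 then of_real (2 * pi) * c 0 else 0)"
    by (intro sum.cong refl) (auto simp: integral_cis)
  finally show ?thesis by simp
qed

lemma integral_is_laurent:
  assumes "0 < r" "is_laurent f" "f \<in> borel_measurable borel" "0 < s"
  shows "integrable (circle_measure r) f"
    "(\<integral>z. f z \<partial>circle_measure r) = (\<integral>z. f z \<partial>circle_measure s)"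
proof -
  obtain c n where f: "\<And>z. z \<noteq> 0 \<Longrightarrow> f z = laurent c n z"
    using assms unfolding is_laurent_def by auto
  obtain K where "\<forall>z\<in>sphere 0 r. norm (laurent c n z) \<le> K"
    using laurent_bounded[OF \<open>0 < r\<close>] by blast
  then show "integrable (circle_measure r) f"
    using assms f by (intro integrable_circle_bounded[where K=K]) auto
  have "(\<integral>z. f z \<partial>circle_measure t) = (\<integral>z. laurent c n z \<partial>circle_measure t)" if "t > 0" for t
    using assms that f by (simp add: integral_circle_measure)
  then show "(\<integral>z. f z \<partial>circle_measure r) = (\<integral>z. f z \<partial>circle_measure s)"
    using assms by (simp add: integral_laurent)
qed

text \<open>This is Cauchy's theorem for the annulus: against dt, the integral of a Laurent
  polynomial is 2 pi times its coefficient at \<open>0\<close>, whatever the radius. Since one and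
  the same polynomial approximates on both circles, the equality survives the uniform limit.\<close>

lemma integral_uniform_laurent:
  assumes "0 < q" "uniform_laurent q f" "f \<in> borel_measurable borel"
  shows "(\<integral>z. f z \<partial>circle_measure 1) = (\<integral>z. f z \<partial>circle_measure q)"
proof -
  have "norm ((\<integral>z. f z \<partial>circle_measure 1) - (\<integral>z. f z \<partial>circle_measure q)) \<le> e" if "e > 0" for e
  proof -
    \<comment> \<open>Each circle has mass 2 pi, so this tolerance costs e / 2 per circle.\<close>
    from that have "e / (4 * pi) > 0" by simp
    then obtain p where p: "is_laurent p" "\<And>z. z \<in> sphere 0 1 \<union> sphere 0 q \<Longrightarrow> norm (f z - p z) < e / (4 * pi)"
      using assms unfolding uniform_laurent_def by blast
    then obtain c n where c: "\<And>z. z \<noteq> 0 \<Longrightarrow> p z = laurent c n z"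
      unfolding is_laurent_def by auto
    have *: "norm ((\<integral>z. f z \<partial>circle_measure r) - of_real (2 * pi) * c 0) \<le> e / 2" if r: "r > 0" "sphere (0::complex) r \<subseteq> sphere 0 1 \<union> sphere 0 q" for r
    proof -
      have bd: "norm (f z - laurent c n z) \<le> e / (4 * pi)" if "z \<in> sphere 0 r" for z
      proof -
        have "z \<noteq> 0" using that r by auto
        then show ?thesis using p(2)[of z] that r by (auto simp: c intro: less_imp_le)
      qed
      have int: "integrable (circle_measure r) (laurent c n)"
        using integral_is_laurent(1)[OF r(1) is_laurent_laurent _ r(1)] by simp
      have intd: "integrable (circle_measure r) (\<lambda>z. f z - laurent c n z)"
        using assms r bd by (intro integrable_circle_bounded[where K="e / (4*pi)"]) auto
      have intf: "integrable (circle_measure r) f"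
        using Bochner_Integration.integrable_add[OF intd int] by simp
      have "norm ((\<integral>z. f z \<partial>circle_measure r) - of_real (2 * pi) * c 0) = norm (\<integral>z. f z - laurent c n z \<partial>circle_measure r)"
        using integral_laurent[OF r(1)] int intf by simp
      also have "\<dots> \<le> (\<integral>z. norm (f z - laurent c n z) \<partial>circle_measure r)"
        by simp
      also have "\<dots> \<le> (\<integral>z. e / (4 * pi) \<partial>circle_measure r)"
        using AE_circle_measure[of r] r intd bd
        by (intro integral_mono_AE integrable_norm finite_measure.integrable_const) auto
      finally show ?thesis by (simp add: field_simps)
    qed
    show ?thesis
      using dist_triangle2[of "\<integral>z. f z \<partial>circle_measure 1" "\<integral>z. f z \<partial>circle_measure q" "of_real (2 * pi) * c 0"]
        *[of 1] *[of q] assms(1) by (simp add: dist_norm)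
  qed
  then show ?thesis
    using field_le_epsilon[of _ 0] by (metis add_0 norm_le_zero_iff right_minus_eq)
qed

text \<open>Needed at both radii: it converts coefficient bounds for the solution of the Dirichlet
  problem into L2 bounds on the boundary. Orthogonality of the exponentials leaves only the diagonal
  of the double sum.\<close>

lemma parseval_laurent:
  assumes "0 < r"
  shows "(\<integral>z. (norm (laurent c n z))\<^sup>2 \<partial>circle_measure r)
    = 2 * pi * (\<Sum>k\<in>{- int n..int n}. (norm (c k * of_real (r powi k)))\<^sup>2)"
proof -
  let ?I = "{- int n..int n}" and ?a = "\<lambda>k. c k * of_real (r powi k)"
  have "complex_of_real (\<integral>z. (norm (laurent c n z))\<^sup>2 \<partial>circle_measure r)
     = (\<integral>t. complex_of_real ((norm (laurent c n (of_real r * cis t)))\<^sup>2) \<partial>angle_measure)"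
    by (subst integral_complex_of_real) (simp add: integral_circle_measure)
  also have "\<dots> = (\<integral>t. (\<Sum>k\<in>?I. \<Sum>j\<in>?I. (?a k * cnj (?a j)) * cis (of_int (k - j) * t)) \<partial>angle_measure)"
  proof (intro Bochner_Integration.integral_cong refl)
    fix t
    have "of_real ((norm (laurent c n (of_real r * cis t)))\<^sup>2)
      = (\<Sum>k\<in>?I. ?a k * cis (of_int k * t)) * cnj (\<Sum>k\<in>?I. ?a k * cis (of_int k * t))"
      using assms by (simp only: complex_norm_square laurent_polar)
    also have "\<dots> = (\<Sum>k\<in>?I. \<Sum>j\<in>?I. (?a k * cnj (?a j)) * (cis (of_int k * t) * cnj (cis (of_int j * t))))"
      by (simp add: sum_product mult_ac)
    also have "\<dots> = (\<Sum>k\<in>?I. \<Sum>j\<in>?I. (?a k * cnj (?a j)) * cis (of_int (k - j) * t))"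
      by (intro sum.cong refl arg_cong2[where f="(*)"]) (simp add: cis_cnj cis_mult algebra_simps)
    finally show "of_real ((norm (laurent c n (of_real r * cis t)))\<^sup>2) = \<dots>" .
  qed
  also have "\<dots> = (\<Sum>k\<in>?I. \<Sum>j\<in>?I. \<integral>t. (?a k * cnj (?a j)) * cis (of_int (k - j) * t) \<partial>angle_measure)"
    by (subst Bochner_Integration.integral_sum, (intro Bochner_Integration.integrable_sum integrable_angle_cis),
        subst Bochner_Integration.integral_sum, (intro integrable_angle_cis), rule refl)
  also have "\<dots> = (\<Sum>k\<in>?I. \<Sum>j\<in>?I. if j = k then 2 * pi * (?a k * cnj (?a j)) else 0)"
    by (intro sum.cong refl, subst integral_mult_right_zero, subst integral_cis) auto
  also have "\<dots> = (\<Sum>k\<in>?I. of_real (2 * pi * (norm (?a k))\<^sup>2))"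
    by (intro sum.cong refl)
      (simp only: sum.delta finite_atLeastAtMost_int if_True of_real_mult complex_norm_square)
  finally show ?thesis
    by (simp only: of_real_sum[symmetric] of_real_eq_iff sum_distrib_left)
qed

section \<open>Square-integrable functions and Hardy spaces\<close>

lemma borel_measurable_Arg2pi [measurable]: "Arg2pi \<in> borel_measurable borel"
  by (rule borel_measurableI_greater) (simp add: borel_open open_Arg2pi2pi_gt)

lemma borel_measurable_cnj [measurable (raw)]:
  "f \<in> borel_measurable M \<Longrightarrow> (\<lambda>x. cnj (f x)) \<in> borel_measurable M"
  by (rule measurable_compose[where N=borel])
    (auto intro!: borel_measurable_continuous_onI continuous_intros)

lemma borel_measurable_chi_pow [measurable]: "chi_pow \<alpha> \<in> borel_measurable borel"
  unfolding chi_pow_def[abs_def] cis_conv_exp by measurable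

lemma norm_chi_pow: "cmod (chi_pow \<alpha> z) = cmod z powr \<alpha>"
  by (simp add: chi_pow_def norm_mult)

lemma norm_add_power2_le: "(norm (a + b))\<^sup>2 \<le> 2 * (norm a)\<^sup>2 + 2 * (norm b)\<^sup>2"
  for a b :: "'a::real_normed_vector"
proof -
  have "(norm (a + b))\<^sup>2 \<le> (norm a + norm b)\<^sup>2"
    by (intro power_mono norm_triangle_ineq) auto
  also have "\<dots> \<le> 2 * (norm a)\<^sup>2 + 2 * (norm b)\<^sup>2"
    using sum_squares_bound[of "norm a" "norm b"] by (simp add: power2_sum)
  finally show ?thesis .
qed

lemma norm_diff_power2_le: "(norm (a - b))\<^sup>2 \<le> 2 * (norm a)\<^sup>2 + 2 * (norm b)\<^sup>2"
  for a b :: "'a::real_normed_vector"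
  using norm_add_power2_le[of a "- b"] by simp

lemma L2D:
  assumes "f \<in> L2 q"
  shows L2_measurable: "f \<in> borel_measurable borel"
    and L2_integrable: "integrable (boundary_measure q) (\<lambda>z. (cmod (f z))\<^sup>2)"
  using assms by (auto simp: L2_def)

lemma L2_diff:
  assumes "f \<in> L2 q" "g \<in> L2 q" shows "(\<lambda>z. f z - g z) \<in> L2 q"
proof -
  have "integrable (boundary_measure q) (\<lambda>z. (cmod (f z - g z))\<^sup>2)"
  proof (rule Bochner_Integration.integrable_bound)
    show "integrable (boundary_measure q) (\<lambda>z. 2 * (cmod (f z))\<^sup>2 + 2 * (cmod (g z))\<^sup>2)"
      using assms by (auto simp: L2_def)
    show "AE z in boundary_measure q.
        norm ((cmod (f z - g z))\<^sup>2) \<le> norm (2 * (cmod (f z))\<^sup>2 + 2 * (cmod (g z))\<^sup>2)"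
      using norm_diff_power2_le by (intro AE_I2) (simp add: abs_of_nonneg)
  qed (use assms in \<open>auto simp: L2_def\<close>)
  then show ?thesis using assms by (auto simp: L2_def)
qed

lemma L2_integrable_mult_cnj:
  assumes "f \<in> L2 q" "g \<in> L2 q"
  shows "integrable (boundary_measure q) (\<lambda>z. f z * cnj (g z))"
proof (rule Bochner_Integration.integrable_bound)
  show "integrable (boundary_measure q) (\<lambda>z. (cmod (f z))\<^sup>2 + (cmod (g z))\<^sup>2)"
    using assms by (auto simp: L2_def)
  have "cmod a * cmod b \<le> (cmod a)\<^sup>2 + (cmod b)\<^sup>2" for a b :: complex
  proof -
    have "2 * (cmod a * cmod b) \<le> (cmod a)\<^sup>2 + (cmod b)\<^sup>2"
      using sum_squares_bound[of "cmod a" "cmod b"] by simp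
    moreover have "0 \<le> cmod a * cmod b"
      by simp
    ultimately show ?thesis
      by linarith
  qed
  then show "AE z in boundary_measure q. norm (f z * cnj (g z)) \<le> norm ((cmod (f z))\<^sup>2 + (cmod (g z))\<^sup>2)"
    by (intro AE_I2) (simp add: norm_mult abs_of_nonneg)
qed (use assms in \<open>auto simp: L2_def\<close>)

lemma L2_bounded_mult:
  assumes "f \<in> L2 q" "g \<in> borel_measurable borel" "AE z in boundary_measure q. cmod (g z) \<le> C"
  shows "(\<lambda>z. g z * f z) \<in> L2 q"
proof -
  have "integrable (boundary_measure q) (\<lambda>z. (cmod (g z * f z))\<^sup>2)"
  proof (rule Bochner_Integration.integrable_bound)
    show "integrable (boundary_measure q) (\<lambda>z. C\<^sup>2 * (cmod (f z))\<^sup>2)"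
      using assms by (auto simp: L2_def)
    show "AE z in boundary_measure q. norm ((cmod (g z * f z))\<^sup>2) \<le> norm (C\<^sup>2 * (cmod (f z))\<^sup>2)"
      using assms(3)
      by eventually_elim (auto simp: norm_mult power_mult_distrib intro!: mult_right_mono power_mono)
  qed (use assms in \<open>auto simp: L2_def\<close>)
  then show ?thesis using assms by (auto simp: L2_def)
qed

lemma AE_boundary_measure:
  assumes "0 \<le> q"
  shows "AE z in boundary_measure q. z \<in> sphere 0 1 \<union> sphere 0 q"
  unfolding AE_boundary_measure_iff
  using AE_circle_measure[of 1] AE_circle_measure[OF assms] by auto

lemma AE_boundary_measure_nonzero:
  assumes "0 < q"
  shows "AE z in boundary_measure q. z \<noteq> 0"
  using AE_boundary_measure[of q] assms by auto

lemma L2_bounded: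
  assumes "f \<in> borel_measurable borel" "AE z in boundary_measure q. cmod (f z) \<le> C"
  shows "f \<in> L2 q"
proof -
  have "integrable (boundary_measure q) (\<lambda>z. (cmod (f z))\<^sup>2)"
  proof (rule finite_measure.integrable_const_bound[OF finite_boundary_measure, where B = "C\<^sup>2"])
    show "AE z in boundary_measure q. norm ((cmod (f z))\<^sup>2) \<le> C\<^sup>2"
      using assms(2) by eventually_elim (auto intro!: power_mono)
  qed (use assms in auto)
  then show ?thesis using assms by (simp add: L2_def)
qed

lemma L2_laurent:
  assumes "0 < q" shows "laurent c n \<in> L2 q"
proof -
  obtain K K' where "\<forall>z\<in>sphere 0 1. norm (laurent c n z) \<le> K" "\<forall>z\<in>sphere 0 q. norm (laurent c n z) \<le> K'"
    using laurent_bounded[of 1 c n] laurent_bounded[of q c n] assms by auto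
  then have "AE z in boundary_measure q. cmod (laurent c n z) \<le> max K K'"
    using AE_boundary_measure[of q] assms by (auto simp: max.coboundedI1 max.coboundedI2)
  then show ?thesis by (intro L2_bounded) auto
qed

section \<open>The Hardy spaces as closed subspaces\<close>

lemma H2_0_iff:
  assumes "0 < q"
  shows "f \<in> H2_0 q \<longleftrightarrow> f \<in> L2 q \<and>
    (\<forall>e>0. \<exists>c n. (\<integral>z. (cmod (f z - laurent c n z))\<^sup>2 \<partial>boundary_measure q) < e)"
proof -
  have "(\<forall>\<epsilon>>0. \<exists>p\<in>laurent_polynomials. L2_norm q (\<lambda>z. f z - p z) < \<epsilon>) \<longleftrightarrow>
        (\<forall>\<epsilon>>0. \<exists>c n. L2_norm q (\<lambda>z. f z - laurent c n z) < \<epsilon>)"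
    using laurent_in_laurent_polynomials by (metis laurent_polynomialsE)
  also have "\<dots> \<longleftrightarrow> (\<forall>e>0. \<exists>c n. (\<integral>z. (cmod (f z - laurent c n z))\<^sup>2 \<partial>boundary_measure q) < e)" (is "?l = ?r")
  proof
    assume l: ?l
    show ?r
    proof (intro allI impI)
      fix e :: real assume "e > 0"
      then obtain c n where "L2_norm q (\<lambda>z. f z - laurent c n z) < sqrt e"
        using l by (metis real_sqrt_gt_zero)
      then show "\<exists>c n. (\<integral>z. (cmod (f z - laurent c n z))\<^sup>2 \<partial>boundary_measure q) < e"
        unfolding L2_norm_def by auto
    qed
  next
    assume r: ?r
    show ?l
    proof (intro allI impI)
      fix e :: real assume "e > 0"
      then obtain c n where "(\<integral>z. (cmod (f z - laurent c n z))\<^sup>2 \<partial>boundary_measure q) < e\<^sup>2"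
        using r by (metis zero_less_power)
      then have "L2_norm q (\<lambda>z. f z - laurent c n z) < sqrt (e\<^sup>2)"
        unfolding L2_norm_def by (rule real_sqrt_less_mono)
      then show "\<exists>c n. L2_norm q (\<lambda>z. f z - laurent c n z) < e"
        using \<open>e > 0\<close> by auto
    qed
  qed
  finally show ?thesis by (simp add: H2_0_def)
qed

text \<open>Closedness of the Hardy space. The triangle inequality is used in the squared form with
  factors 2, which is why both errors are taken below e / 4.\<close>

lemma H2_0_approx:
  assumes "0 < q" "f \<in> L2 q"
    and "\<And>e. e > 0 \<Longrightarrow> \<exists>g\<in>H2_0 q. (\<integral>z. (cmod (f z - g z))\<^sup>2 \<partial>boundary_measure q) < e"
  shows "f \<in> H2_0 q"
  unfolding H2_0_iff[OF assms(1)]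
proof (intro conjI allI impI assms(2))
  fix e :: real assume "e > 0"
  then obtain g where g: "g \<in> H2_0 q" "(\<integral>z. (cmod (f z - g z))\<^sup>2 \<partial>boundary_measure q) < e / 4"
    using assms(3)[of "e / 4"] by auto
  then obtain c n where c: "(\<integral>z. (cmod (g z - laurent c n z))\<^sup>2 \<partial>boundary_measure q) < e / 4"
    using \<open>e > 0\<close> unfolding H2_0_iff[OF assms(1)] by (metis divide_pos_pos zero_less_numeral)
  have gL: "g \<in> L2 q" using g by (simp add: H2_0_def)
  note i = L2_integrable[OF L2_diff]
  have "(\<integral>z. (cmod (f z - laurent c n z))\<^sup>2 \<partial>boundary_measure q)
     \<le> (\<integral>z. 2 * (cmod (f z - g z))\<^sup>2 + 2 * (cmod (g z - laurent c n z))\<^sup>2 \<partial>boundary_measure q)"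
  proof (rule integral_mono)
    show "(cmod (f z - laurent c n z))\<^sup>2 \<le> 2 * (cmod (f z - g z))\<^sup>2 + 2 * (cmod (g z - laurent c n z))\<^sup>2" for z
      using norm_add_power2_le[of "f z - g z" "g z - laurent c n z"] by simp
  qed (use assms gL in \<open>auto intro!: i L2_laurent Bochner_Integration.integrable_add integrable_mult_right\<close>)
  also have "\<dots> = 2 * (\<integral>z. (cmod (f z - g z))\<^sup>2 \<partial>boundary_measure q) + 2 * (\<integral>z. (cmod (g z - laurent c n z))\<^sup>2 \<partial>boundary_measure q)"
    using assms gL by (simp add: i L2_laurent)
  finally show "\<exists>c n. (\<integral>z. (cmod (f z - laurent c n z))\<^sup>2 \<partial>boundary_measure q) < e"
    using g c by (intro exI[of _ c] exI[of _ n]) linarith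
qed

text \<open>Agreement with a Laurent polynomial off the origin is enough, because the origin is a
  null set for the boundary measure.\<close>

lemma H2_0_is_laurent:
  assumes "0 < q" "is_laurent f" "f \<in> borel_measurable borel"
  shows "f \<in> H2_0 q"
proof -
  obtain c n where f: "\<And>z. z \<noteq> 0 \<Longrightarrow> f z = laurent c n z"
    using assms unfolding is_laurent_def by auto
  have ae: "AE z in boundary_measure q. f z = laurent c n z"
    using AE_boundary_measure_nonzero[OF assms(1)] by eventually_elim (rule f)
  have "integrable (boundary_measure q) (\<lambda>z. (cmod (f z))\<^sup>2)"
    using L2_integrable[OF L2_laurent[OF assms(1), of c n]]
  proof (rule integrable_cong_AE_imp)
    show "AE z in boundary_measure q. (cmod (laurent c n z))\<^sup>2 = (cmod (f z))\<^sup>2"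
      using ae by eventually_elim simp
  qed (use assms in auto)
  then have "f \<in> L2 q" using assms by (simp add: L2_def)
  moreover have "(\<integral>z. (cmod (f z - laurent c n z))\<^sup>2 \<partial>boundary_measure q) = 0"
    using ae by (intro integral_eq_zero_AE) (auto elim!: eventually_mono)
  ultimately show ?thesis
    unfolding H2_0_iff[OF assms(1)] by (intro conjI allI impI exI[of _ c] exI[of _ n]) auto
qed

lemma H2_0_diff:
  assumes "0 < q" "f \<in> H2_0 q" "g \<in> H2_0 q" shows "(\<lambda>z. f z - g z) \<in> H2_0 q"
proof (rule H2_0_approx[OF assms(1)])
  have L: "f \<in> L2 q" "g \<in> L2 q" using assms by (auto simp: H2_0_def)
  then show "(\<lambda>z. f z - g z) \<in> L2 q" by (rule L2_diff)
  fix e :: real assume "e > 0"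
  then have "e / 4 > 0" by simp
  then obtain c n d m where c: "(\<integral>z. (cmod (f z - laurent c n z))\<^sup>2 \<partial>boundary_measure q) < e / 4"
    and d: "(\<integral>z. (cmod (g z - laurent d m z))\<^sup>2 \<partial>boundary_measure q) < e / 4"
    using assms(2,3) unfolding H2_0_iff[OF assms(1)] by blast
  note i = L2_integrable[OF L2_diff]
  have "(\<integral>z. (cmod ((f z - g z) - (laurent c n z - laurent d m z)))\<^sup>2 \<partial>boundary_measure q)
     \<le> (\<integral>z. 2 * (cmod (f z - laurent c n z))\<^sup>2 + 2 * (cmod (g z - laurent d m z))\<^sup>2 \<partial>boundary_measure q)"
  proof (rule integral_mono)
    show "(cmod ((f z - g z) - (laurent c n z - laurent d m z)))\<^sup>2 \<le> 2 * (cmod (f z - laurent c n z))\<^sup>2 + 2 * (cmod (g z - laurent d m z))\<^sup>2" for z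
      using norm_diff_power2_le[of "f z - laurent c n z" "g z - laurent d m z"] by (simp add: algebra_simps)
    show "integrable (boundary_measure q) (\<lambda>z. (cmod ((f z - g z) - (laurent c n z - laurent d m z)))\<^sup>2)"
      by (intro i L2_diff L L2_laurent assms)
    show "integrable (boundary_measure q) (\<lambda>z. 2 * (cmod (f z - laurent c n z))\<^sup>2 + 2 * (cmod (g z - laurent d m z))\<^sup>2)"
      by (intro i L L2_laurent assms Bochner_Integration.integrable_add integrable_mult_right)
  qed
  also have "\<dots> = 2 * (\<integral>z. (cmod (f z - laurent c n z))\<^sup>2 \<partial>boundary_measure q) + 2 * (\<integral>z. (cmod (g z - laurent d m z))\<^sup>2 \<partial>boundary_measure q)"
    using assms L by (simp add: i L2_laurent)
  finally have "(\<integral>z. (cmod ((f z - g z) - (laurent c n z - laurent d m z)))\<^sup>2 \<partial>boundary_measure q) < e"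
    using c d by linarith
  moreover have "is_laurent (\<lambda>z. laurent c n z - laurent d m z)"
    using is_laurent_add[OF is_laurent_laurent[of c n]
        is_laurent_mult[OF is_laurent_const[of "-1"] is_laurent_laurent[of d m]]] by simp
  ultimately show "\<exists>h\<in>H2_0 q. (\<integral>z. (cmod (f z - g z - h z))\<^sup>2 \<partial>boundary_measure q) < e"
    using assms by (intro bexI[of _ "\<lambda>z. laurent c n z - laurent d m z"] H2_0_is_laurent) auto
qed

lemma H2_0_cmult:
  assumes "0 < q" "f \<in> H2_0 q" shows "(\<lambda>z. a * f z) \<in> H2_0 q"
proof (rule H2_0_approx[OF assms(1)])
  have L: "f \<in> L2 q" using assms by (auto simp: H2_0_def)
  then show "(\<lambda>z. a * f z) \<in> L2 q" by (rule L2_bounded_mult[where C = "cmod a"]) auto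
  fix e :: real assume "e > 0"
  define K where "K = (cmod a)\<^sup>2 + 1"
  have K: "K > 0" "(cmod a)\<^sup>2 \<le> K"
    unfolding K_def by (auto simp: add_nonneg_pos)
  with \<open>e > 0\<close> have "e / K > 0" by simp
  then obtain c n where c: "(\<integral>z. (cmod (f z - laurent c n z))\<^sup>2 \<partial>boundary_measure q) < e / K"
    using assms unfolding H2_0_iff[OF assms(1)] by metis
  have "(\<integral>z. (cmod (a * f z - a * laurent c n z))\<^sup>2 \<partial>boundary_measure q)
     = (cmod a)\<^sup>2 * (\<integral>z. (cmod (f z - laurent c n z))\<^sup>2 \<partial>boundary_measure q)"
    by (simp add: norm_mult power_mult_distrib flip: right_diff_distrib)
  also have "\<dots> \<le> K * (\<integral>z. (cmod (f z - laurent c n z))\<^sup>2 \<partial>boundary_measure q)"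
    using K by (intro mult_right_mono) auto
  also have "\<dots> < e" using c K by (simp add: field_simps)
  finally show "\<exists>h\<in>H2_0 q. (\<integral>z. (cmod (a * f z - h z))\<^sup>2 \<partial>boundary_measure q) < e"
    using assms
    by (intro bexI[of _ "\<lambda>z. a * laurent c n z"] H2_0_is_laurent is_laurent_mult is_laurent_const
        is_laurent_laurent) auto
qed

lemma H2_diff:
  assumes "0 < q" "f \<in> H2 q \<alpha>" "g \<in> H2 q \<alpha>" shows "(\<lambda>z. f z - g z) \<in> H2 q \<alpha>"
proof -
  obtain u v where u: "u \<in> H2_0 q" "AE z in boundary_measure q. f z = chi_pow \<alpha> z * u z"
    and v: "v \<in> H2_0 q" "AE z in boundary_measure q. g z = chi_pow \<alpha> z * v z"
    using assms unfolding H2_def by auto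
  have "AE z in boundary_measure q. f z - g z = chi_pow \<alpha> z * (u z - v z)"
    using u(2) v(2) by eventually_elim (simp add: right_diff_distrib)
  moreover have "(\<lambda>z. f z - g z) \<in> L2 q" using assms by (intro L2_diff) (auto simp: H2_def)
  ultimately show ?thesis
    unfolding H2_def using H2_0_diff[OF assms(1) u(1) v(1)]
    by (intro CollectI conjI bexI[of _ "\<lambda>z. u z - v z"])
qed

lemma H2_cmult:
  assumes "0 < q" "f \<in> H2 q \<alpha>" shows "(\<lambda>z. a * f z) \<in> H2 q \<alpha>"
proof -
  obtain u where u: "u \<in> H2_0 q" "AE z in boundary_measure q. f z = chi_pow \<alpha> z * u z"
    using assms unfolding H2_def by auto
  have "AE z in boundary_measure q. a * f z = chi_pow \<alpha> z * (a * u z)"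
    using u(2) by eventually_elim simp
  moreover have "(\<lambda>z. a * f z) \<in> L2 q"
    using assms by (intro L2_bounded_mult[where C = "cmod a"]) (auto simp: H2_def)
  ultimately show ?thesis
    unfolding H2_def using H2_0_cmult[OF assms(1) u(1)]
    by (intro CollectI conjI bexI[of _ "\<lambda>z. a * u z"])
qed

text \<open>The projection is a choice among representatives, so it must be identified almost
  everywhere. The orthogonality assumption makes \<open>w * f\<close> a valid candidate, so the
  choice really has the defining property of the projection. The difference \<open>d\<close> between
  the chosen function and \<open>w * f\<close> then lies in the subspace and is also orthogonal to
  it, as a difference of two residuals; being orthogonal to itself, it vanishes.\<close>

lemma toeplitz_eigenvalueI:
  assumes q: "0 < q" and phi: "\<phi> \<in> borel_measurable borel" "AE z in boundary_measure q. \<bar>\<phi> z\<bar> \<le> C"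
    and f: "f \<in> H2 q \<alpha>" "\<not> (AE z in boundary_measure q. f z = 0)"
    and orth: "\<And>u. u \<in> H2 q \<alpha> \<Longrightarrow> L2_inner q (\<lambda>z. (of_real (\<phi> z) - w) * f z) u = 0"
  shows "toeplitz_eigenvalue q \<alpha> \<phi> w"
proof -
  let ?g = "\<lambda>z. of_real (\<phi> z) * f z"
  let ?P = "\<lambda>h. h \<in> H2 q \<alpha> \<and> (\<forall>u\<in>H2 q \<alpha>. L2_inner q (\<lambda>z. ?g z - h z) u = 0)"
  have "?P (\<lambda>z. w * f z)"
    using H2_cmult[OF q f(1)] orth by (auto simp: algebra_simps)
  then have h: "?P (toeplitz q \<alpha> \<phi> f)"
    unfolding toeplitz_def H2_proj_def by (rule someI[where P = ?P])
  define d where "d = (\<lambda>z. toeplitz q \<alpha> \<phi> f z - w * f z)"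
  have d: "d \<in> H2 q \<alpha>"
    unfolding d_def using h H2_cmult[OF q f(1)] by (intro H2_diff[OF q]) auto
  have L: "d \<in> L2 q" "f \<in> L2 q" "toeplitz q \<alpha> \<phi> f \<in> L2 q" "?g \<in> L2 q"
    using d f h phi by (auto simp: H2_def intro!: L2_bounded_mult[where C=C])
  then have Lw: "(\<lambda>z. w * f z) \<in> L2 q"
    by (intro L2_bounded_mult[where C = "cmod w"]) auto
  define A where "A = (\<lambda>z. ?g z - w * f z)"
  define B where "B = (\<lambda>z. ?g z - toeplitz q \<alpha> \<phi> f z)"
  have AB: "A \<in> L2 q" "B \<in> L2 q" and d_eq: "d z = A z - B z" for z
    unfolding A_def B_def using L Lw by (auto intro!: L2_diff simp: d_def)
  have "L2_inner q A d = 0" "L2_inner q B d = 0"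
    using orth[OF d] h d by (simp_all add: A_def B_def left_diff_distrib)
  then have "0 = L2_inner q A d - L2_inner q B d"
    by simp
  also have "\<dots> = L2_inner q d d"
    unfolding L2_inner_def
      Bochner_Integration.integral_diff[OF L2_integrable_mult_cnj[OF AB(1) L(1)]
        L2_integrable_mult_cnj[OF AB(2) L(1)], symmetric]
    by (simp add: d_eq left_diff_distrib)
  also have "\<dots> = of_real (\<integral>z. (cmod (d z))\<^sup>2 \<partial>boundary_measure q)"
    unfolding L2_inner_def by (simp only: complex_norm_square[symmetric] integral_complex_of_real)
  finally have "(\<integral>z. (cmod (d z))\<^sup>2 \<partial>boundary_measure q) = 0"
    by (metis of_real_eq_0_iff)
  then have "AE z in boundary_measure q. (cmod (d z))\<^sup>2 = 0"
    by (subst (asm) integral_nonneg_eq_0_iff_AE) (use L L2_integrable in auto)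
  then have "AE z in boundary_measure q. toeplitz q \<alpha> \<phi> f z = w * f z"
    by eventually_elim (simp add: d_def)
  then show ?thesis
    unfolding toeplitz_eigenvalue_def using f by blast
qed

text \<open>A substitute for the Cauchy-Schwarz inequality against the constant 1, obtained by
  integrating 2 |a| e \<le> |a|^2 + e^2. Taking \<open>e\<close> of the size of the L2 norm recovers
  it up to a constant.\<close>

lemma integral_norm_le_power2:
  fixes f :: "'a \<Rightarrow> 'b::{banach, second_countable_topology}"
  assumes "finite_measure M" "f \<in> borel_measurable M" "integrable M (\<lambda>x. (norm (f x))\<^sup>2)" "e > 0"
  shows "integrable M f"
    "(\<integral>x. norm (f x) \<partial>M) \<le> (e * measure M (space M) + (\<integral>x. (norm (f x))\<^sup>2 \<partial>M) / e) / 2"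
proof -
  interpret finite_measure M by fact
  have *: "norm a \<le> (e + (norm a)\<^sup>2 / e) / 2" for a :: 'b
    using sum_squares_bound[of "norm a" e] \<open>e > 0\<close>
    by (simp add: field_simps power2_eq_square)
  have i: "integrable M (\<lambda>x. (e + (norm (f x))\<^sup>2 / e) / 2)"
    using assms by auto
  have "norm (f x) \<le> norm ((e + (norm (f x))\<^sup>2 / e) / 2)" for x
    by (rule order_trans[OF *]) (simp only: real_norm_def abs_ge_self)
  then show int: "integrable M f"
    by (intro Bochner_Integration.integrable_bound[OF i assms(2)] AE_I2)
  have "(\<integral>x. norm (f x) \<partial>M) \<le> (\<integral>x. (e + (norm (f x))\<^sup>2 / e) / 2 \<partial>M)"
    using i int by (intro integral_mono * integrable_norm)
  also have "\<dots> = (e * measure M (space M) + (\<integral>x. (norm (f x))\<^sup>2 \<partial>M) / e) / 2"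
    using assms by simp
  finally show "(\<integral>x. norm (f x) \<partial>M) \<le> \<dots>" .
qed

text \<open>Pairing with a bounded function is continuous in L2, so vanishing on the monomials
  passes to Laurent polynomials and then to their closure.\<close>

lemma orthogonal_H2_0:
  assumes q: "0 < q" and F: "F \<in> borel_measurable borel" "AE z in boundary_measure q. cmod (F z) \<le> C"
    and g: "g \<in> H2_0 q"
    and orth: "\<And>j. (\<integral>z. F z * cnj (z powi j) \<partial>boundary_measure q) = 0"
  shows "(\<integral>z. F z * cnj (g z) \<partial>boundary_measure q) = 0"
proof -
  have FL: "F \<in> L2 q" using F by (rule L2_bounded)
  have gL: "g \<in> L2 q" using g by (simp add: H2_0_def)
  have powL: "(\<lambda>z. z powi j) \<in> L2 q" for j
    using H2_0_is_laurent[OF q is_laurent_monomial[of 1 j]] by (simp add: H2_0_def)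
  have "norm (\<integral>z. F z * cnj (g z) \<partial>boundary_measure q) \<le> 0 + e" if "e > 0" for e
  proof -
    define K where "K = max C 1"
    \<comment> \<open>The boundary has mass 4 pi, so an L2 error below \<open>d\<close> gives an L1
      error of at most d (4 pi + 1) / 2, and \<open>K\<close> times that is e / 2.\<close>
    define d where "d = e / (K * (4 * pi + 1))"
    have K: "K \<ge> C" "K \<ge> 1" unfolding K_def by auto
    have pp: "4 * pi + 1 > 0" using pi_gt_zero by linarith
    have d: "d > 0" unfolding d_def using that K pp by (intro divide_pos_pos mult_pos_pos) auto
    then obtain c n where c: "(\<integral>z. (cmod (g z - laurent c n z))\<^sup>2 \<partial>boundary_measure q) < d\<^sup>2"
      using g zero_less_power[OF d, of 2] unfolding H2_0_iff[OF q] by blast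
    have DL: "(\<lambda>z. g z - laurent c n z) \<in> L2 q" using gL L2_laurent[OF q] by (rule L2_diff)
    have "(\<integral>z. F z * cnj (laurent c n z) \<partial>boundary_measure q)
       = (\<integral>z. (\<Sum>k\<in>{-int n..int n}. cnj (c k) * (F z * cnj (z powi k))) \<partial>boundary_measure q)"
      by (intro Bochner_Integration.integral_cong refl)
        (simp add: laurent_def sum_distrib_left mult_ac)
    also have "\<dots> = 0"
    proof (subst Bochner_Integration.integral_sum)
      show "integrable (boundary_measure q) (\<lambda>z. cnj (c k) * (F z * cnj (z powi k)))" for k
        by (intro integrable_mult_right L2_integrable_mult_cnj FL powL)
    qed (simp only: integral_mult_right_zero orth mult_zero_right sum.neutral_const)
    finally have L0: "(\<integral>z. F z * cnj (laurent c n z) \<partial>boundary_measure q) = 0" .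
    define D where "D = (\<lambda>z. g z - laurent c n z)"
    have D: "D \<in> borel_measurable (boundary_measure q)" "integrable (boundary_measure q) (\<lambda>z. (norm (D z))\<^sup>2)"
        "integrable (boundary_measure q) (\<lambda>z. F z * cnj (D z))"
      using L2_measurable[OF DL] L2_integrable[OF DL] L2_integrable_mult_cnj[OF FL DL] by (simp_all add: D_def)
    note D1 = integral_norm_le_power2[OF finite_boundary_measure D(1,2) d]
    have "(\<integral>z. norm (D z) \<partial>boundary_measure q) \<le> (d * (4 * pi) + (\<integral>z. (norm (D z))\<^sup>2 \<partial>boundary_measure q) / d) / 2"
      using D1(2) by simp
    also have "\<dots> \<le> (d * (4 * pi) + d\<^sup>2 / d) / 2"
      using c d by (intro divide_right_mono add_left_mono) (auto simp: D_def)
    also have "d * (4 * pi) + d\<^sup>2 / d = d * (4 * pi + 1)"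
      using d by (simp add: power2_eq_square distrib_left)
    also have "\<dots> = e / K"
      using K pp unfolding d_def by (simp del: distrib_left_numeral)
    finally have D2: "K * (\<integral>z. norm (D z) \<partial>boundary_measure q) \<le> e / 2"
      using K by (simp add: field_simps)
    have "(\<integral>z. F z * cnj (g z) \<partial>boundary_measure q) = (\<integral>z. F z * cnj (g z) - F z * cnj (laurent c n z) \<partial>boundary_measure q)"
      using L0 Bochner_Integration.integral_diff[OF L2_integrable_mult_cnj[OF FL gL]
          L2_integrable_mult_cnj[OF FL L2_laurent[OF q, of c n]]] by (simp only: diff_zero)
    also have "\<dots> = (\<integral>z. F z * cnj (D z) \<partial>boundary_measure q)"
      by (simp only: D_def complex_cnj_diff right_diff_distrib)
    also have "norm \<dots> \<le> (\<integral>z. norm (F z * cnj (D z)) \<partial>boundary_measure q)"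
      by (rule integral_norm_bound)
    also have "\<dots> \<le> (\<integral>z. K * norm (D z) \<partial>boundary_measure q)"
    proof (rule integral_mono_AE)
      show "AE z in boundary_measure q. norm (F z * cnj (D z)) \<le> K * norm (D z)"
        using F(2)
      proof eventually_elim
        case (elim z)
        then have "cmod (F z) * cmod (D z) \<le> K * cmod (D z)"
          using K by (intro mult_right_mono) auto
        then show ?case by (simp only: norm_mult complex_mod_cnj)
      qed
      show "integrable (boundary_measure q) (\<lambda>z. norm (F z * cnj (D z)))"
        using D(3) by (rule integrable_norm)
      show "integrable (boundary_measure q) (\<lambda>z. K * norm (D z))"
        using D1(1) by (intro integrable_mult_right integrable_norm)
    qed
    finally show ?thesis using that D2 by simp
  qed
  then have "norm (\<integral>z. F z * cnj (g z) \<partial>boundary_measure q) \<le> 0"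
    by (rule field_le_epsilon)
  then show ?thesis by simp
qed

section \<open>Trigonometric approximation\<close>

text \<open>The symmetry of the coefficients of a trigonometric polynomial that is real on the unit
  circle.\<close>

definition hermitian :: "(int \<Rightarrow> complex) \<Rightarrow> bool" where
  "hermitian c \<longleftrightarrow> (\<forall>k. c (- k) = cnj (c k))"

lemma inverse_eq_cnj: "norm z = 1 \<Longrightarrow> inverse z = cnj z"
  by (simp add: inverse_complex_def complex_eq_iff cmod_power2[symmetric] del: inverse_complex.sel)

lemma cnj_laurent_unit:
  assumes "norm z = 1" shows "cnj (laurent c n z) = laurent (\<lambda>k. cnj (c (- k))) n z"
proof -
  have z: "cnj z = inverse z"
    using assms by (simp add: inverse_eq_cnj)
  have "cnj (laurent c n z) = (\<Sum>k\<in>{- int n..int n}. cnj (c k) * z powi (- k))"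
    unfolding laurent_def using z by (simp add: power_int_minus power_int_inverse)
  also have "\<dots> = (\<Sum>k\<in>{- int n..int n}. cnj (c (- k)) * z powi k)"
    by (rule sum.reindex_bij_witness[of _ uminus uminus]) auto
  finally show ?thesis by (simp add: laurent_def)
qed

lemma Re_laurent_unit:
  assumes "norm z = 1"
  shows "of_real (Re (laurent c n z)) = laurent (\<lambda>k. (c k + cnj (c (- k))) / 2) n z"
proof -
  have "of_real (Re (laurent c n z)) = (laurent c n z + cnj (laurent c n z)) / 2"
    by (simp add: complex_eq_iff)
  also have "\<dots> = laurent (\<lambda>k. (c k + cnj (c (- k))) / 2) n z"
    unfolding cnj_laurent_unit[OF assms]
    by (simp add: laurent_def sum_divide_distrib flip: sum.distrib add: algebra_simps add_divide_distrib)
  finally show ?thesis .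
qed

text \<open>On the unit circle the conjugate of z is its inverse, so real polynomials in Re z and Im
  z become Laurent polynomials in z. This puts the Stone-Weierstrass theorem at the service of
  Laurent approximation.\<close>

lemma real_polynomial_function_is_laurent:
  fixes g :: "complex \<Rightarrow> real"
  assumes "real_polynomial_function g"
  shows "\<exists>P. is_laurent P \<and> (\<forall>z. norm z = 1 \<longrightarrow> of_real (g z) = P z)"
  using assms
proof (induction rule: real_polynomial_function.induct)
  case (linear f)
  \<comment> \<open>The coefficients result from Re z = (z + cnj z) / 2 and Im z = (z - cnj z) / (2
    i), inserted into the real-linear expression f z = Re z f 1 + Im z f i.\<close>
  let ?P = "\<lambda>z. (f 1 - \<i> * f \<i>) / 2 * z powi 1 + (f 1 + \<i> * f \<i>) / 2 * z powi (- 1)"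
  have "of_real (f z) = ?P z" if "norm z = 1" for z
  proof -
    interpret bounded_linear f by fact
    have "Re z *\<^sub>R 1 + Im z *\<^sub>R \<i> = z"
      by (simp add: complex_eq_iff)
    moreover have "f (Re z *\<^sub>R 1 + Im z *\<^sub>R \<i>) = Re z * f 1 + Im z * f \<i>"
      by (simp only: add scale real_scaleR_def)
    ultimately have fz: "f z = Re z * f 1 + Im z * f \<i>"
      by (simp only:)
    have zi: "z powi (- 1) = cnj z"
      by (simp add: power_int_minus inverse_eq_cnj[OF that])
    have "of_real (Re z * f 1 + Im z * f \<i>)
        = (f 1 - \<i> * f \<i>) / 2 * z + (f 1 + \<i> * f \<i>) / 2 * cnj z"
      by (rule complex_eqI) (simp_all add: field_simps)
    then show ?thesis
      unfolding fz zi power_int_1_right .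
  qed
  moreover have "is_laurent ?P"
    by (intro is_laurent_add is_laurent_monomial)
  ultimately show ?case by blast
next
  case (const c)
  show ?case using is_laurent_const by blast
next
  case (add f g)
  then obtain P Q where "is_laurent P" "\<forall>z. norm z = 1 \<longrightarrow> of_real (f z) = P z"
    "is_laurent Q" "\<forall>z. norm z = 1 \<longrightarrow> of_real (g z) = Q z" by blast
  then show ?case
    by (intro exI[of _ "\<lambda>z. P z + Q z"]) (simp add: is_laurent_add)
next
  case (mult f g)
  then obtain P Q where "is_laurent P" "\<forall>z. norm z = 1 \<longrightarrow> of_real (f z) = P z"
    "is_laurent Q" "\<forall>z. norm z = 1 \<longrightarrow> of_real (g z) = Q z" by blast
  then show ?case
    by (intro exI[of _ "\<lambda>z. P z * Q z"]) (simp add: is_laurent_mult)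
qed

lemma laurent_approx:
  fixes g :: "complex \<Rightarrow> real"
  assumes "continuous_on (sphere 0 1) g" "0 < e"
  shows "\<exists>c n. hermitian c \<and> (\<forall>k. int n < \<bar>k\<bar> \<longrightarrow> c k = 0) \<and>
    (\<forall>z\<in>sphere 0 1. norm (laurent c n z - of_real (g z)) < e)"
proof -
  obtain p where p: "real_polynomial_function p" "\<And>z. z \<in> sphere 0 1 \<Longrightarrow> \<bar>g z - p z\<bar> < e"
    using Stone_Weierstrass_real_polynomial_function[OF compact_sphere assms] by blast
  obtain P where P: "is_laurent P" "\<And>z. norm z = 1 \<Longrightarrow> of_real (p z) = P z"
    using real_polynomial_function_is_laurent[OF p(1)] by blast
  then obtain c n where c: "\<And>z. z \<noteq> 0 \<Longrightarrow> P z = laurent c n z"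
    unfolding is_laurent_def by auto
  \<comment> \<open>Averaging with the reflected conjugate represents the real part on the circle.
    As the values there are real already, nothing changes except that the coefficients become
    hermitian.\<close>
  define d where "d = (\<lambda>k. if \<bar>k\<bar> \<le> int n then (c k + cnj (c (- k))) / 2 else 0)"
  have "laurent d n z = of_real (p z)" if "norm z = 1" for z
  proof -
    have "z \<noteq> 0" using that by auto
    then have "of_real (p z) = laurent c n z" using P(2)[OF that] c by simp
    then have "of_real (p z) = complex_of_real (Re (laurent c n z))" by (metis Re_complex_of_real)
    then show ?thesis
      unfolding d_def laurent_truncate using Re_laurent_unit[OF that] by simp
  qed
  moreover have "hermitian d"
    by (auto simp: hermitian_def d_def algebra_simps)
  ultimately show ?thesis
    using p(2) by (intro exI[of _ d] exI[of _ n])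
      (auto simp: d_def norm_minus_commute abs_minus_commute simp flip: of_real_diff)
qed

text \<open>Since \<open>g\<close> need not be periodic, its transplant to the circle may jump at 1,
  where \<open>Arg2pi\<close> is discontinuous. The second factor vanishes at 1 and removes the
  jump; for large \<open>K\<close> it equals 1 away from a small neighbourhood of 1.\<close>

lemma continuous_on_periodic:
  fixes g :: "real \<Rightarrow> real"
  assumes "continuous_on UNIV g" "\<And>t. \<bar>g t\<bar> \<le> C"
  shows "continuous_on (sphere 0 1) (\<lambda>z. g (Arg2pi z) * min 1 (K * cmod (z - 1)))"
  unfolding continuous_on_eq_continuous_within
proof
  fix z :: complex assume z: "z \<in> sphere 0 1"
  let ?F = "\<lambda>z. g (Arg2pi z) * min 1 (K * cmod (z - 1))"
  show "continuous (at z within sphere 0 1) ?F"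
  proof (cases "z = 1")
    case True
    have "(?F \<longlongrightarrow> 0) (at 1 within sphere 0 1)"
    proof (rule Lim_null_comparison)
      have C: "C \<ge> 0" using assms(2)[of 0] by simp
      show "\<forall>\<^sub>F z in at 1 within sphere 0 1. norm (?F z) \<le> C * \<bar>min 1 (K * cmod (z - 1))\<bar>"
        using C assms(2) by (intro always_eventually allI) (auto simp: abs_mult intro!: mult_mono)
      have "((\<lambda>z. C * \<bar>min 1 (K * cmod (z - 1))\<bar>) \<longlongrightarrow> C * \<bar>min 1 (K * cmod (1 - 1 :: complex))\<bar>) (at 1 within sphere 0 1)"
        by (intro tendsto_intros)
      then show "((\<lambda>z. C * \<bar>min 1 (K * cmod (z - 1))\<bar>) \<longlongrightarrow> 0) (at 1 within sphere 0 1)"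
        by simp
    qed
    then show ?thesis unfolding continuous_within True by simp
  next
    case False
    have "z \<notin> \<real>\<^sub>\<ge>\<^sub>0"
      using z False by (auto elim!: nonneg_Reals_cases)
    then have "continuous (at z) Arg2pi" by (rule continuous_at_Arg2pi)
    moreover have "isCont g (Arg2pi z)"
      using assms(1) by (simp add: continuous_on_eq_continuous_at)
    ultimately have "continuous (at z) (\<lambda>z. g (Arg2pi z))"
      by (rule continuous_within_compose3[rotated])
    then have "continuous (at z) ?F"
      by (intro continuous_intros)
    then show ?thesis by (rule continuous_at_imp_continuous_at_within)
  qed
qed

lemma Arg2pi_cis: "0 \<le> t \<Longrightarrow> t < 2 * pi \<Longrightarrow> Arg2pi (cis t) = t"
  using Arg2pi_unique[of 1 t "cis t"] by (simp add: cis_conv_exp)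

lemma cis_eq_1_imp: "0 < t \<Longrightarrow> t < 2 * pi \<Longrightarrow> cis t \<noteq> 1"
  using Arg2pi_cis[of t] Arg2pi_of_real[of 1] by auto

text \<open>A measurable function is an almost everywhere limit of continuous ones. These are made
  bounded, made continuous on the circle, and approximated uniformly by Laurent polynomials with
  error 1 / (N + 1); lastly the mean is removed. The polynomial and its mean are each at most C + 1
  in modulus, which gives the bound 2 C + 2.\<close>

lemma trig_approx_AE:
  fixes w :: "real \<Rightarrow> real"
  assumes w: "w \<in> borel_measurable borel" "\<And>t. \<bar>w t\<bar> \<le> C" "(\<integral>t. w t \<partial>angle_measure) = 0"
  shows "\<exists>c n. (\<forall>N. hermitian (c N) \<and> c N 0 = 0 \<and> (\<forall>k. int (n N) < \<bar>k\<bar> \<longrightarrow> c N k = 0) \<and>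
      (\<forall>t. norm (laurent (c N) (n N) (cis t)) \<le> 2 * C + 2)) \<and>
    (AE t in angle_measure. (\<lambda>N. laurent (c N) (n N) (cis t)) \<longlonglongrightarrow> of_real (w t))"
proof -
  have "w \<in> borel_measurable lebesgue"
    using w(1) by (simp add: measurable_completion)
  then have "w measurable_on UNIV"
    by (intro lebesgue_measurable_imp_measurable_on) auto
  then obtain Z g where Z: "negligible Z" and g: "\<And>n. continuous_on UNIV (g n)"
    and gw: "\<And>x. x \<notin> Z \<Longrightarrow> (\<lambda>n. g n x) \<longlonglongrightarrow> w x"
    unfolding measurable_on_def by auto
  \<comment> \<open>Nothing bounds the continuous approximants uniformly. Clipping at the bound of
    \<open>w\<close> does, and leaves the limit unchanged.\<close>
  define G where "G n t = max (- C) (min C (g n t))" for n :: nat and t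
  have C: "C \<ge> 0" using w(2)[of 0] by simp
  have G: "continuous_on UNIV (G n)" "\<bar>G n t\<bar> \<le> C" for n t
    using C unfolding G_def[abs_def] by (auto intro!: continuous_intros g)
  have Gw: "(\<lambda>n. G n t) \<longlonglongrightarrow> w t" if "t \<notin> Z" for t
  proof -
    have "(\<lambda>n. G n t) \<longlonglongrightarrow> max (- C) (min C (w t))"
      unfolding G_def by (intro tendsto_intros gw that)
    then show ?thesis using w(2)[of t] by (simp add: abs_le_iff max_def min_def split: if_splits)
  qed
  \<comment> \<open>The cutoff narrows with \<open>n\<close>: at each point other than 1 it is
    eventually 1, so the limit is lost only at the angle 0.\<close>
  define F where "F n z = G n (Arg2pi z) * min 1 (real n * cmod (z - 1))" for n :: nat and z
  have F: "continuous_on (sphere 0 1) (F n)" for n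
    unfolding F_def[abs_def] by (rule continuous_on_periodic G)+
  have F_le: "\<bar>F n z\<bar> \<le> C" for n z
  proof -
    have "\<bar>F n z\<bar> = \<bar>G n (Arg2pi z)\<bar> * min 1 (real n * cmod (z - 1))"
      unfolding F_def by (simp add: abs_mult)
    also have "\<dots> \<le> C * 1" using C G by (intro mult_mono) auto
    finally show ?thesis by simp
  qed
  have "\<exists>c n. hermitian c \<and> (\<forall>k. int n < \<bar>k\<bar> \<longrightarrow> c k = 0) \<and>
    (\<forall>z\<in>sphere 0 1. norm (laurent c n z - of_real (F N z)) < inverse (Suc N))" for N
    by (intro laurent_approx F) simp
  then obtain c n where c: "\<And>N. hermitian (c N)" "\<And>N k. int (n N) < \<bar>k\<bar> \<Longrightarrow> c N k = 0"
    "\<And>N z. z \<in> sphere 0 1 \<Longrightarrow> norm (laurent (c N) (n N) z - of_real (F N z)) < inverse (Suc N)"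
    by metis
  have c_le: "norm (laurent (c N) (n N) (cis t)) \<le> C + 1" for N t
  proof -
    have "norm (laurent (c N) (n N) (cis t)) \<le> norm (laurent (c N) (n N) (cis t) - of_real (F N (cis t))) + norm (of_real (F N (cis t)) :: complex)"
      using norm_triangle_sub add.commute by metis
    also have "\<dots> \<le> inverse (Suc N) + C"
      using c(3)[of "cis t" N] F_le[of N "cis t"] by (intro add_mono) auto
    also have "inverse (Suc N) \<le> (1::real)"
      by (simp add: inverse_eq_divide)
    finally show ?thesis by simp
  qed
  have "AE t in lborel. t \<notin> Z"
    using Z AE_not_in[of Z "lebesgue :: real measure"]
    by (auto simp: negligible_iff_null_sets AE_completion_iff)
  moreover have "AE t in lborel. t \<noteq> (0::real)"
    by (rule AE_lborel_singleton)
  ultimately have "AE t in lborel. 0 \<le> t \<and> t < 2 * pi \<longrightarrow> (\<lambda>N. laurent (c N) (n N) (cis t)) \<longlonglongrightarrow> of_real (w t)"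
  proof eventually_elim
    case (elim t)
    show ?case
    proof
      assume t: "0 \<le> t \<and> t < 2 * pi"
      have "(\<lambda>N. min 1 (real N * cmod (cis t - 1))) \<longlonglongrightarrow> 1"
      proof (rule tendsto_eventually)
        have "cmod (cis t - 1) > 0"
          using cis_eq_1_imp[of t] t elim by auto
        then obtain N0 where "1 < real N0 * cmod (cis t - 1)"
          using reals_Archimedean3 by blast
        then show "\<forall>\<^sub>F N in sequentially. min 1 (real N * cmod (cis t - 1)) = 1"
          unfolding eventually_sequentially
          by (intro exI[of _ N0] allI impI min_absorb1)
            (meson less_imp_le mult_right_mono norm_ge_zero of_nat_mono order_trans)
      qed
      then have "(\<lambda>N. F N (cis t)) \<longlonglongrightarrow> w t * 1"
        unfolding F_def using t elim by (intro tendsto_mult) (auto simp: Arg2pi_cis Gw)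
      then have 1: "(\<lambda>N. complex_of_real (F N (cis t))) \<longlonglongrightarrow> of_real (w t)"
        by (intro tendsto_of_real) simp
      have "(\<lambda>N. laurent (c N) (n N) (cis t) - of_real (F N (cis t))) \<longlonglongrightarrow> 0"
      proof (rule Lim_null_comparison)
        show "\<forall>\<^sub>F N in sequentially. norm (laurent (c N) (n N) (cis t) - of_real (F N (cis t))) \<le> inverse (Suc N)"
          using c(3)[of "cis t"] by (intro always_eventually allI less_imp_le) auto
      qed (rule LIMSEQ_inverse_real_of_nat)
      from tendsto_add[OF this 1] show "(\<lambda>N. laurent (c N) (n N) (cis t)) \<longlonglongrightarrow> of_real (w t)"
        by simp
    qed
  qed
  then have cw: "AE t in angle_measure. (\<lambda>N. laurent (c N) (n N) (cis t)) \<longlonglongrightarrow> of_real (w t)"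
    by (simp add: AE_angle_measure_iff)
  have c0: "complex_of_real (2 * pi) * c N 0 = (\<integral>t. laurent (c N) (n N) (cis t) \<partial>angle_measure)" for N
    using integral_laurent[of 1 "c N" "n N"] by (simp add: integral_circle_measure)
  have "(\<lambda>N. \<integral>t. laurent (c N) (n N) (cis t) \<partial>angle_measure) \<longlonglongrightarrow> (\<integral>t. complex_of_real (w t) \<partial>angle_measure)"
  proof (rule integral_dominated_convergence[where w = "\<lambda>_. C + 1"])
    show "integrable angle_measure (\<lambda>_. C + 1)"
      by (simp add: finite_measure.integrable_const)
  qed (use w(1) cw c_le in \<open>auto simp: cis_conv_exp\<close>)
  also have "(\<integral>t. complex_of_real (w t) \<partial>angle_measure) = 0"
    using w(3) by simp
  finally have "(\<lambda>N. (complex_of_real (2 * pi) * c N 0) / complex_of_real (2 * pi)) \<longlonglongrightarrow> 0 / complex_of_real (2 * pi)"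
    unfolding c0 by (intro tendsto_divide tendsto_const) auto
  then have c0_lim: "(\<lambda>N. c N 0) \<longlonglongrightarrow> 0" by simp
  have c0_le: "norm (c N 0) \<le> C + 1" for N
  proof -
    have "2 * pi * norm (c N 0) = norm (\<integral>t. laurent (c N) (n N) (cis t) \<partial>angle_measure)"
      unfolding c0[symmetric] by (simp add: norm_mult)
    also have "\<dots> \<le> (\<integral>t. norm (laurent (c N) (n N) (cis t)) \<partial>angle_measure)"
      by (rule integral_norm_bound)
    also have "\<dots> \<le> (\<integral>t. C + 1 \<partial>angle_measure)"
      using c_le by (intro integral_mono finite_measure.integrable_const_bound[where B = "C + 1"] finite_measure.integrable_const)
        (auto simp: cis_conv_exp)
    also have "\<dots> = 2 * pi * (C + 1)" by simp
    finally show ?thesis by (simp only: mult_le_cancel_left_pos pi_gt_zero zero_less_mult_iff zero_less_numeral simp_thms)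
  qed
  \<comment> \<open>Only polynomials with mean exactly 0 are admissible data on the annulus.
    Dropping the coefficient at \<open>0\<close> does not alter the limit, as these coefficients
    tend to the mean of \<open>w\<close>, which is 0.\<close>
  define d where "d N = (c N)(0 := 0)" for N
  have d: "laurent (d N) (n N) z = laurent (c N) (n N) z - c N 0" for N z
  proof -
    have "laurent (c N) (n N) z = c N 0 + (\<Sum>k\<in>{- int (n N)..int (n N)} - {0}. c N k * z powi k)"
      unfolding laurent_def by (subst sum.remove[of _ 0]) auto
    moreover have "laurent (d N) (n N) z = (\<Sum>k\<in>{- int (n N)..int (n N)} - {0}. c N k * z powi k)"
      unfolding laurent_def by (subst sum.remove[of _ 0]) (auto simp: d_def)
    ultimately show ?thesis by simp
  qed
  show ?thesis
  proof (intro exI[of _ d] exI[of _ n] conjI allI impI)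
    fix N
    show "hermitian (d N)" using c(1)[of N] by (simp add: hermitian_def d_def)
    show "d N 0 = 0" by (simp add: d_def)
    show "d N k = 0" if "int (n N) < \<bar>k\<bar>" for k using c(2)[OF that] by (simp add: d_def)
    show "norm (laurent (d N) (n N) (cis t)) \<le> 2 * C + 2" for t
      unfolding d using norm_triangle_ineq4[of "laurent (c N) (n N) (cis t)" "c N 0"] c_le[of N t] c0_le[of N] by simp
  next
    show "AE t in angle_measure. (\<lambda>N. laurent (d N) (n N) (cis t)) \<longlonglongrightarrow> of_real (w t)"
      using cw
    proof eventually_elim
      case (elim t)
      from tendsto_diff[OF elim c0_lim] show ?case by (simp add: d)
    qed
  qed
qed

section \<open>The Dirichlet problem on the annulus\<close>

text \<open>The Laurent polynomial with these coefficients has real part \<open>laurent a n z\<close> on \<open>|z| = 1\<close> and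
  \<open>laurent b n (z / q)\<close> on \<open>|z| = q\<close>. The coefficient at \<open>0\<close> vanishes, as \<open>x / 0 = 0\<close>.\<close>

definition dirichlet_coeff :: "real \<Rightarrow> (int \<Rightarrow> complex) \<Rightarrow> (int \<Rightarrow> complex) \<Rightarrow> int \<Rightarrow> complex" where
  "dirichlet_coeff q a b k = 2 * (a k - of_real (q powi k) * b k) / (1 - of_real ((q powi k)\<^sup>2))"

lemma laurent_scale:
  assumes "0 < q"
  shows "laurent c n (of_real q * w) = laurent (\<lambda>k. c k * of_real (q powi k)) n w"
  using assms unfolding laurent_def by (simp add: power_int_mult_distrib mult.assoc)

lemma powi_eq_1_imp:
  assumes "0 < q" "q < 1" "(q powi k)\<^sup>2 = (1::real)" shows "k = 0"
proof (rule ccontr)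
  assume "k \<noteq> 0"
  have "q powi k = 1"
    using assms zero_less_power_int[OF assms(1), of k] by (auto simp: power2_eq_1_iff)
  then have "real_of_int k * ln q = 0"
    using assms(1) by (simp flip: powr_real_of_int' add: powr_def)
  then show False using assms \<open>k \<noteq> 0\<close> by simp
qed

text \<open>With x = q^k, the numbers u = H(k) and v = cnj (H(-k)) must satisfy u + v = 2 a and x u
  + v / x = 2 b, one equation per circle. The determinant 1 / x - x vanishes only for x^2 = 1, that
  is k = 0, and elimination of v gives the formula for u.\<close>

lemma dirichlet_coeff_algebra:
  fixes x a b :: complex
  assumes x: "x \<noteq> 0" "1 - x\<^sup>2 \<noteq> 0"
  shows "(2 * (a - x * b) / (1 - x\<^sup>2) + 2 * (a - inverse x * b) / (1 - (inverse x)\<^sup>2)) / 2 = a"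
    and "(2 * (a - x * b) / (1 - x\<^sup>2) * x + 2 * (a - inverse x * b) / (1 - (inverse x)\<^sup>2) * inverse x) / 2 = b"
proof -
  define E where "E = 1 - x\<^sup>2"
  have E: "E \<noteq> 0" using x by (simp add: E_def)
  have "2 * (a - inverse x * b) / (1 - (inverse x)\<^sup>2)
      = (- x\<^sup>2 * (2 * (a - inverse x * b))) / (- x\<^sup>2 * (1 - (inverse x)\<^sup>2))"
    using x(1) by (intro mult_divide_mult_cancel_left[symmetric]) simp
  also have "- x\<^sup>2 * (1 - (inverse x)\<^sup>2) = E"
    using x(1) by (simp add: E_def right_diff_distrib power_inverse)
  also have "- x\<^sup>2 * (2 * (a - inverse x * b)) = 2 * (x * b - x\<^sup>2 * a)"
    using x(1) by (simp add: right_diff_distrib power2_eq_square)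
  finally have *: "2 * (a - inverse x * b) / (1 - (inverse x)\<^sup>2) = 2 * (x * b - x\<^sup>2 * a) / E" .
  have "2 * (a - x * b) + 2 * (x * b - x\<^sup>2 * a) = (2 * a) * E"
    by (simp add: E_def algebra_simps)
  then have "2 * (a - x * b) / E + 2 * (x * b - x\<^sup>2 * a) / E = (2 * a) * E / E"
    unfolding add_divide_distrib[symmetric] by (simp only:)
  then show "(2 * (a - x * b) / (1 - x\<^sup>2) + 2 * (a - inverse x * b) / (1 - (inverse x)\<^sup>2)) / 2 = a"
    unfolding * E_def[symmetric] using E by simp
  have "x * b - x\<^sup>2 * a = (b - x * a) * x"
    by (simp add: algebra_simps power2_eq_square)
  then have "(x * b - x\<^sup>2 * a) * inverse x = b - x * a"
    using x(1) by (simp only: mult.assoc right_inverse mult_1_right not_False_eq_True)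
  then have "2 * (a - x * b) * x + 2 * (x * b - x\<^sup>2 * a) * inverse x = 2 * (a - x * b) * x + 2 * (b - x * a)"
    by (simp only: mult.assoc)
  also have "\<dots> = (2 * b) * E"
    by (simp add: E_def algebra_simps power2_eq_square)
  finally have "2 * (a - x * b) * x + 2 * (x * b - x\<^sup>2 * a) * inverse x = (2 * b) * E" .
  then have "2 * (a - x * b) / E * x + 2 * (x * b - x\<^sup>2 * a) / E * inverse x = (2 * b) * E / E"
    unfolding times_divide_eq_left add_divide_distrib[symmetric] by (simp only:)
  then show "(2 * (a - x * b) / (1 - x\<^sup>2) * x + 2 * (a - inverse x * b) / (1 - (inverse x)\<^sup>2) * inverse x) / 2 = b"
    unfolding * E_def[symmetric] using E by simp
qed

lemma dirichlet_coeff_real_part: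
  assumes q: "0 < q" "q < 1" and h: "hermitian a" "hermitian b" "a 0 = 0" "b 0 = 0"
  defines "H \<equiv> dirichlet_coeff q a b"
  shows "(H k + cnj (H (- k))) / 2 = a k"
    and "(H k * of_real (q powi k) + cnj (H (- k) * of_real (q powi (- k)))) / 2 = b k"
proof -
  define x where "x = complex_of_real (q powi k)"
  have h': "cnj (a (- k)) = a k" "cnj (b (- k)) = b k"
    using h by (simp_all add: hermitian_def)
  have x0: "x \<noteq> 0" using q by (simp add: x_def)
  have xi: "cnj (of_real (q powi (- k))) = inverse x"
    by (simp add: x_def power_int_minus)
  have H: "H k = 2 * (a k - x * b k) / (1 - x\<^sup>2)"
    by (simp add: H_def dirichlet_coeff_def x_def)
  have Hm: "cnj (H (- k)) = 2 * (a k - inverse x * b k) / (1 - (inverse x)\<^sup>2)"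
    unfolding H_def dirichlet_coeff_def of_real_power complex_cnj_divide complex_cnj_mult
      complex_cnj_diff complex_cnj_power xi h' complex_cnj_one complex_cnj_numeral ..
  have "(H k + cnj (H (- k))) / 2 = a k \<and> (H k * x + cnj (H (- k)) * inverse x) / 2 = b k"
  proof (cases "k = 0")
    case True
    then show ?thesis using h by (simp add: H_def dirichlet_coeff_def)
  next
    case False
    have E: "1 - x\<^sup>2 \<noteq> 0"
    proof
      assume "1 - x\<^sup>2 = 0"
      then have "complex_of_real ((q powi k)\<^sup>2) = of_real 1" by (simp add: x_def)
      then have "(q powi k)\<^sup>2 = 1" by (simp only: of_real_eq_iff)
      then show False using powi_eq_1_imp[OF q] False by blast
    qed
    show ?thesis
      unfolding H Hm using dirichlet_coeff_algebra[OF x0 E] by blast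
  qed
  then show "(H k + cnj (H (- k))) / 2 = a k"
      "(H k * of_real (q powi k) + cnj (H (- k) * of_real (q powi (- k)))) / 2 = b k"
    unfolding complex_cnj_mult xi x_def[symmetric] by blast+
qed

lemma Re_laurent_dirichlet:
  assumes q: "0 < q" "q < 1" and h: "hermitian a" "hermitian b" "a 0 = 0" "b 0 = 0" and z: "norm z = 1"
  shows "of_real (Re (laurent (dirichlet_coeff q a b) n z)) = laurent a n z"
    and "of_real (Re (laurent (dirichlet_coeff q a b) n (of_real q * z))) = laurent b n z"
  using dirichlet_coeff_real_part[OF q h]
  by (simp_all add: laurent_scale[OF q(1)] Re_laurent_unit[OF z])

text \<open>The two estimates concern the Fourier coefficients of the solution on the outer and on
  the inner circle. A bound independent of \<open>k\<close> holds because q^k stays away from 1 for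
  k other than 0, and because growth of q^k for negative \<open>k\<close> is compensated by the
  denominator.\<close>

lemma norm_dirichlet_coeff_le:
  assumes q: "0 < q" "q < 1" and z: "a 0 = 0" "b 0 = 0"
  shows "norm (dirichlet_coeff q a b k) \<le> 2 / (1 - q\<^sup>2) * (norm (a k) + norm (b k))"
    and "norm (dirichlet_coeff q a b k * of_real (q powi k)) \<le> 2 / (1 - q\<^sup>2) * (norm (a k) + norm (b k))"
proof -
  define x where "x = q powi k"
  have x: "x > 0" using q by (simp add: x_def)
  have q2: "q\<^sup>2 < 1" using q by (simp add: power_less_one_iff)
  \<comment> \<open>A common form of both claims: (u, v) is (1, x) on the outer circle and (x, x^2)
    on the inner one, and each entry is at most \<open>max 1 (x\<^sup>2)\<close>.\<close>
  have bnd: "norm (2 * (u * a k - v * b k) / (1 - of_real (x\<^sup>2))) \<le> 2 / (1 - q\<^sup>2) * (norm (a k) + norm (b k))"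
    if uv: "norm u \<le> max 1 (x\<^sup>2)" "norm v \<le> max 1 (x\<^sup>2)" and k: "k \<noteq> 0" for u v :: complex
  proof -
    \<comment> \<open>For k > 0 this is 1 / (1 - x^2) with x \<le> q; for k < 0 it is 1 / (1 -
      x^(-2)) with 1 / x \<le> q. Both are at most 1 / (1 - q^2).\<close>
    define y where "y = max 1 (x\<^sup>2) / \<bar>1 - x\<^sup>2\<bar>"
    have y: "y \<le> 1 / (1 - q\<^sup>2)"
    proof (cases "k > 0")
      case True
      have "x \<le> q powi 1"
        unfolding x_def using q True by (intro power_int_decreasing) auto
      then have "x\<^sup>2 \<le> q\<^sup>2" using x by (intro power_mono) auto
      then show ?thesis unfolding y_def using q2 by (auto simp: max_def frac_le)
    next
      case False
      have "q powi (-1) \<le> x"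
        unfolding x_def using q False k by (intro power_int_decreasing) auto
      then have "1 / q \<le> x" by (simp add: power_int_minus divide_inverse)
      then have "(1 / q)\<^sup>2 \<le> x\<^sup>2" using q by (intro power_mono) auto
      then have x2: "1 / q\<^sup>2 \<le> x\<^sup>2" by (simp add: power_divide)
      have "1 < 1 / q\<^sup>2" using q q2 by simp
      with x2 have x1: "x\<^sup>2 > 1" by linarith
      have "1 \<le> q\<^sup>2 * x\<^sup>2" using x2 q by (simp add: field_simps)
      then show ?thesis unfolding y_def using q2 x1 by (simp add: max_def field_simps)
    qed
    have d: "\<bar>1 - x\<^sup>2\<bar> > 0" using powi_eq_1_imp[OF q, of k] k by (auto simp: x_def)
    have "norm (u * a k - v * b k) \<le> norm u * norm (a k) + norm v * norm (b k)"
      using norm_triangle_ineq4[of "u * a k" "v * b k"] by (simp add: norm_mult)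
    also have "\<dots> \<le> max 1 (x\<^sup>2) * norm (a k) + max 1 (x\<^sup>2) * norm (b k)"
      using uv by (intro add_mono mult_right_mono) auto
    finally have 1: "norm (u * a k - v * b k) \<le> max 1 (x\<^sup>2) * (norm (a k) + norm (b k))"
      by (simp add: distrib_left)
    have "norm (1 - complex_of_real (x\<^sup>2)) = \<bar>1 - x\<^sup>2\<bar>"
      by (metis norm_of_real of_real_1 of_real_diff)
    then have "norm (2 * (u * a k - v * b k) / (1 - of_real (x\<^sup>2))) = 2 * norm (u * a k - v * b k) / \<bar>1 - x\<^sup>2\<bar>"
      by (simp only: norm_mult norm_divide norm_numeral)
    also have "\<dots> \<le> 2 * (max 1 (x\<^sup>2) * (norm (a k) + norm (b k))) / \<bar>1 - x\<^sup>2\<bar>"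
      using 1 d by (intro divide_right_mono mult_left_mono) auto
    also have "\<dots> = 2 * (y * (norm (a k) + norm (b k)))" by (simp add: y_def)
    also have "\<dots> \<le> 2 * (1 / (1 - q\<^sup>2) * (norm (a k) + norm (b k)))"
      using y by (intro mult_left_mono mult_right_mono) auto
    finally show ?thesis by simp
  qed
  have x_le: "x \<le> max 1 (x\<^sup>2)"
    using x self_le_power[of x 2] by (cases "x \<le> 1") (auto simp: max.coboundedI1 max.coboundedI2)
  have z0: "norm (dirichlet_coeff q a b 0) = 0" using z by (simp add: dirichlet_coeff_def)
  have u: "norm (1::complex) \<le> max 1 (x\<^sup>2)" "norm (complex_of_real x) \<le> max 1 (x\<^sup>2)"
    "norm (complex_of_real (x\<^sup>2)) \<le> max 1 (x\<^sup>2)"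
    using x x_le by (simp_all only: norm_of_real norm_one) auto
  have "dirichlet_coeff q a b k = 2 * (1 * a k - of_real x * b k) / (1 - of_real (x\<^sup>2))"
    by (simp add: dirichlet_coeff_def x_def)
  then show "norm (dirichlet_coeff q a b k) \<le> 2 / (1 - q\<^sup>2) * (norm (a k) + norm (b k))"
    using bnd[OF u(1,2)] z z0 by (cases "k = 0") (simp, metis)
  have "dirichlet_coeff q a b k * of_real (q powi k) = 2 * (of_real x * a k - of_real (x\<^sup>2) * b k) / (1 - of_real (x\<^sup>2))"
    by (simp add: dirichlet_coeff_def x_def algebra_simps power2_eq_square)
  then show "norm (dirichlet_coeff q a b k * of_real (q powi k)) \<le> 2 / (1 - q\<^sup>2) * (norm (a k) + norm (b k))"
    using bnd[OF u(2,3)] z z0 by (cases "k = 0") (simp, metis)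
qed

lemma dirichlet_coeff_diff:
  "dirichlet_coeff q (\<lambda>k. a k - a' k) (\<lambda>k. b k - b' k) k = dirichlet_coeff q a b k - dirichlet_coeff q a' b' k"
  by (simp add: dirichlet_coeff_def diff_divide_distrib[symmetric] algebra_simps)

text \<open>L2 stability of the full complex solution, imaginary part included; applied to
  differences of approximants. The factor 4 collects one factor 2 from squaring a sum and one from
  having two circles.\<close>

lemma integral_dirichlet_le:
  assumes q: "0 < q" "q < 1" and z: "a 0 = 0" "b 0 = 0"
  shows "(\<integral>z. (norm (laurent (dirichlet_coeff q a b) n z))\<^sup>2 \<partial>boundary_measure q)
    \<le> 4 * (2 / (1 - q\<^sup>2))\<^sup>2 * ((\<integral>z. (norm (laurent a n z))\<^sup>2 \<partial>circle_measure 1) +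
         (\<integral>z. (norm (laurent b n z))\<^sup>2 \<partial>circle_measure 1))"
proof -
  let ?H = "dirichlet_coeff q a b" and ?I = "{- int n..int n}"
  define K where "K = (2 / (1 - q\<^sup>2))\<^sup>2"
  have sq: "(norm w)\<^sup>2 \<le> K * (2 * (norm (a k))\<^sup>2 + 2 * (norm (b k))\<^sup>2)"
    if "norm w \<le> 2 / (1 - q\<^sup>2) * (norm (a k) + norm (b k))" for w :: complex and k
  proof -
    have "(norm w)\<^sup>2 \<le> (2 / (1 - q\<^sup>2) * (norm (a k) + norm (b k)))\<^sup>2"
      using that by (intro power_mono) auto
    also have "\<dots> = K * (norm (a k) + norm (b k))\<^sup>2"
      unfolding K_def by (rule power_mult_distrib)
    also have "\<dots> \<le> K * (2 * (norm (a k))\<^sup>2 + 2 * (norm (b k))\<^sup>2)"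
      using norm_add_power2_le[of "norm (a k)" "norm (b k)"]
      by (intro mult_left_mono) (auto simp: K_def)
    finally show ?thesis .
  qed
  have "(\<integral>z. (norm (laurent ?H n z))\<^sup>2 \<partial>boundary_measure q)
     = (\<integral>z. (norm (laurent ?H n z))\<^sup>2 \<partial>circle_measure 1) + (\<integral>z. (norm (laurent ?H n z))\<^sup>2 \<partial>circle_measure q)"
    by (rule integral_boundary_measure[OF L2_integrable[OF L2_laurent[OF q(1)]]])
  also have "\<dots> = 2 * pi * (\<Sum>k\<in>?I. (norm (?H k))\<^sup>2) + 2 * pi * (\<Sum>k\<in>?I. (norm (?H k * of_real (q powi k)))\<^sup>2)"
    using parseval_laurent[of 1 ?H n] parseval_laurent[OF q(1), of ?H n] by simp
  also have "\<dots> \<le> 2 * pi * (\<Sum>k\<in>?I. K * (2 * (norm (a k))\<^sup>2 + 2 * (norm (b k))\<^sup>2))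
     + 2 * pi * (\<Sum>k\<in>?I. K * (2 * (norm (a k))\<^sup>2 + 2 * (norm (b k))\<^sup>2))"
    by (intro add_mono mult_left_mono sum_mono sq norm_dirichlet_coeff_le assms) auto
  also have "\<dots> = 4 * K * (2 * pi * (\<Sum>k\<in>?I. (norm (a k))\<^sup>2) + 2 * pi * (\<Sum>k\<in>?I. (norm (b k))\<^sup>2))"
    by (simp add: sum.distrib sum_distrib_left[symmetric] algebra_simps)
  also have "\<dots> = 4 * K * ((\<integral>z. (norm (laurent a n z))\<^sup>2 \<partial>circle_measure 1) +
         (\<integral>z. (norm (laurent b n z))\<^sup>2 \<partial>circle_measure 1))"
    using parseval_laurent[of 1 a n] parseval_laurent[of 1 b n] by simp
  finally show ?thesis by (simp add: K_def)
qed

text \<open>Stated as a Cauchy property because it has to be carried from the boundary data to the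
  solutions on the annulus, for which no limit function is known yet. Bounded convergence to
  \<open>w\<close> provides it.\<close>

lemma bounded_convergent_imp_L2_Cauchy:
  fixes p :: "nat \<Rightarrow> 'a \<Rightarrow> complex"
  assumes M: "finite_measure M" and meas: "\<And>N. p N \<in> borel_measurable M" "w \<in> borel_measurable M"
    and bnd: "\<And>N x. norm (p N x) \<le> C" and lim: "AE x in M. (\<lambda>N. p N x) \<longlonglongrightarrow> w x" and e: "e > 0"
  shows "\<exists>N. \<forall>i\<ge>N. \<forall>j\<ge>N. (\<integral>x. (norm (p i x - p j x))\<^sup>2 \<partial>M) < e"
proof -
  interpret finite_measure M by fact
  have w: "AE x in M. norm (w x) \<le> C"
    using lim by eventually_elim (rule Lim_bounded[OF tendsto_norm], use bnd in auto)
  have C: "C \<ge> 0" using bnd[of 0 undefined] norm_ge_zero order_trans by blast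
  have diff: "AE x in M. (norm (p i x - w x))\<^sup>2 \<le> (2 * C)\<^sup>2" for i
    using w
  proof eventually_elim
    case (elim x)
    show ?case
      using norm_triangle_ineq4[of "p i x" "w x"] bnd[of i x] elim by (intro power_mono) auto
  qed
  have int: "integrable M (\<lambda>x. (norm (p i x - w x))\<^sup>2)" for i
    using diff[of i] meas by (intro integrable_const_bound[where B = "(2 * C)\<^sup>2"]) auto
  have "(\<lambda>i. \<integral>x. (norm (p i x - w x))\<^sup>2 \<partial>M) \<longlonglongrightarrow> (\<integral>x. 0 \<partial>M)"
  proof (rule integral_dominated_convergence[where w = "\<lambda>_. (2 * C)\<^sup>2"])
    show "AE x in M. (\<lambda>i. (norm (p i x - w x))\<^sup>2) \<longlonglongrightarrow> 0"
      using lim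
    proof eventually_elim
      case (elim x)
      then have "(\<lambda>i. (norm (p i x - w x))\<^sup>2) \<longlonglongrightarrow> (norm (w x - w x))\<^sup>2"
        by (intro tendsto_intros)
      then show ?case by simp
    qed
  qed (use diff meas in auto)
  then have "\<forall>\<^sub>F i in sequentially. (\<integral>x. (norm (p i x - w x))\<^sup>2 \<partial>M) < e / 4"
    using e by (auto dest!: order_tendstoD(2)[where a = "e / 4"])
  then obtain N where N: "\<And>i. i \<ge> N \<Longrightarrow> (\<integral>x. (norm (p i x - w x))\<^sup>2 \<partial>M) < e / 4"
    unfolding eventually_sequentially by blast
  have "(\<integral>x. (norm (p i x - p j x))\<^sup>2 \<partial>M) < e" if "i \<ge> N" "j \<ge> N" for i j
  proof -
    have "(\<integral>x. (norm (p i x - p j x))\<^sup>2 \<partial>M) \<le> (\<integral>x. 2 * (norm (p i x - w x))\<^sup>2 + 2 * (norm (p j x - w x))\<^sup>2 \<partial>M)"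
    proof (rule integral_mono)
      show "integrable M (\<lambda>x. (norm (p i x - p j x))\<^sup>2)"
      proof (rule integrable_const_bound[where B = "(2 * C)\<^sup>2"])
        show "AE x in M. norm ((norm (p i x - p j x))\<^sup>2) \<le> (2 * C)\<^sup>2"
        proof (rule AE_I2)
          fix x
          have "norm (p i x - p j x) \<le> 2 * C"
            using norm_triangle_ineq4[of "p i x" "p j x"] bnd[of i x] bnd[of j x] by simp
          then show "norm ((norm (p i x - p j x))\<^sup>2) \<le> (2 * C)\<^sup>2"
            using power_mono[OF _ norm_ge_zero, of "p i x - p j x" "2 * C" 2] by simp
        qed
      qed (use meas in auto)
      show "integrable M (\<lambda>x. 2 * (norm (p i x - w x))\<^sup>2 + 2 * (norm (p j x - w x))\<^sup>2)"
        using int by auto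
      show "(norm (p i x - p j x))\<^sup>2 \<le> 2 * (norm (p i x - w x))\<^sup>2 + 2 * (norm (p j x - w x))\<^sup>2" for x
        using norm_diff_power2_le[of "p i x - w x" "p j x - w x"] by simp
    qed
    also have "\<dots> = 2 * (\<integral>x. (norm (p i x - w x))\<^sup>2 \<partial>M) + 2 * (\<integral>x. (norm (p j x - w x))\<^sup>2 \<partial>M)"
      using int by simp
    finally show ?thesis using N[OF that(1)] N[OF that(2)] by linarith
  qed
  then show ?thesis by blast
qed

text \<open>On each circle the real part coincides with a data polynomial and so inherits its bound;
  the imaginary part has no such control.\<close>

lemma laurent_Re_bounded:
  assumes q: "0 < q" "q < 1" and h: "hermitian a" "hermitian b" "a 0 = 0" "b 0 = 0"
    and le: "\<And>t. norm (laurent a n (cis t)) \<le> K" "\<And>t. norm (laurent b n (cis t)) \<le> K"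
    and z: "z \<in> sphere 0 1 \<union> sphere 0 q"
  shows "\<bar>Re (laurent (dirichlet_coeff q a b) n z)\<bar> \<le> K"
proof -
  define w where "w = cis (Arg z)"
  have w: "norm w = 1" by (simp add: w_def)
  have zw: "z = of_real (norm z) * w"
    using rcis_cmod_Arg[of z] by (simp add: w_def rcis_def)
  from z consider "norm z = 1" | "norm z = q" by auto
  then show ?thesis
  proof cases
    case 1
    then have "z = w" using zw by simp
    then have "\<bar>Re (laurent (dirichlet_coeff q a b) n z)\<bar> = norm (laurent a n w)"
      using Re_laurent_dirichlet(1)[OF q h w, of n] by (metis norm_of_real)
    then show ?thesis using le(1)[of "Arg z"] by (simp add: w_def)
  next
    case 2
    then have "z = of_real q * w" using zw by simp
    then have "\<bar>Re (laurent (dirichlet_coeff q a b) n z)\<bar> = norm (laurent b n w)"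
      using Re_laurent_dirichlet(2)[OF q h w, of n] by (metis norm_of_real)
    then show ?thesis using le(2)[of "Arg z"] by (simp add: w_def)
  qed
qed

lemma AE_circle_measure_angle:
  "AE z in circle_measure r. P z \<Longrightarrow> AE t in angle_measure. P (of_real r * cis t)"
  unfolding circle_measure_def by (rule AE_distrD[OF circle_map_measurable])

text \<open>The data are approximated by polynomials with mean 0, for which the problem is solved
  coefficientwise. L2 stability makes the solutions Cauchy in L2, hence in L1, and a subsequence
  converges almost everywhere. The real parts of the limit are read off from the data, since on each
  circle they are the data polynomials themselves.\<close>

lemma dirichlet_problem:
  fixes w1 w2 :: "real \<Rightarrow> real"
  assumes q: "0 < q" "q < 1"
    and w1: "w1 \<in> borel_measurable borel" "\<And>t. \<bar>w1 t\<bar> \<le> C" "(\<integral>t. w1 t \<partial>angle_measure) = 0"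
    and w2: "w2 \<in> borel_measurable borel" "\<And>t. \<bar>w2 t\<bar> \<le> C" "(\<integral>t. w2 t \<partial>angle_measure) = 0"
  obtains c n h K where "h \<in> borel_measurable borel"
    "\<And>N z. z \<in> sphere 0 1 \<union> sphere 0 q \<Longrightarrow> \<bar>Re (laurent (c N) (n N) z)\<bar> \<le> K"
    "AE z in boundary_measure q. (\<lambda>N. laurent (c N) (n N) z) \<longlonglongrightarrow> h z"
    "AE t in angle_measure. Re (h (cis t)) = w1 t"
    "AE t in angle_measure. Re (h (of_real q * cis t)) = w2 t"
proof -
  obtain a n where a: "\<And>N. hermitian (a N)" "\<And>N. a N 0 = 0" "\<And>N k. int (n N) < \<bar>k\<bar> \<Longrightarrow> a N k = 0"
    "\<And>N t. norm (laurent (a N) (n N) (cis t)) \<le> 2 * C + 2"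
    and a_lim: "AE t in angle_measure. (\<lambda>N. laurent (a N) (n N) (cis t)) \<longlonglongrightarrow> of_real (w1 t)"
    using trig_approx_AE[OF w1] by blast
  obtain b m where b: "\<And>N. hermitian (b N)" "\<And>N. b N 0 = 0" "\<And>N k. int (m N) < \<bar>k\<bar> \<Longrightarrow> b N k = 0"
    "\<And>N t. norm (laurent (b N) (m N) (cis t)) \<le> 2 * C + 2"
    and b_lim: "AE t in angle_measure. (\<lambda>N. laurent (b N) (m N) (cis t)) \<longlonglongrightarrow> of_real (w2 t)"
    using trig_approx_AE[OF w2] by blast
  define H where "H N = dirichlet_coeff q (a N) (b N)" for N
  \<comment> \<open>The approximations on the two circles have unrelated lengths, whereas the
    solution needs a single one.\<close>
  define p where "p N = max (n N) (m N)" for N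
  define s where "s N = laurent (H N) (p N)" for N
  have ap: "laurent (a N) P z = laurent (a N) (n N) z" if "n N \<le> P" for N P z
    by (rule laurent_extend[OF that]) (use a in auto)
  have bp: "laurent (b N) P z = laurent (b N) (m N) z" if "m N \<le> P" for N P z
    by (rule laurent_extend[OF that]) (use b in auto)
  have np: "n N \<le> p N" "m N \<le> p N" for N
    by (simp_all add: p_def)
  note ap' = ap[OF np(1)] and bp' = bp[OF np(2)]
  have Hp: "laurent (H N) P z = s N z" if "p N \<le> P" for N P z
    unfolding s_def by (rule laurent_extend[OF that]) (use a b in \<open>auto simp: H_def dirichlet_coeff_def p_def\<close>)
  define K where "K = 4 * (2 / (1 - q\<^sup>2))\<^sup>2"
  have "q\<^sup>2 < 1" using q by (simp add: power_less_one_iff)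
  then have K: "K > 0" by (simp add: K_def)
  have sdiff: "(\<integral>z. (norm (s i z - s j z))\<^sup>2 \<partial>boundary_measure q) \<le>
      K * ((\<integral>t. (norm (laurent (a i) (n i) (cis t) - laurent (a j) (n j) (cis t)))\<^sup>2 \<partial>angle_measure)
         + (\<integral>t. (norm (laurent (b i) (m i) (cis t) - laurent (b j) (m j) (cis t)))\<^sup>2 \<partial>angle_measure))" for i j
  proof -
    define P where "P = max (p i) (p j)"
    have P: "p i \<le> P" "p j \<le> P" "n i \<le> P" "n j \<le> P" "m i \<le> P" "m j \<le> P"
      by (auto simp: P_def p_def)
    have "s i z - s j z = laurent (dirichlet_coeff q (\<lambda>k. a i k - a j k) (\<lambda>k. b i k - b j k)) P z" for z
      using P by (simp add: dirichlet_coeff_diff[abs_def] laurent_diff Hp flip: H_def)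
    then have "(\<integral>z. (norm (s i z - s j z))\<^sup>2 \<partial>boundary_measure q)
       = (\<integral>z. (norm (laurent (dirichlet_coeff q (\<lambda>k. a i k - a j k) (\<lambda>k. b i k - b j k)) P z))\<^sup>2 \<partial>boundary_measure q)"
      by simp
    also have "\<dots> \<le> K * ((\<integral>z. (norm (laurent (\<lambda>k. a i k - a j k) P z))\<^sup>2 \<partial>circle_measure 1)
        + (\<integral>z. (norm (laurent (\<lambda>k. b i k - b j k) P z))\<^sup>2 \<partial>circle_measure 1))"
      unfolding K_def by (rule integral_dirichlet_le[OF q]) (simp_all add: a b)
    finally show ?thesis
      using P by (simp add: integral_circle_measure laurent_diff ap[where P=P] bp[where P=P])
  qed
  have meas: "s N \<in> borel_measurable borel" for N
    unfolding s_def by measurable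
  have sL: "s N \<in> L2 q" for N
    unfolding s_def by (rule L2_laurent[OF q(1)])
  obtain r where r: "strict_mono r" "AE z in boundary_measure q. Cauchy (\<lambda>i. s (r i) z)"
  proof (rule cauchy_L1_AE_cauchy_subseq[of "boundary_measure q" s])
    show "integrable (boundary_measure q) (s N)" for N
      using integral_norm_le_power2(1)[OF finite_boundary_measure _ L2_integrable[OF sL], of N 1] meas by simp
    fix e :: real assume e: "e > 0"
    \<comment> \<open>Chosen backwards: data errors below \<open>y\<close> give a squared L2 error
      of at most K (y + y) = d^2, and on mass 4 pi this bounds the L1 error by d (4 pi + 1) / 2 = e
      / 2.\<close>
    define d where "d = e / (4 * pi + 1)"
    have pp: "4 * pi + 1 > 0" using pi_gt_zero by linarith
    have d: "d > 0" using e pp by (simp add: d_def)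
    define y where "y = d\<^sup>2 / (2 * K)"
    have y: "y > 0" using d K by (simp add: y_def)
    have lm: "(\<lambda>t. laurent c k (cis t)) \<in> borel_measurable angle_measure" for c k
      by (auto simp: cis_conv_exp)
    obtain N1 where N1: "\<And>i j. i \<ge> N1 \<Longrightarrow> j \<ge> N1 \<Longrightarrow>
       (\<integral>t. (norm (laurent (a i) (n i) (cis t) - laurent (a j) (n j) (cis t)))\<^sup>2 \<partial>angle_measure) < y"
      using bounded_convergent_imp_L2_Cauchy[OF finite_angle_measure lm _ a(4) a_lim y] w1(1) by auto
    obtain N2 where N2: "\<And>i j. i \<ge> N2 \<Longrightarrow> j \<ge> N2 \<Longrightarrow>
       (\<integral>t. (norm (laurent (b i) (m i) (cis t) - laurent (b j) (m j) (cis t)))\<^sup>2 \<partial>angle_measure) < y"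
      using bounded_convergent_imp_L2_Cauchy[OF finite_angle_measure lm _ b(4) b_lim y] w2(1) by auto
    have "(\<integral>z. norm (s i z - s j z) \<partial>boundary_measure q) < e" if "i \<ge> max N1 N2" "j \<ge> max N1 N2" for i j
    proof -
      have "(\<integral>z. (norm (s i z - s j z))\<^sup>2 \<partial>boundary_measure q) \<le> K * (y + y)"
        using sdiff[of i j] N1[of i j] N2[of i j] that K
        by (elim order_trans) (intro mult_left_mono add_mono, auto)
      also have "\<dots> = d\<^sup>2" using K by (simp add: y_def)
      finally have I: "(\<integral>z. (norm (s i z - s j z))\<^sup>2 \<partial>boundary_measure q) \<le> d\<^sup>2" .
      have "(\<integral>z. norm (s i z - s j z) \<partial>boundary_measure q)
        \<le> (d * (4 * pi) + (\<integral>z. (norm (s i z - s j z))\<^sup>2 \<partial>boundary_measure q) / d) / 2"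
        using integral_norm_le_power2(2)[OF finite_boundary_measure _ L2_integrable[OF L2_diff[OF sL sL]] d, of i j] meas
        by simp
      also have "\<dots> \<le> (d * (4 * pi) + d\<^sup>2 / d) / 2"
        using I d by (intro divide_right_mono add_left_mono) auto
      also have "\<dots> = d * (4 * pi + 1) / 2" using d by (simp add: power2_eq_square distrib_left)
      also have "d * (4 * pi + 1) = e" using pp by (simp add: d_def del: distrib_left_numeral)
      finally show ?thesis using e by linarith
    qed
    then show "\<exists>N. \<forall>i\<ge>N. \<forall>j\<ge>N. (\<integral>z. norm (s i z - s j z) \<partial>boundary_measure q) < e"
      by blast
  qed (rule that)
  \<comment> \<open>Defined everywhere by \<open>lim\<close>, with unspecified values where the
    subsequence diverges; this keeps \<open>h\<close> Borel measurable on the whole plane.\<close>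
  define h where "h z = lim (\<lambda>i. s (r i) z)" for z
  have h_lim: "AE z in boundary_measure q. (\<lambda>i. s (r i) z) \<longlonglongrightarrow> h z"
    using r(2) unfolding h_def by eventually_elim (simp add: Cauchy_convergent_iff convergent_LIMSEQ_iff)
  have sub: "(\<lambda>i. x (r i)) \<longlonglongrightarrow> y" if "x \<longlonglongrightarrow> y" for x :: "nat \<Rightarrow> complex" and y
    using LIMSEQ_subseq_LIMSEQ[OF that r(1)] by (simp add: o_def)
  have Re1: "complex_of_real (Re (s N (cis t))) = laurent (a N) (n N) (cis t)"
    and Re2: "complex_of_real (Re (s N (of_real q * cis t))) = laurent (b N) (m N) (cis t)" for N t
    using Re_laurent_dirichlet[OF q a(1) b(1) a(2) b(2), of "cis t" N N "p N"]
    by (simp_all add: s_def H_def ap' bp')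
  show thesis
  proof (rule that[of h "\<lambda>i. H (r i)" "\<lambda>i. p (r i)" "2 * C + 2"])
    show "h \<in> borel_measurable borel"
      unfolding h_def[abs_def] using meas by (intro borel_measurable_lim_metric) auto
    show "\<bar>Re (laurent (H (r N)) (p (r N)) z)\<bar> \<le> 2 * C + 2" if "z \<in> sphere 0 1 \<union> sphere 0 q" for N z
      unfolding H_def using a b
      by (intro laurent_Re_bounded[OF q _ _ _ _ _ _ that]) (auto simp: ap' bp')
    show "AE z in boundary_measure q. (\<lambda>N. laurent (H (r N)) (p (r N)) z) \<longlonglongrightarrow> h z"
      using h_lim by (simp add: s_def)
    have h1: "AE t in angle_measure. (\<lambda>i. s (r i) (cis t)) \<longlonglongrightarrow> h (cis t)"
      using AE_circle_measure_angle[where r=1] h_lim unfolding AE_boundary_measure_iff by fastforce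
    show "AE t in angle_measure. Re (h (cis t)) = w1 t"
      using h1 a_lim
    proof eventually_elim
      case (elim t)
      have "(\<lambda>i. complex_of_real (Re (s (r i) (cis t)))) \<longlonglongrightarrow> of_real (Re (h (cis t)))"
        by (intro tendsto_intros elim)
      moreover have "(\<lambda>i. complex_of_real (Re (s (r i) (cis t)))) \<longlonglongrightarrow> of_real (w1 t)"
        unfolding Re1 by (rule sub[OF elim(2)])
      ultimately show ?case using LIMSEQ_unique of_real_eq_iff by blast
    qed
    have h2: "AE t in angle_measure. (\<lambda>i. s (r i) (of_real q * cis t)) \<longlonglongrightarrow> h (of_real q * cis t)"
      using AE_circle_measure_angle[where r=q] h_lim unfolding AE_boundary_measure_iff by fastforce
    show "AE t in angle_measure. Re (h (of_real q * cis t)) = w2 t"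
      using h2 b_lim
    proof eventually_elim
      case (elim t)
      have "(\<lambda>i. complex_of_real (Re (s (r i) (of_real q * cis t)))) \<longlonglongrightarrow> of_real (Re (h (of_real q * cis t)))"
        by (intro tendsto_intros elim)
      moreover have "(\<lambda>i. complex_of_real (Re (s (r i) (of_real q * cis t)))) \<longlonglongrightarrow> of_real (w2 t)"
        unfolding Re2 by (rule sub[OF elim(2)])
      ultimately show ?case using LIMSEQ_unique of_real_eq_iff by blast
    qed
  qed
qed

section \<open>The eigenfunctions\<close>

lemma H2_0_uniform_laurent:
  assumes q: "0 < q" and f: "uniform_laurent q f" "f \<in> borel_measurable borel"
  shows "f \<in> H2_0 q"
proof -
  have approx: "\<exists>c n. AE z in boundary_measure q. cmod (f z - laurent c n z) \<le> e" if e: "e > 0" for e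
  proof -
    obtain p where p: "is_laurent p" "\<forall>z\<in>sphere 0 1 \<union> sphere 0 q. cmod (f z - p z) < e"
      using f(1) e unfolding uniform_laurent_def by blast
    then obtain c n where c: "\<And>z. z \<noteq> 0 \<Longrightarrow> p z = laurent c n z"
      unfolding is_laurent_def by auto
    have "AE z in boundary_measure q. cmod (f z - laurent c n z) \<le> e"
      using AE_boundary_measure[OF less_imp_le[OF q]] AE_boundary_measure_nonzero[OF q]
    proof eventually_elim
      case (elim z)
      then show ?case using p(2) c[of z] by (metis less_imp_le)
    qed
    then show ?thesis by blast
  qed
  have L: "f \<in> L2 q"
  proof -
    obtain c n where "AE z in boundary_measure q. cmod (f z - laurent c n z) \<le> 1"
      using approx[of 1] by auto
    then have "(\<lambda>z. f z - laurent c n z) \<in> L2 q"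
      using f(2) by (intro L2_bounded) auto
    from L2_diff[OF this L2_laurent[OF q, of "\<lambda>k. - c k" n]] show ?thesis
      by (simp add: laurent_def sum_negf)
  qed
  show ?thesis
    unfolding H2_0_iff[OF q]
  proof (intro conjI L allI impI)
    fix e :: real assume "e > 0"
    \<comment> \<open>On mass 4 pi, a uniform error \<open>d\<close> contributes at most 4 pi d^2 =
      e / 2 to the squared distance.\<close>
    define d where "d = sqrt (e / (8 * pi))"
    have d: "d > 0" "d\<^sup>2 = e / (8 * pi)" using \<open>e > 0\<close> by (simp_all add: d_def)
    obtain c n where c: "AE z in boundary_measure q. cmod (f z - laurent c n z) \<le> d"
      using approx[OF d(1)] by blast
    have "(\<integral>z. (cmod (f z - laurent c n z))\<^sup>2 \<partial>boundary_measure q) \<le> (\<integral>z. d\<^sup>2 \<partial>boundary_measure q)"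
    proof (rule integral_mono_AE)
      show "integrable (boundary_measure q) (\<lambda>z. (cmod (f z - laurent c n z))\<^sup>2)"
        by (rule L2_integrable[OF L2_diff[OF L L2_laurent[OF q]]])
      show "AE z in boundary_measure q. (cmod (f z - laurent c n z))\<^sup>2 \<le> d\<^sup>2"
        using c by eventually_elim (auto intro: power_mono)
    qed (simp add: finite_measure.integrable_const)
    also have "\<dots> = e / 2" using d by simp
    finally have "(\<integral>z. (cmod (f z - laurent c n z))\<^sup>2 \<partial>boundary_measure q) < e"
      using \<open>e > 0\<close> by simp
    then show "\<exists>c n. (\<integral>z. (cmod (f z - laurent c n z))\<^sup>2 \<partial>boundary_measure q) < e"
      by blast
  qed
qed

lemma borel_measurable_exp_complex [measurable (raw)]:
  fixes f :: "'a \<Rightarrow> complex"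
  shows "f \<in> borel_measurable M \<Longrightarrow> (\<lambda>x. exp (f x)) \<in> borel_measurable M"
  by (rule measurable_compose[where N=borel])
    (auto intro!: borel_measurable_continuous_onI continuous_intros)

lemma cmod_exp_le: "\<bar>Re w\<bar> \<le> K \<Longrightarrow> cmod (exp w) \<le> exp K" "\<bar>Re w\<bar> \<le> K \<Longrightarrow> cmod (exp (- w)) \<le> exp K"
  by (auto simp: norm_exp_eq_Re)

text \<open>The modulus of an exponential sees only the real part, so both exp(h) and exp(-h), and
  all their approximants, are bounded by exp(K) on the boundary. Dominated convergence with a
  constant majorant then carries over membership in the Hardy space and Cauchy's theorem.\<close>

lemma limit_exp_laurent:
  assumes q: "0 < q" and h: "h \<in> borel_measurable borel"
    and K: "\<And>N z. z \<in> sphere 0 1 \<union> sphere 0 q \<Longrightarrow> \<bar>Re (laurent (c N) (n N) z)\<bar> \<le> K"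
    and lim: "AE z in boundary_measure q. (\<lambda>N. laurent (c N) (n N) z) \<longlonglongrightarrow> h z"
  shows exp_limit_H2_0: "(\<lambda>z. z powi k * exp (h z)) \<in> H2_0 q"
    and exp_limit_integral: "(\<integral>z. z powi k * exp (- h z) \<partial>circle_measure 1) = (\<integral>z. z powi k * exp (- h z) \<partial>circle_measure q)"
    and exp_limit_bound: "AE z in boundary_measure q. \<bar>Re (h z)\<bar> \<le> K"
proof -
  let ?s = "\<lambda>N. laurent (c N) (n N)"
  note ae = AE_boundary_measure[OF less_imp_le[OF q]]
  show hK: "AE z in boundary_measure q. \<bar>Re (h z)\<bar> \<le> K"
    using lim ae
  proof eventually_elim
    case (elim z)
    have "(\<lambda>N. \<bar>Re (?s N z)\<bar>) \<longlonglongrightarrow> \<bar>Re (h z)\<bar>"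
      by (intro tendsto_intros elim)
    then show ?case by (rule Lim_bounded[where M=0]) (use K elim in auto)
  qed
  define B where "B = max 1 (q powi k)"
  have B: "cmod (z powi k) \<le> B" if "z \<in> sphere 0 1 \<union> sphere 0 q" for z
    using that by (auto simp: B_def norm_power_int intro: max.coboundedI1 max.coboundedI2)
  have B0: "B \<ge> 0" by (simp add: B_def)
  let ?f = "\<lambda>z. z powi k * exp (h z)" and ?fN = "\<lambda>N z. z powi k * exp (?s N z)"
  have le: "cmod (z powi k * exp w) \<le> B * exp K" if "z \<in> sphere 0 1 \<union> sphere 0 q" "\<bar>Re w\<bar> \<le> K" for z w
    unfolding norm_mult using that B B0 cmod_exp_le by (intro mult_mono) auto
  have fb: "AE z in boundary_measure q. cmod (?f z) \<le> B * exp K"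
    using hK ae by eventually_elim (rule le)
  have fL: "?f \<in> L2 q"
    using fb h by (intro L2_bounded) measurable
  have gH: "?fN N \<in> H2_0 q" for N
    by (intro H2_0_uniform_laurent q uniform_laurent_powi_mult uniform_laurent_exp) measurable
  have "(\<lambda>N. \<integral>z. (cmod (?f z - ?fN N z))\<^sup>2 \<partial>boundary_measure q) \<longlonglongrightarrow> (\<integral>z. 0 \<partial>boundary_measure q)"
  proof (rule integral_dominated_convergence[where w = "\<lambda>_. (2 * (B * exp K))\<^sup>2"])
    show "AE z in boundary_measure q. (\<lambda>N. (cmod (?f z - ?fN N z))\<^sup>2) \<longlonglongrightarrow> 0"
      using lim
    proof eventually_elim
      case (elim z)
      then have "(\<lambda>N. (cmod (?f z - ?fN N z))\<^sup>2) \<longlonglongrightarrow> (cmod (?f z - ?f z))\<^sup>2"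
        by (intro tendsto_intros)
      then show ?case by simp
    qed
    show "AE z in boundary_measure q. norm ((cmod (?f z - ?fN N z))\<^sup>2) \<le> (2 * (B * exp K))\<^sup>2" for N
      using fb ae
    proof eventually_elim
      case (elim z)
      have "cmod (?f z - ?fN N z) \<le> 2 * (B * exp K)"
        using norm_triangle_ineq4[of "?f z" "?fN N z"] elim le[of z "?s N z"] K[of z N] by simp
      then have "(cmod (?f z - ?fN N z))\<^sup>2 \<le> (2 * (B * exp K))\<^sup>2"
        by (intro power_mono norm_ge_zero)
      then show ?case by (simp only: real_norm_def abs_power2)
    qed
    show "integrable (boundary_measure q) (\<lambda>_. (2 * (B * exp K))\<^sup>2)"
      by (simp add: finite_measure.integrable_const)
    show "(\<lambda>z. (cmod (?f z - ?fN N z))\<^sup>2) \<in> borel_measurable (boundary_measure q)" for N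
      using L2_measurable[OF fL] gH[of N] unfolding H2_0_def L2_def by auto
  qed simp
  then have lim0: "(\<lambda>N. \<integral>z. (cmod (?f z - ?fN N z))\<^sup>2 \<partial>boundary_measure q) \<longlonglongrightarrow> 0"
    by simp
  show "?f \<in> H2_0 q"
  proof (rule H2_0_approx[OF q fL])
    fix e :: real assume "e > 0"
    with lim0 have "\<forall>\<^sub>F N in sequentially. (\<integral>z. (cmod (?f z - ?fN N z))\<^sup>2 \<partial>boundary_measure q) < e"
      by (rule order_tendstoD)
    then obtain N where "(\<integral>z. (cmod (?f z - ?fN N z))\<^sup>2 \<partial>boundary_measure q) < e"
      unfolding eventually_sequentially by blast
    with gH[of N] show "\<exists>g\<in>H2_0 q. (\<integral>z. (cmod (?f z - g z))\<^sup>2 \<partial>boundary_measure q) < e"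
      by (intro bexI[of _ "?fN N"])
  qed
  let ?u = "\<lambda>z. z powi k * exp (- h z)" and ?uN = "\<lambda>N z. z powi k * exp (- ?s N z)"
  have conv: "(\<lambda>N. \<integral>z. ?uN N z \<partial>circle_measure r) \<longlonglongrightarrow> (\<integral>z. ?u z \<partial>circle_measure r)"
    if r: "0 \<le> r" "sphere (0::complex) r \<subseteq> sphere 0 1 \<union> sphere 0 q"
      and limr: "AE z in circle_measure r. (\<lambda>N. ?s N z) \<longlonglongrightarrow> h z" for r
  proof (rule integral_dominated_convergence[where w = "\<lambda>_. B * exp K"])
    show "AE z in circle_measure r. (\<lambda>N. ?uN N z) \<longlonglongrightarrow> ?u z"
      using limr by eventually_elim (intro tendsto_intros)
    show "AE z in circle_measure r. norm (?uN N z) \<le> B * exp K" for N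
      using AE_circle_measure[OF r(1)]
    proof eventually_elim
      case (elim z)
      then have "z \<in> sphere 0 1 \<union> sphere 0 q" using r(2) by blast
      then show ?case using le[of z "- ?s N z"] K[of z N] by simp
    qed
    show "integrable (circle_measure r) (\<lambda>_. B * exp K)"
      by (simp add: finite_measure.integrable_const)
  qed (use h in measurable)
  have eqN: "(\<integral>z. ?uN N z \<partial>circle_measure 1) = (\<integral>z. ?uN N z \<partial>circle_measure q)" for N
  proof (rule integral_uniform_laurent[OF q])
    have "- ?s N z = laurent (\<lambda>j. - c N j) (n N) z" for z
      by (simp add: laurent_def sum_negf)
    then show "uniform_laurent q (?uN N)"
      using uniform_laurent_powi_mult[OF q uniform_laurent_exp[OF q], of k "\<lambda>j. - c N j" "n N"] by simp
  qed measurable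
  have "(\<lambda>N. \<integral>z. ?uN N z \<partial>circle_measure 1) \<longlonglongrightarrow> (\<integral>z. ?u z \<partial>circle_measure 1)"
    "(\<lambda>N. \<integral>z. ?uN N z \<partial>circle_measure q) \<longlonglongrightarrow> (\<integral>z. ?u z \<partial>circle_measure q)"
    using lim q unfolding AE_boundary_measure_iff by (auto intro!: conv)
  then show "(\<integral>z. ?u z \<partial>circle_measure 1) = (\<integral>z. ?u z \<partial>circle_measure q)"
    unfolding eqN by (rule LIMSEQ_unique)
qed

text \<open>Trades the analytic factor \<open>z powi k\<close> for an antianalytic one, at the price
  of the radial constant r^(2 k). This constant is the integer part of the quantisation.\<close>

lemma powi_mult_cnj_powi:
  assumes "norm z = r" "r > 0"
  shows "z powi k * cnj (z powi j) = of_real ((r powi k)\<^sup>2) * cnj (z powi (j - k))"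
proof -
  have z: "z \<noteq> 0" using assms by auto
  have "z powi j = z powi (j - k) * z powi k"
    using z power_int_add[of z "j - k" k] by simp
  then have "z powi k * cnj (z powi j) = (z powi k * cnj (z powi k)) * cnj (z powi (j - k))"
    by (simp only: complex_cnj_mult mult_ac)
  also have "z powi k * cnj (z powi k) = of_real ((r powi k)\<^sup>2)"
    by (simp only: complex_norm_square[symmetric] norm_power_int assms)
  finally show ?thesis .
qed

text \<open>On each circle \<open>\<phi> - x\<close> is a constant multiple of \<open>exp (- 2 Re h)\<close>, which turns the factor
  \<open>exp h\<close> of the eigenfunction into the conjugate of the analytic function \<open>exp (- h)\<close>.\<close>

lemma eigenfunction_boundary_identity:
  assumes "norm z = r" "r > 0" "y = \<sigma> * exp l" "Re w = (A - l) / 2"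
  shows "of_real (y * (r powr \<alpha>)\<^sup>2) * (z powi k * exp w) * cnj (z powi j)
    = of_real (\<sigma> * (exp A * (r powr \<alpha>)\<^sup>2 * (r powi k)\<^sup>2)) * cnj (z powi (j - k) * exp (- w))"
proof -
  have "l = A - 2 * Re w"
    using assms(4) by simp
  then have "of_real l + w = of_real A + (w - of_real (2 * Re w))"
    by simp
  then have "exp (of_real l) * exp w = exp (of_real A) * exp (w - of_real (2 * Re w))"
    unfolding exp_add[symmetric] by (simp only:)
  then have "of_real (exp l) * exp w = of_real (exp A) * exp (w - of_real (2 * Re w))"
    unfolding exp_of_real .
  also have "w - of_real (2 * Re w) = cnj (- w)"
    by (simp add: complex_eq_iff)
  finally have *: "of_real (exp l) * exp w = of_real (exp A) * cnj (exp (- w))"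
    by (simp only: exp_cnj)
  have "of_real (y * (r powr \<alpha>)\<^sup>2) * (z powi k * exp w) * cnj (z powi j)
    = of_real \<sigma> * of_real ((r powr \<alpha>)\<^sup>2) * (of_real (exp l) * exp w) * (z powi k * cnj (z powi j))"
    unfolding assms(3) by (simp only: of_real_mult mult_ac)
  also have "\<dots> = of_real (\<sigma> * (exp A * (r powr \<alpha>)\<^sup>2 * (r powi k)\<^sup>2)) * cnj (z powi (j - k) * exp (- w))"
    unfolding * powi_mult_cnj_powi[OF assms(1,2)] by (simp only: of_real_mult complex_cnj_mult mult_ac)
  finally show ?thesis .
qed

lemma borel_measurable_circle_map [measurable]: "(\<lambda>t. of_real r * cis t) \<in> borel_measurable borel"
  by (simp add: cis_conv_exp)

lemma integral_centred_half:
  fixes f :: "complex \<Rightarrow> real" and r :: real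
  assumes "f \<in> borel_measurable borel" "\<And>z. \<bar>f z\<bar> \<le> K"
  defines "A \<equiv> (\<integral>z. f z \<partial>circle_measure r) / (2 * pi)"
  shows "(\<integral>t. (A - f (of_real r * cis t)) / 2 \<partial>angle_measure) = 0"
proof -
  have "integrable angle_measure (\<lambda>t. f (of_real r * cis t))"
    using assms by (intro finite_measure.integrable_const_bound[OF finite_angle_measure, where B=K]) auto
  then have "(\<integral>t. (A - f (of_real r * cis t)) / 2 \<partial>angle_measure)
      = (2 * pi * A - (\<integral>t. f (of_real r * cis t) \<partial>angle_measure)) / 2"
    by (simp add: finite_measure.integrable_const)
  also have "\<dots> = 0"
    by (simp add: A_def integral_circle_measure[OF assms(1)])
  finally show ?thesis .
qed

text \<open>The sign \<open>s\<close> records which circle lies above the gap, so both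
  configurations are treated at once; the margin \<open>d\<close> keeps the logarithm bounded. The
  condition \<open>period\<close> makes the constants on the two circles cancel.\<close>

lemma toeplitz_eigenvalue_condition:
  fixes \<phi> :: "complex \<Rightarrow> real" and k :: int
  assumes q: "0 < q" "q < 1"
    and phi: "\<phi> \<in> borel_measurable borel" "AE z in boundary_measure q. \<bar>\<phi> z\<bar> \<le> C"
    and s: "s = 1 \<or> s = - 1" and d: "d > 0"
    and gap1: "AE z in circle_measure 1. d \<le> s * (\<phi> z - x)"
    and gapq: "AE z in circle_measure q. d \<le> - s * (\<phi> z - x)"
    and period: "(\<integral>z. ln \<bar>\<phi> z - x\<bar> \<partial>circle_measure 1) - (\<integral>z. ln \<bar>\<phi> z - x\<bar> \<partial>circle_measure q)
       = 4 * pi * (\<alpha> + of_int k) * ln q"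
  shows "toeplitz_eigenvalue q \<alpha> \<phi> (of_real x)"
proof -
  define K where "K = max \<bar>ln d\<bar> \<bar>ln (C + \<bar>x\<bar>)\<bar>"
  have ss: "s * s = 1" "\<bar>s\<bar> = 1" using s by auto
  \<comment> \<open>The logarithm is bounded only almost everywhere; clipping yields a bound at
    every point, as \<open>dirichlet_problem\<close> demands of its data, and changes it on a null
    set only.\<close>
  define L where "L z = max (- K) (min K (ln \<bar>\<phi> z - x\<bar>))" for z
  have K0: "K \<ge> 0" by (auto simp: K_def)
  have L: "L \<in> borel_measurable borel" "\<bar>L z\<bar> \<le> K" for z
    using phi K0 unfolding L_def[abs_def] by (auto simp: abs_le_iff)
  have L_eq: "L z = ln \<bar>\<phi> z - x\<bar>" "exp (L z) = \<bar>\<phi> z - x\<bar>"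
    if "d \<le> \<bar>\<phi> z - x\<bar>" "\<bar>\<phi> z\<bar> \<le> C" for z
  proof -
    have "ln d \<le> ln \<bar>\<phi> z - x\<bar>" "ln \<bar>\<phi> z - x\<bar> \<le> ln (C + \<bar>x\<bar>)"
      using that d by (auto intro!: ln_mono)
    then have "\<bar>ln \<bar>\<phi> z - x\<bar>\<bar> \<le> K" unfolding K_def by linarith
    then show "L z = ln \<bar>\<phi> z - x\<bar>" by (auto simp: L_def abs_le_iff)
    then show "exp (L z) = \<bar>\<phi> z - x\<bar>" using that d by simp
  qed
  have phi1: "AE z in circle_measure 1. \<bar>\<phi> z\<bar> \<le> C" and phiq: "AE z in circle_measure q. \<bar>\<phi> z\<bar> \<le> C"
    using phi(2) unfolding AE_boundary_measure_iff by auto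
  have L1: "AE z in circle_measure 1. L z = ln \<bar>\<phi> z - x\<bar> \<and> \<phi> z - x = s * exp (L z)"
    using phi1 gap1
  proof eventually_elim
    case (elim z)
    have "\<bar>\<phi> z - x\<bar> = s * (\<phi> z - x)" using elim d s by auto
    with L_eq[of z] elim ss show ?case by (simp add: mult.assoc[symmetric])
  qed
  have Lq: "AE z in circle_measure q. L z = ln \<bar>\<phi> z - x\<bar> \<and> \<phi> z - x = - s * exp (L z)"
    using phiq gapq
  proof eventually_elim
    case (elim z)
    have "\<bar>\<phi> z - x\<bar> = - s * (\<phi> z - x)" using elim d s by auto
    with L_eq[of z] elim ss show ?case by (simp add: mult.assoc[symmetric])
  qed
  define a0 where "a0 = (\<integral>z. L z \<partial>circle_measure 1) / (2 * pi)"
  define b0 where "b0 = (\<integral>z. L z \<partial>circle_measure q) / (2 * pi)"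
  have "(\<integral>z. L z \<partial>circle_measure 1) = (\<integral>z. ln \<bar>\<phi> z - x\<bar> \<partial>circle_measure 1)"
    using L1 L(1) phi(1) by (intro integral_cong_AE) (auto elim: eventually_mono)
  moreover have "(\<integral>z. L z \<partial>circle_measure q) = (\<integral>z. ln \<bar>\<phi> z - x\<bar> \<partial>circle_measure q)"
    using Lq L(1) phi(1) by (intro integral_cong_AE) (auto elim: eventually_mono)
  ultimately have "a0 - b0 = 4 * pi * (\<alpha> + of_int k) * ln q / (2 * pi)"
    unfolding a0_def b0_def period[symmetric] by (simp add: diff_divide_distrib)
  also have "\<dots> = 2 * (\<alpha> + of_int k) * ln q"
    by simp
  finally have ab: "a0 = b0 + (2 * (\<alpha> * ln q) + 2 * (of_int k * ln q))"
    by (simp add: algebra_simps)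
  have "(q powr \<alpha>)\<^sup>2 = exp (2 * (\<alpha> * ln q))" "(q powi k)\<^sup>2 = exp (2 * (of_int k * ln q))"
    using q by (simp_all add: powr_def exp_double powr_real_of_int'[symmetric])
  \<comment> \<open>This is the matching of constants: the left side belongs to the outer circle;
    the right side collects the mean, the modulus of \<chi>^\<alpha> and that of z^k on the inner
    circle.\<close>
  then have exp_ab: "exp a0 = exp b0 * (q powr \<alpha>)\<^sup>2 * (q powi k)\<^sup>2"
    unfolding ab by (simp add: exp_add)
  define w1 where "w1 t = (a0 - L (of_real 1 * cis t)) / 2" for t
  define w2 where "w2 t = (b0 - L (of_real q * cis t)) / 2" for t
  define C' where "C' = \<bar>a0\<bar> + \<bar>b0\<bar> + K"
  have w: "w1 \<in> borel_measurable borel" "w2 \<in> borel_measurable borel"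
    unfolding w1_def[abs_def] w2_def[abs_def] using L(1) by measurable
  have w_le: "\<bar>w1 t\<bar> \<le> C'" "\<bar>w2 t\<bar> \<le> C'" for t
    using L(2)[of "of_real 1 * cis t"] L(2)[of "of_real q * cis t"] unfolding w1_def w2_def C'_def by auto
  have w0: "(\<integral>t. w1 t \<partial>angle_measure) = 0" "(\<integral>t. w2 t \<partial>angle_measure) = 0"
    unfolding w1_def w2_def a0_def b0_def by (rule integral_centred_half[OF L])+
  obtain c n h R where h: "h \<in> borel_measurable borel"
    and R: "\<And>N z. z \<in> sphere 0 1 \<union> sphere 0 q \<Longrightarrow> \<bar>Re (laurent (c N) (n N) z)\<bar> \<le> R"
    and lim: "AE z in boundary_measure q. (\<lambda>N. laurent (c N) (n N) z) \<longlonglongrightarrow> h z"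
    and hw: "AE t in angle_measure. Re (h (cis t)) = w1 t" "AE t in angle_measure. Re (h (of_real q * cis t)) = w2 t"
    by (rule dirichlet_problem[OF q w(1) w_le(1) w0(1) w(2) w_le(2) w0(2)]) (rule that)
  have h1: "AE z in circle_measure 1. Re (h z) = (a0 - L z) / 2"
    using hw(1) h L(1) by (subst AE_circle_measure_iff) (auto simp: w1_def)
  have hq: "AE z in circle_measure q. Re (h z) = (b0 - L z) / 2"
    using hw(2) h L(1) by (subst AE_circle_measure_iff) (auto simp: w2_def)
  define f0 where "f0 z = z powi k * exp (h z)" for z
  have f0: "f0 \<in> H2_0 q"
    unfolding f0_def[abs_def] by (rule exp_limit_H2_0[OF q(1) h R lim])
  have f0m: "f0 \<in> borel_measurable borel"
    using f0 by (auto simp: H2_0_def dest: L2_measurable)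
  define J where "J j = (\<integral>z. z powi j * exp (- h z) \<partial>circle_measure 1)" for j
  have Jq: "J j = (\<integral>z. z powi j * exp (- h z) \<partial>circle_measure q)" for j
    unfolding J_def by (rule exp_limit_integral[OF q(1) h R lim])
  have hR: "AE z in boundary_measure q. \<bar>Re (h z)\<bar> \<le> R"
    by (rule exp_limit_bound[OF q(1) h R lim])
  note ae = AE_boundary_measure[OF less_imp_le[OF q(1)]]
  define B where "B = max 1 (q powr \<alpha>)"
  have B: "1 \<le> B" "q powr \<alpha> \<le> B" by (auto simp: B_def)
  have chi_le: "AE z in boundary_measure q. cmod (chi_pow \<alpha> z) \<le> B"
    using ae by eventually_elim (use B in \<open>auto simp: norm_chi_pow\<close>)
  have f0L: "f0 \<in> L2 q" using f0 by (simp add: H2_0_def)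
  define f where "f z = chi_pow \<alpha> z * f0 z" for z
  have fH: "f \<in> H2 q \<alpha>"
    unfolding H2_def f_def[abs_def] using L2_bounded_mult[OF f0L borel_measurable_chi_pow chi_le] f0 by auto
  \<comment> \<open>Testing against \<chi>^\<alpha> g multiplies \<chi>^\<alpha> by its conjugate.
    Only |z|^(2\<alpha>) remains, so the branch cut disappears and the test functions
    \<open>g\<close> range over the untwisted space.\<close>
  define F where "F z = of_real ((\<phi> z - x) * (cmod z powr \<alpha>)\<^sup>2) * f0 z" for z
  have Fm: "F \<in> borel_measurable borel"
    unfolding F_def[abs_def] using phi(1) f0m by measurable
  define Q where "Q = max 1 (q powi k)"
  have F_le: "AE z in boundary_measure q. cmod (F z) \<le> ((C + \<bar>x\<bar>) * B\<^sup>2) * (Q * exp R)"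
    using ae phi(2) hR
  proof eventually_elim
    case (elim z)
    have 1: "\<bar>\<phi> z - x\<bar> \<le> C + \<bar>x\<bar>" using elim by linarith
    have 2: "(cmod z powr \<alpha>)\<^sup>2 \<le> B\<^sup>2" using elim B by (intro power_mono) auto
    have 3: "cmod (z powi k) \<le> Q" using elim by (auto simp: Q_def norm_power_int)
    have 4: "cmod (exp (h z)) \<le> exp R" using elim cmod_exp_le by blast
    have "cmod (F z) = (\<bar>\<phi> z - x\<bar> * (cmod z powr \<alpha>)\<^sup>2) * (cmod (z powi k) * cmod (exp (h z)))"
      unfolding F_def f0_def norm_mult norm_of_real abs_mult abs_power2 ..
    also have "\<dots> \<le> ((C + \<bar>x\<bar>) * B\<^sup>2) * (Q * exp R)"
      using 1 2 3 4 by (intro mult_mono) (auto simp: Q_def)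
    finally show ?case .
  qed
  have FL: "F \<in> L2 q" by (rule L2_bounded[OF Fm F_le])
  have orth: "(\<integral>z. F z * cnj (z powi j) \<partial>boundary_measure q) = 0" for j
  proof -
    have powL: "(\<lambda>z. z powi j) \<in> L2 q"
      using H2_0_is_laurent[OF q(1) is_laurent_monomial[of 1 j]] by (simp add: H2_0_def)
    have m: "(\<lambda>z. F z * cnj (z powi j)) \<in> borel_measurable borel"
      by (intro borel_measurable_times Fm borel_measurable_cnj borel_measurable_powi)
    have m': "(\<lambda>z. z powi (j - k) * exp (- h z)) \<in> borel_measurable borel"
      by (intro borel_measurable_times borel_measurable_powi borel_measurable_exp_complex borel_measurable_uminus h)
    have *: "(\<integral>z. F z * cnj (z powi j) \<partial>circle_measure r) =
        of_real (\<sigma> * (exp A * (r powr \<alpha>)\<^sup>2 * (r powi k)\<^sup>2)) * cnj (\<integral>z. z powi (j - k) * exp (- h z) \<partial>circle_measure r)"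
      if r: "r > 0" and ph: "AE z in circle_measure r. L z = ln \<bar>\<phi> z - x\<bar> \<and> \<phi> z - x = \<sigma> * exp (L z)"
        and hh: "AE z in circle_measure r. Re (h z) = (A - L z) / 2" for r \<sigma> A
    proof -
      have "AE z in circle_measure r. F z * cnj (z powi j) =
        of_real (\<sigma> * (exp A * (r powr \<alpha>)\<^sup>2 * (r powi k)\<^sup>2)) * cnj (z powi (j - k) * exp (- h z))"
        using AE_circle_measure[OF less_imp_le[OF r]] ph hh
      proof eventually_elim
        case (elim z)
        from elim(1) have z: "norm z = r" by simp
        show ?case
          unfolding F_def f0_def z
          by (rule eigenfunction_boundary_identity[OF z r conjunct2[OF elim(2)] elim(3)])
      qed
      then have "(\<integral>z. F z * cnj (z powi j) \<partial>circle_measure r) =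
         (\<integral>z. of_real (\<sigma> * (exp A * (r powr \<alpha>)\<^sup>2 * (r powi k)\<^sup>2)) * cnj (z powi (j - k) * exp (- h z)) \<partial>circle_measure r)"
        using m m' by (intro integral_cong_AE) (auto simp del: complex_cnj_mult)
      then show ?thesis
        by (simp only: integral_mult_right_zero Bochner_Integration.integral_cnj)
    qed
    have "(\<integral>z. F z * cnj (z powi j) \<partial>boundary_measure q)
      = (\<integral>z. F z * cnj (z powi j) \<partial>circle_measure 1) + (\<integral>z. F z * cnj (z powi j) \<partial>circle_measure q)"
      by (rule integral_boundary_measure[OF L2_integrable_mult_cnj[OF FL powL]])
    \<comment> \<open>Cauchy's theorem makes the integral \<open>J (j - k)\<close> the same for both
      circles, so what remains is the sum of two constants of opposite sign.\<close>
    also have "\<dots> = of_real (s * (exp a0 * (1 powr \<alpha>)\<^sup>2 * (1 powi k)\<^sup>2)) * cnj (J (j - k))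
      + of_real (- s * (exp b0 * (q powr \<alpha>)\<^sup>2 * (q powi k)\<^sup>2)) * cnj (J (j - k))"
      using *[OF _ L1 h1] *[OF q(1) Lq hq] unfolding J_def[symmetric] Jq[symmetric] by simp
    also have "\<dots> = 0"
      unfolding exp_ab[symmetric] by simp
    finally show ?thesis .
  qed
  show ?thesis
  proof (rule toeplitz_eigenvalueI[OF q(1) phi fH])
    show "\<not> (AE z in boundary_measure q. f z = 0)"
    proof
      assume "AE z in boundary_measure q. f z = 0"
      \<comment> \<open>Neither exp(h) nor a power of z vanishes off the origin, so vanishing almost
        everywhere would force the boundary to have measure 0.\<close>
      then have "AE z in boundary_measure q. False"
        using AE_boundary_measure_nonzero[OF q(1)]
        by eventually_elim (auto simp: f_def f0_def chi_pow_def)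
      then have "emeasure (boundary_measure q) UNIV = 0"
        using AE_iff_null[of "boundary_measure q" "\<lambda>_. False"] by (simp add: null_sets_def)
      then show False
        using measure_boundary_measure[of q] by (simp add: measure_def)
    qed
    fix u assume u: "u \<in> H2 q \<alpha>"
    then obtain g where g: "g \<in> H2_0 q" "AE z in boundary_measure q. u z = chi_pow \<alpha> z * g z"
      unfolding H2_def by auto
    have "L2_inner q (\<lambda>z. (complex_of_real (\<phi> z) - complex_of_real x) * f z) u = (\<integral>z. F z * cnj (g z) \<partial>boundary_measure q)"
      unfolding L2_inner_def
    proof (rule integral_cong_AE)
      show "AE z in boundary_measure q. (complex_of_real (\<phi> z) - complex_of_real x) * f z * cnj (u z) = F z * cnj (g z)"
        using g(2)
      proof eventually_elim
        case (elim z)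
        have c: "chi_pow \<alpha> z * cnj (chi_pow \<alpha> z) = of_real ((cmod z powr \<alpha>)\<^sup>2)"
          by (simp only: complex_norm_square[symmetric] norm_chi_pow)
        have "(complex_of_real (\<phi> z) - complex_of_real x) * f z * cnj (u z)
            = of_real (\<phi> z - x) * (chi_pow \<alpha> z * cnj (chi_pow \<alpha> z)) * f0 z * cnj (g z)"
          unfolding elim f_def by (simp only: complex_cnj_mult of_real_diff mult_ac)
        then show ?case
          unfolding c F_def by (simp only: of_real_mult mult_ac)
      qed
      have "f \<in> borel_measurable borel" "u \<in> borel_measurable borel" "g \<in> borel_measurable borel"
        using fH u g(1) by (auto simp: H2_def H2_0_def L2_def)
      then show "(\<lambda>z. (complex_of_real (\<phi> z) - complex_of_real x) * f z * cnj (u z)) \<in> borel_measurable (boundary_measure q)"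
        "(\<lambda>z. F z * cnj (g z)) \<in> borel_measurable (boundary_measure q)"
        using phi(1) Fm by auto
    qed
    also have "\<dots> = 0"
      by (rule orthogonal_H2_0[OF q(1) Fm F_le g(1) orth])
    finally show "L2_inner q (\<lambda>z. (complex_of_real (\<phi> z) - complex_of_real x) * f z) u = 0" .
  qed
qed

section \<open>Logarithmic integrals across the gap\<close>

lemma abs_ln_abs_le:
  fixes y t :: real
  assumes "0 < \<delta>" "\<delta> \<le> \<bar>y - t\<bar>" "\<bar>y\<bar> \<le> C"
  shows "\<bar>ln \<bar>y - t\<bar>\<bar> \<le> \<bar>ln \<delta>\<bar> + \<bar>ln (C + \<bar>t\<bar>)\<bar>"
proof -
  have "ln \<delta> \<le> ln \<bar>y - t\<bar>" "ln \<bar>y - t\<bar> \<le> ln (C + \<bar>t\<bar>)"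
    using assms by (auto intro!: ln_mono)
  then show ?thesis by linarith
qed

section \<open>The logarithmic integral over one circle as a function of the spectral
  parameter\<close>

locale spectral_gap = finite_measure \<nu> for \<nu> :: "'a measure" +
  fixes \<psi> :: "'a \<Rightarrow> real" and C a b :: real
  assumes psi_measurable [measurable]: "\<psi> \<in> borel_measurable \<nu>"
    and psi_bounded: "AE z in \<nu>. \<bar>\<psi> z\<bar> \<le> C"
    and psi_gap: "AE z in \<nu>. \<psi> z \<le> a \<or> b \<le> \<psi> z"
begin

definition log_integral :: "real \<Rightarrow> real" where
  "log_integral t = (\<integral>z. ln \<bar>\<psi> z - t\<bar> \<partial>\<nu>)"

lemma abs_diff_ge_gap:
  assumes "a < t" "t < b"
  shows "AE z in \<nu>. min (t - a) (b - t) \<le> \<bar>\<psi> z - t\<bar>"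
  using psi_gap by eventually_elim (use assms in auto)

lemma integrable_ln:
  assumes "a < t" "t < b"
  shows "integrable \<nu> (\<lambda>z. ln \<bar>\<psi> z - t\<bar>)"
proof (rule integrable_const_bound)
  show "AE z in \<nu>. norm (ln \<bar>\<psi> z - t\<bar>) \<le> \<bar>ln (min (t - a) (b - t))\<bar> + \<bar>ln (C + \<bar>t\<bar>)\<bar>"
    using abs_diff_ge_gap[OF assms] psi_bounded
  proof eventually_elim
    case (elim z)
    then show ?case using abs_ln_abs_le[OF _ elim] assms by simp
  qed
qed measurable

lemma abs_log_integral_le:
  assumes "0 < \<delta>" "AE z in \<nu>. \<delta> \<le> \<bar>\<psi> z - t\<bar>" "\<bar>t\<bar> \<le> T" "1 \<le> C + \<bar>t\<bar>"
  shows "\<bar>log_integral t\<bar> \<le> (\<bar>ln \<delta>\<bar> + ln (C + T)) * measure \<nu> (space \<nu>)"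
proof -
  let ?B = "\<bar>ln \<delta>\<bar> + ln (C + T)"
  have bnd: "AE z in \<nu>. norm (ln \<bar>\<psi> z - t\<bar>) \<le> ?B"
    using assms(2) psi_bounded
  proof eventually_elim
    case (elim z)
    have "ln (C + \<bar>t\<bar>) \<ge> 0" "ln (C + \<bar>t\<bar>) \<le> ln (C + T)"
      using assms by auto
    then show ?case using abs_ln_abs_le[OF assms(1) elim] by simp
  qed
  have "norm (log_integral t) \<le> (\<integral>z. norm (ln \<bar>\<psi> z - t\<bar>) \<partial>\<nu>)"
    unfolding log_integral_def by (rule integral_norm_bound)
  also have "\<dots> \<le> (\<integral>z. ?B \<partial>\<nu>)"
    using bnd by (intro integral_mono_AE integrable_norm integrable_const_bound[where B = ?B]) auto
  finally show ?thesis by (simp add: mult.commute)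
qed

text \<open>Inside the gap the distance from \<open>t\<close> to the values of \<open>\<psi>\<close>
  is bounded below locally uniformly, which gives a constant majorant for the logarithms.\<close>

lemma continuous_on_log_integral: "continuous_on {a<..<b} log_integral"
  unfolding continuous_on_sequentially
proof (intro allI ballI impI)
  fix X t assume t: "t \<in> {a<..<b}" and X: "(\<forall>n. X n \<in> {a<..<b}) \<and> X \<longlonglongrightarrow> t"
  \<comment> \<open>Half the distance from \<open>t\<close> to the ends of the gap: moving
    \<open>t\<close> by less than \<delta> leaves a distance of at least \<delta> to the values of
    \<open>\<psi>\<close>.\<close>
  define \<delta> where "\<delta> = min (t - a) (b - t) / 2"
  have \<delta>: "\<delta> > 0" using t by (simp add: \<delta>_def)
  obtain N where N: "\<And>n. n \<ge> N \<Longrightarrow> \<bar>X n - t\<bar> < \<delta>"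
    using X \<delta> unfolding LIMSEQ_def dist_real_def by blast
  define T where "T = \<bar>t\<bar> + \<delta>"
  have lim: "(\<lambda>n. X (n + N)) \<longlonglongrightarrow> t"
    using X by (simp add: LIMSEQ_ignore_initial_segment)
  have ge: "AE z in \<nu>. \<forall>s. \<bar>s - t\<bar> < \<delta> \<longrightarrow> \<delta> \<le> \<bar>\<psi> z - s\<bar>"
  proof -
    have "AE z in \<nu>. 2 * \<delta> \<le> \<bar>\<psi> z - t\<bar>"
      using abs_diff_ge_gap[of t] t by (simp add: \<delta>_def)
    then show ?thesis
      by (rule eventually_mono) (intro allI impI, linarith)
  qed
  have "(\<lambda>n. log_integral (X (n + N))) \<longlonglongrightarrow> log_integral t"
    unfolding log_integral_def
  proof (rule integral_dominated_convergence[where w = "\<lambda>_. \<bar>ln \<delta>\<bar> + ln (\<bar>C\<bar> + T + 1)"])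
    show "AE z in \<nu>. (\<lambda>n. ln \<bar>\<psi> z - X (n + N)\<bar>) \<longlonglongrightarrow> ln \<bar>\<psi> z - t\<bar>"
      using ge
    proof eventually_elim
      case (elim z)
      then have "\<delta> \<le> \<bar>\<psi> z - t\<bar>" using \<delta> by auto
      then have "\<bar>\<psi> z - t\<bar> \<noteq> 0" using \<delta> by auto
      then show ?case by (intro tendsto_intros lim)
    qed
    show "AE z in \<nu>. norm (ln \<bar>\<psi> z - X (n + N)\<bar>) \<le> \<bar>ln \<delta>\<bar> + ln (\<bar>C\<bar> + T + 1)" for n
      using ge psi_bounded
    proof eventually_elim
      case (elim z)
      have 1: "\<bar>X (n + N) - t\<bar> < \<delta>" using N by simp
      \<comment> \<open>The bound is enlarged so that the argument of the upper logarithm is at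
        least 1, hence that logarithm is its own absolute value.\<close>
      have 2: "\<bar>\<psi> z\<bar> \<le> \<bar>C\<bar> + 1" using elim by linarith
      have 3: "\<delta> \<le> \<bar>\<psi> z - X (n + N)\<bar>" using elim(1) 1 by blast
      have "1 \<le> \<bar>C\<bar> + 1 + \<bar>X (n + N)\<bar>" "\<bar>C\<bar> + 1 + \<bar>X (n + N)\<bar> \<le> \<bar>C\<bar> + T + 1"
        using 1 unfolding T_def by linarith+
      then have "0 \<le> ln (\<bar>C\<bar> + 1 + \<bar>X (n + N)\<bar>)" "ln (\<bar>C\<bar> + 1 + \<bar>X (n + N)\<bar>) \<le> ln (\<bar>C\<bar> + T + 1)"
        by (auto intro!: ln_mono)
      then show ?case using abs_ln_abs_le[OF \<delta> 3 2] by simp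
    qed
  qed simp_all
  then show "(log_integral \<circ> X) \<longlonglongrightarrow> log_integral t"
    unfolding o_def by (rule LIMSEQ_offset)
qed

text \<open>Fatou's lemma for the nonnegative functions ln D - ln |\<psi> - X n|. Their integrals
  are bounded by the lower bound on \<open>log_integral\<close>, and their lower limit dominates the
  negative part of the logarithm at \<open>e\<close>.\<close>

lemma log_integral_bounded_imp_finite:
  assumes X: "\<And>n. a < X n" "\<And>n. X n < b" "X \<longlonglongrightarrow> e"
    and e: "e = a \<or> e = b" and K: "\<And>n. - K \<le> log_integral (X n)"
  shows "(\<integral>\<^sup>+z. e2ennreal (- log_abs (\<psi> z - e)) \<partial>\<nu>) < \<infinity>"
proof -
  \<comment> \<open>Large enough that |\<psi> - X n| \<le> D almost everywhere, and at least 1 so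
    that adding ln D only increases the negative part.\<close>
  define D where "D = \<bar>C\<bar> + \<bar>a\<bar> + \<bar>b\<bar> + 1"
  have D: "D \<ge> 1" by (simp add: D_def)
  define g where "g n z = ln D - ln \<bar>\<psi> z - X n\<bar>" for n z
  have g_nonneg: "AE z in \<nu>. \<forall>n. 0 \<le> g n z"
    unfolding AE_all_countable
  proof
    fix n
    show "AE z in \<nu>. 0 \<le> g n z"
      using abs_diff_ge_gap[OF X(1,2)[of n]] psi_bounded
    proof eventually_elim
      case (elim z)
      have "0 < \<bar>\<psi> z - X n\<bar>" using elim(1) X(1,2)[of n] by (simp add: min_def split: if_splits)
      moreover have "\<bar>\<psi> z - X n\<bar> \<le> D" using elim X(1,2)[of n] unfolding D_def by linarith
      ultimately show ?case by (auto simp: g_def)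
    qed
  qed
  have "(\<integral>\<^sup>+z. e2ennreal (- log_abs (\<psi> z - e)) \<partial>\<nu>) \<le> (\<integral>\<^sup>+z. liminf (\<lambda>n. ennreal (g n z)) \<partial>\<nu>)"
  proof (rule nn_integral_mono)
    fix z
    show "e2ennreal (- log_abs (\<psi> z - e)) \<le> liminf (\<lambda>n. ennreal (g n z))"
    proof (cases "\<psi> z = e")
      case False
      have "(\<lambda>n. ennreal (g n z)) \<longlonglongrightarrow> ennreal (ln D - ln \<bar>\<psi> z - e\<bar>)"
        unfolding g_def using False by (intro tendsto_intros X(3)) auto
      then have "liminf (\<lambda>n. ennreal (g n z)) = ennreal (ln D - ln \<bar>\<psi> z - e\<bar>)"
        by (intro lim_imp_Liminf) simp_all
      moreover have "e2ennreal (- log_abs (\<psi> z - e)) = ennreal (- ln \<bar>\<psi> z - e\<bar>)"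
        using False by (simp add: log_abs_def ennreal.rep_eq e2ennreal_ereal)
      moreover have "ln D \<ge> 0" using D by simp
      ultimately show ?thesis by (auto intro!: ennreal_leI)
    next
      \<comment> \<open>Here \<open>log_abs\<close> is -\<infinity>, while \<open>ln\<close> has the
        default value 0 at 0, so passing to the limit inside \<open>ln\<close> would be wrong.
        Instead the lower limit is shown to exceed every finite bound, using that \<open>X n\<close>
        stays strictly inside the gap and so differs from \<open>e\<close>.\<close>
      case True
      have "y \<le> liminf (\<lambda>n. ennreal (g n z))" if "y < top" for y :: ennreal
      proof (rule Liminf_bounded)
        define c where "c = enn2real y"
        have c: "y = ennreal c" using that by (simp add: c_def)
        have "(\<lambda>n. \<bar>\<psi> z - X n\<bar>) \<longlonglongrightarrow> \<bar>\<psi> z - e\<bar>" by (intro tendsto_intros X(3))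
        then have "\<forall>\<^sub>F n in sequentially. \<bar>\<psi> z - X n\<bar> < exp (ln D - c)"
          by (rule order_tendstoD) (simp add: True)
        then show "\<forall>\<^sub>F n in sequentially. y \<le> ennreal (g n z)"
        proof eventually_elim
          case (elim n)
          have "0 < \<bar>\<psi> z - X n\<bar>" using True X(1,2)[of n] e by auto
          then have "ln \<bar>\<psi> z - X n\<bar> < ln (exp (ln D - c))"
            using elim by (subst ln_less_cancel_iff) auto
          then show ?case unfolding c g_def by (intro ennreal_leI) simp
        qed
      qed
      then have "liminf (\<lambda>n. ennreal (g n z)) = top"
        by (metis dense leD top.not_eq_extremum)
      then show ?thesis by simp
    qed
  qed
  also have "\<dots> \<le> liminf (\<lambda>n. \<integral>\<^sup>+z. ennreal (g n z) \<partial>\<nu>)"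
    by (rule nn_integral_liminf) (simp add: g_def)
  also have "\<dots> \<le> ennreal (ln D * measure \<nu> (space \<nu>) + K)"
  proof (rule Liminf_le)
    have "(\<integral>\<^sup>+z. ennreal (g n z) \<partial>\<nu>) \<le> ennreal (ln D * measure \<nu> (space \<nu>) + K)" for n
    proof -
      have i: "integrable \<nu> (g n)"
        unfolding g_def[abs_def] by (intro Bochner_Integration.integrable_diff integrable_ln X) simp
      have "(\<integral>\<^sup>+z. ennreal (g n z) \<partial>\<nu>) = ennreal (\<integral>z. g n z \<partial>\<nu>)"
        using g_nonneg by (intro nn_integral_eq_integral i) auto
      also have "(\<integral>z. g n z \<partial>\<nu>) = ln D * measure \<nu> (space \<nu>) - log_integral (X n)"
        unfolding g_def log_integral_def using integrable_ln[OF X(1,2)] by (simp add: mult.commute)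
      finally show ?thesis using K[of n] by (auto intro!: ennreal_leI)
    qed
    then show "\<forall>\<^sub>F n in sequentially. (\<integral>\<^sup>+z. ennreal (g n z) \<partial>\<nu>) \<le> ennreal (ln D * measure \<nu> (space \<nu>) + K)"
      by simp
  qed simp
  finally show ?thesis by (simp add: order_le_less_trans ennreal_less_top)
qed

end

text \<open>The normalisation \<open>1 \<le> C\<close> keeps the logarithms of C + |t|
  nonnegative.\<close>

lemma real_Linfty_bounded:
  assumes "\<phi> \<in> real_Linfty q"
  obtains C where "1 \<le> C" "AE z in boundary_measure q. \<bar>\<phi> z\<bar> \<le> C"
proof -
  let ?e = "esssup (boundary_measure q) (\<lambda>z. ereal \<bar>\<phi> z\<bar>)"
  have "?e < \<infinity>" using assms by (simp add: real_Linfty_def)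
  then obtain C where "?e \<le> ereal C"
    by (cases ?e) auto
  then have "AE z in boundary_measure q. \<bar>\<phi> z\<bar> \<le> max 1 C"
    using esssup_AE[of "\<lambda>z. ereal \<bar>\<phi> z\<bar>" "boundary_measure q"]
    by (auto elim!: eventually_mono dest: order_trans simp: max.coboundedI2)
  then show thesis by (rule that[rotated]) simp
qed

lemma esssup_eq_imp_AE: "esssup M (\<lambda>z. ereal (f z)) = ereal m \<Longrightarrow> AE z in M. f z \<le> m"
  using esssup_AE[of "\<lambda>z. ereal (f z)" M] by simp

lemma essinf_eq_imp_AE:
  assumes "ereal m = essinf M (\<lambda>z. ereal (f z))"
  shows "AE z in M. m \<le> f z"
proof -
  have "esssup M (\<lambda>z. ereal (- f z)) = ereal (- m)"
    using assms unfolding essinf_def by (cases "esssup M (\<lambda>z. ereal (- f z))") auto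
  from esssup_eq_imp_AE[OF this] show ?thesis by simp
qed

text \<open>Near one end of the gap the integral over the measure on the other side stays bounded, so a
  bounded difference would bound both integrals there, and Fatou's lemma would make both
  logarithmic integrals at that end finite.\<close>

lemma log_integral_diff_unbounded:
  fixes \<phi> :: "'a \<Rightarrow> real"
  assumes g: "spectral_gap \<nu> \<phi> C m M" "spectral_gap \<nu>' \<phi> C m M" and mM: "m < M" and C: "1 \<le> C"
    and upper: "AE z in \<nu>. M \<le> \<phi> z" and lower: "AE z in \<nu>'. \<phi> z \<le> m"
    and e: "e = m \<or> e = M"
    and inf: "(\<integral>\<^sup>+z. e2ennreal (- log_abs (\<phi> z - e)) \<partial>\<nu>) = \<infinity> \<or>
              (\<integral>\<^sup>+z. e2ennreal (- log_abs (\<phi> z - e)) \<partial>\<nu>') = \<infinity>"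
  shows "\<exists>t. m < t \<and> t < M \<and> K < \<bar>spectral_gap.log_integral \<nu> \<phi> t - spectral_gap.log_integral \<nu>' \<phi> t\<bar>"
proof (rule ccontr)
  interpret U: spectral_gap \<nu> \<phi> C m M by fact
  interpret V: spectral_gap \<nu>' \<phi> C m M by fact
  assume "\<not> ?thesis"
  then have K: "\<bar>U.log_integral t - V.log_integral t\<bar> \<le> K" if "m < t" "t < M" for t
    using that by (meson linorder_not_less)
  define \<delta> where "\<delta> = (M - m) / 2"
  have \<delta>: "\<delta> > 0" using mM by (simp add: \<delta>_def)
  define T where "T = \<bar>m\<bar> + \<bar>M\<bar>"
  \<comment> \<open>Starts at the midpoint of the gap and tends to \<open>e\<close> from inside, so
    the distance to the opposite end never drops below \<delta>.\<close>
  define X where "X n = e + (if e = m then \<delta> else - \<delta>) * inverse (real (Suc n))" for n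
  have inv: "0 < \<delta> * inverse (real (Suc n))" "\<delta> * inverse (real (Suc n)) \<le> \<delta>" for n
    using \<delta> by (auto simp: field_simps)
  have \<delta>2: "2 * \<delta> = M - m" by (simp add: \<delta>_def)
  have Xm: "m < X n" "X n \<le> m + \<delta>" if "e = m" for n
    unfolding X_def if_P[OF that] using inv[of n] that by linarith+
  have XM: "X n < M" "M - \<delta> \<le> X n" if "e \<noteq> m" for n
    unfolding X_def if_not_P[OF that] mult_minus_left using inv[of n] that e by linarith+
  have X: "m < X n" "X n < M" for n
    using Xm[of n] XM[of n] \<delta> \<delta>2 by (cases "e = m"; linarith)+
  have "(\<lambda>n. e + (if e = m then \<delta> else - \<delta>) * inverse (real (Suc n))) \<longlonglongrightarrow> e + (if e = m then \<delta> else - \<delta>) * 0"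
    by (intro tendsto_intros LIMSEQ_inverse_real_of_nat)
  then have lim: "X \<longlonglongrightarrow> e" unfolding X_def[abs_def] by simp
  have Xle: "\<bar>X n\<bar> \<le> T" "1 \<le> C + \<bar>X n\<bar>" for n
    using X[of n] C unfolding T_def by linarith+
  obtain K' where K': "\<And>n. - K' \<le> U.log_integral (X n)" "\<And>n. - K' \<le> V.log_integral (X n)"
  proof (cases "e = m")
    case True
    have bnd: "\<bar>U.log_integral (X n)\<bar> \<le> (\<bar>ln \<delta>\<bar> + ln (C + T)) * measure \<nu> (space \<nu>)" for n
    proof (rule U.abs_log_integral_le[OF \<delta> _ Xle])
      show "AE z in \<nu>. \<delta> \<le> \<bar>\<phi> z - X n\<bar>"
        using upper by (rule eventually_mono) (use Xm(2)[OF True, of n] \<delta>2 in linarith)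
    qed
    define K' where "K' = (\<bar>ln \<delta>\<bar> + ln (C + T)) * measure \<nu> (space \<nu>) + \<bar>K\<bar>"
    have "- K' \<le> U.log_integral (X n) \<and> - K' \<le> V.log_integral (X n)" for n
      using bnd[of n] K[OF X, of n] unfolding K'_def by linarith
    then show thesis
      using that by blast
  next
    case False
    have bnd: "\<bar>V.log_integral (X n)\<bar> \<le> (\<bar>ln \<delta>\<bar> + ln (C + T)) * measure \<nu>' (space \<nu>')" for n
    proof (rule V.abs_log_integral_le[OF \<delta> _ Xle])
      show "AE z in \<nu>'. \<delta> \<le> \<bar>\<phi> z - X n\<bar>"
        using lower by (rule eventually_mono) (use XM(2)[OF False, of n] \<delta>2 in linarith)
    qed
    define K' where "K' = (\<bar>ln \<delta>\<bar> + ln (C + T)) * measure \<nu>' (space \<nu>') + \<bar>K\<bar>"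
    have "- K' \<le> U.log_integral (X n) \<and> - K' \<le> V.log_integral (X n)" for n
      using bnd[of n] K[OF X, of n] unfolding K'_def by linarith
    then show thesis
      using that by blast
  qed
  show False
    using inf U.log_integral_bounded_imp_finite[OF X lim e K'(1)]
      V.log_integral_bounded_imp_finite[OF X lim e K'(2)] by (metis less_irrefl)
qed

section \<open>Intermediate values in an arithmetic progression\<close>

lemma exists_int_in_interval:
  fixes c \<alpha> p :: real
  assumes "c < 0"
  shows "\<exists>k::int. p \<le> c * (\<alpha> + of_int k) \<and> c * (\<alpha> + of_int k) \<le> p - c"
proof (intro exI conjI)
  let ?k = "\<lfloor>p / c - \<alpha>\<rfloor>"
  have "\<alpha> + of_int ?k \<le> p / c" "p / c < \<alpha> + of_int ?k + 1"
    by linarith+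
  then show "p \<le> c * (\<alpha> + of_int ?k)" "c * (\<alpha> + of_int ?k) \<le> p - c"
    using assms by (simp_all add: field_simps)
qed

text \<open>Finitely many solutions would bound the attained terms of the progression. But the
  connected image reaches beyond any bound in at least one direction, by more than one step of the
  progression, so the intermediate value theorem yields a further term.\<close>

lemma infinite_vimage_progression:
  fixes f :: "real \<Rightarrow> real"
  assumes c: "c < 0" and cont: "continuous_on {a<..<b} f" and ab: "a < b"
    and unbounded: "\<And>K. \<exists>t. a < t \<and> t < b \<and> K < \<bar>f t\<bar>"
  shows "infinite {t. a < t \<and> t < b \<and> (\<exists>k::int. f t = c * (\<alpha> + of_int k))}"
proof
  let ?E = "{t. a < t \<and> t < b \<and> (\<exists>k::int. f t = c * (\<alpha> + of_int k))}"
  assume "finite ?E"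
  then have "bounded (f ` ?E)" by (intro finite_imp_bounded finite_imageI)
  then obtain R where R: "\<And>t. t \<in> ?E \<Longrightarrow> \<bar>f t\<bar> \<le> R"
    unfolding bounded_iff by auto
  define y0 where "y0 = f ((a + b) / 2)"
  \<comment> \<open>Beyond all the solutions' values and beyond the value at the midpoint: an
    interval of length -c starting at R', or its mirror image, then lies between that value and
    \<open>f t\<close>.\<close>
  define R' where "R' = max 0 (max R \<bar>y0\<bar>) + 1"
  have R': "R' > 0" "R' > R" "R' > \<bar>y0\<bar>" by (auto simp: R'_def)
  let ?I = "f ` {a<..<b}"
  have conn: "x \<in> ?I" if "y \<in> ?I" "y' \<in> ?I" "y \<le> x" "x \<le> y'" for x y y'
    using connectedD_interval[OF connected_continuous_image[OF cont] that(1,2)] that(3,4) connected_Ioo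
    by auto
  have y0: "y0 \<in> ?I" unfolding y0_def using ab by (intro imageI) auto
  obtain t where t: "a < t" "t < b" "R' - c < \<bar>f t\<bar>" using unbounded by blast
  then have ft: "f t \<in> ?I" by auto
  have "\<exists>k::int. c * (\<alpha> + of_int k) \<in> ?I \<and> R < \<bar>c * (\<alpha> + of_int k)\<bar>"
  proof (cases "f t > 0")
    case True
    obtain k :: int where k: "R' \<le> c * (\<alpha> + of_int k)" "c * (\<alpha> + of_int k) \<le> R' - c"
      using exists_int_in_interval[OF c] by blast
    have "c * (\<alpha> + of_int k) \<in> ?I"
      by (rule conn[OF y0 ft]) (use k t True R' in linarith)+
    then show ?thesis using k R' by (intro exI[of _ k]) linarith
  next
    case False
    obtain k :: int where k: "- R' + c \<le> c * (\<alpha> + of_int k)" "c * (\<alpha> + of_int k) \<le> (- R' + c) - c"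
      using exists_int_in_interval[OF c] by blast
    have "c * (\<alpha> + of_int k) \<in> ?I"
      by (rule conn[OF ft y0]) (use k t False R' in linarith)+
    then show ?thesis using k R' by (intro exI[of _ k]) linarith
  qed
  then obtain k :: int and t' where "t' \<in> {a<..<b}" "f t' = c * (\<alpha> + of_int k)" "R < \<bar>f t'\<bar>"
    by (metis imageE)
  then have "t' \<in> ?E" by auto
  with R[of t'] \<open>R < \<bar>f t'\<bar>\<close> show False by simp
qed

theorem corollary2p4:
  fixes q m M \<alpha> :: real and \<phi> :: "complex \<Rightarrow> real"
  assumes q: "0 < q" "q < 1"
    and phi: "\<phi> \<in> real_Linfty q"
    and gap:
      "(esssup (circle_measure q) (\<lambda>z. ereal (\<phi> z)) = ereal m \<and> m < 0 \<and> 0 < M \<and>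
          ereal M = essinf (circle_measure 1) (\<lambda>z. ereal (\<phi> z))) \<or>
       (esssup (circle_measure 1) (\<lambda>z. ereal (\<phi> z)) = ereal m \<and> m < 0 \<and> 0 < M \<and>
          ereal M = essinf (circle_measure q) (\<lambda>z. ereal (\<phi> z)))"
    and log_integral:
      "ext_integral (boundary_measure q) (\<lambda>z. log_abs (\<phi> z - M)) = - \<infinity> \<or>
       ext_integral (boundary_measure q) (\<lambda>z. log_abs (\<phi> z - m)) = - \<infinity>"
    and alpha: "0 \<le> \<alpha>" "\<alpha> < 1"
  shows "infinite {x :: real. m < x \<and> x < M \<and> toeplitz_eigenvalue q \<alpha> \<phi> (of_real x)}"
proof -
  have mM: "m < M" using gap by linarith
  have phim: "\<phi> \<in> borel_measurable borel"
    using phi by (auto simp: real_Linfty_def)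
  obtain C where C: "1 \<le> C" "AE z in boundary_measure q. \<bar>\<phi> z\<bar> \<le> C"
    using real_Linfty_bounded[OF phi] by blast
  \<comment> \<open>Both alternatives of the gap hypothesis are merged into a sign, positive when
    \<open>\<phi>\<close> lies above the gap on the outer circle.\<close>
  obtain s :: real where s: "s = 1 \<or> s = - 1"
    and g1: "(s = 1 \<and> (AE z in circle_measure 1. M \<le> \<phi> z) \<and> (AE z in circle_measure q. \<phi> z \<le> m)) \<or>
             (s = - 1 \<and> (AE z in circle_measure q. M \<le> \<phi> z) \<and> (AE z in circle_measure 1. \<phi> z \<le> m))"
    using gap essinf_eq_imp_AE[of M _ \<phi>] esssup_eq_imp_AE[of _ \<phi> m] by blast
  have sg: "spectral_gap (circle_measure 1) \<phi> C m M" "spectral_gap (circle_measure q) \<phi> C m M"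
    unfolding spectral_gap_def spectral_gap_axioms_def
    using phim C(2) g1 unfolding AE_boundary_measure_iff by (auto elim: eventually_mono)
  interpret U: spectral_gap "circle_measure 1" \<phi> C m M by (rule sg)
  interpret V: spectral_gap "circle_measure q" \<phi> C m M by (rule sg)
  \<comment> \<open>A logarithmic integral equal to -\<infinity> has a divergent negative part,
    which must diverge on one of the two circles.\<close>
  obtain e where e: "e = m \<or> e = M"
    and "(\<integral>\<^sup>+z. e2ennreal (- log_abs (\<phi> z - e)) \<partial>boundary_measure q) = \<infinity>"
    using log_integral unfolding ext_integral_eq_MInf_iff by blast
  moreover have "(\<lambda>z. e2ennreal (- log_abs (\<phi> z - e))) \<in> borel_measurable borel"
    unfolding log_abs_def using phim by measurable
  ultimately have inf: "(\<integral>\<^sup>+z. e2ennreal (- log_abs (\<phi> z - e)) \<partial>circle_measure 1) = \<infinity> \<or>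
      (\<integral>\<^sup>+z. e2ennreal (- log_abs (\<phi> z - e)) \<partial>circle_measure q) = \<infinity>"
    by (simp add: nn_integral_boundary_measure)
  define f where "f t = U.log_integral t - V.log_integral t" for t
  have "\<exists>t. m < t \<and> t < M \<and> K < \<bar>f t\<bar>" for K
    using g1
  proof (elim disjE conjE)
    assume "AE z in circle_measure 1. M \<le> \<phi> z" "AE z in circle_measure q. \<phi> z \<le> m"
    from log_integral_diff_unbounded[OF sg mM C(1) this e inf] show ?thesis
      unfolding f_def .
  next
    assume "AE z in circle_measure q. M \<le> \<phi> z" "AE z in circle_measure 1. \<phi> z \<le> m"
    \<comment> \<open>The upper measure comes first, so the circles are exchanged here; this
      reverses the sign of \<open>f\<close>, which the absolute value hides.\<close>
    from log_integral_diff_unbounded[OF sg(2,1) mM C(1) this e] inf show ?thesis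
      unfolding f_def abs_minus_commute[of "U.log_integral _"] by blast
  qed
  moreover have "continuous_on {m<..<M} f"
    unfolding f_def[abs_def] by (intro continuous_on_diff U.continuous_on_log_integral V.continuous_on_log_integral)
  moreover have "4 * pi * ln q < 0"
    using q by (simp add: mult_pos_neg)
  ultimately have "infinite {t. m < t \<and> t < M \<and> (\<exists>k::int. f t = (4 * pi * ln q) * (\<alpha> + of_int k))}"
    using mM by (intro infinite_vimage_progression)
  moreover have "toeplitz_eigenvalue q \<alpha> \<phi> (of_real t)"
    if t: "m < t" "t < M" and k: "f t = (4 * pi * ln q) * (\<alpha> + of_int k)" for t and k :: int
  proof (rule toeplitz_eigenvalue_condition[OF q phim C(2) s])
    show "min (M - t) (t - m) > 0" using t by simp
    show "AE z in circle_measure 1. min (M - t) (t - m) \<le> s * (\<phi> z - t)"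
      using g1 by (auto elim!: eventually_mono)
    show "AE z in circle_measure q. min (M - t) (t - m) \<le> - s * (\<phi> z - t)"
      using g1 by (auto elim!: eventually_mono)
    show "(\<integral>z. ln \<bar>\<phi> z - t\<bar> \<partial>circle_measure 1) - (\<integral>z. ln \<bar>\<phi> z - t\<bar> \<partial>circle_measure q)
        = 4 * pi * (\<alpha> + of_int k) * ln q"
      using k by (simp add: f_def U.log_integral_def V.log_integral_def mult_ac)
  qed
  ultimately show ?thesis
    by (elim infinite_super[rotated]) blast
qed

end
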